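(* If $(\Phi_n)$ is a family of acyclic conjunctive queries of size polynomially bounded in $n$ and of quantified star size bounded by a constant, then $(Q(\Phi_n))\in\mathbf{VP}$. Moreover, every family in $\mathbf{VP}$ is a p-projection of a family $(Q(\Phi_n))$ where the $\Phi_n$ are quantifier-free conjunctive queries of polynomial size whose hypergraph is a tree.
   Context: A conjunctive query $\Phi=(\mathcal{S},\phi)$: $\mathcal{S}$ finite relational structure with domain $D$, $\phi$ built from atoms with $\wedge,\exists$; $Q(\Phi)=\sum_{a\in\phi(\mathcal{S})}\prod_{x\in\mathrm{free}(\phi)}X_{a(x)}$, where $\phi(\mathcal{S})$ is the set of assignments $a$ of the free variables into $D$ satisfying $\phi$, in variables $X_d$ ($d\in D$). The hypergraph of $\phi$ has the variables as vertices and variable sets of atoms as hyperedges; acyclic means having a join tree (tree with nodes labeled by hyperedges, each used, such that for each vertex the nodes whose labels contain it are connected). For $\mathcal{H}=(V,E)$, $S\subseteq V$: $\mathcal{H}[S]=(S,\{e\cap S:e\cap S\ne\emptyset\})$, $\mathcal{H}[E']=(\bigcup E',E')$; a path from $A$ to $B$ is a sequence of hyperedges, consecutive intersecting, first meeting $A$, last meeting $B$; the $S$-component of $e\not\subseteq S$ is $\mathcal{H}[E']$ with $E'$ all $e'\not\subseteq S$ reachable by a path from $e\setminus S$ to $e'\setminus S$ in $\mathcal{H}[V\setminus S]$; an $S$-component $(V',E')$ is an $S$-$k$-star if some $y_1,\dots,y_k\in V'\cap S$ have no edge of $E$ containing two of them; the quantified star size is the maximal such $k$ with $S$ the free variables.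 $\mathbf{VP}$ is the class of polynomial families $(f_n)$ over a field of polynomially bounded degree computed by polynomial-size arithmetic circuits. $f$ is a projection of $g$ if $f=g(a_1,\dots,a_q)$ with each $a_i$ a field constant or a variable; $(f_n)$ is a p-projection of $(g_n)$ if there is a polynomial $r$ with $f_n$ a projection of $g_{r(n)}$ for all $n$. *)

theory Defs
  imports Main "HOL-Library.Poly_Mapping" "HOL-Library.FuncSet"
    "HOL-Computational_Algebra.Polynomial"
begin

section \<open>Multivariate polynomials in variables X_0, X_1, ... over a field\<close>

type_synonym 'a mpoly = "(nat \<Rightarrow>\<^sub>0 nat) \<Rightarrow>\<^sub>0 'a"

definition mvar :: "nat \<Rightarrow> 'a::comm_ring_1 mpoly" where
  "mvar i = Poly_Mapping.single (Poly_Mapping.single i 1) 1"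

definition mconst :: "'a::comm_ring_1 \<Rightarrow> 'a mpoly" where
  "mconst c = Poly_Mapping.single 0 c"

definition total_degree :: "'a::zero mpoly \<Rightarrow> nat" where
  "total_degree p = Max (insert 0 ((\<lambda>m. \<Sum>i\<in>Poly_Mapping.keys m. Poly_Mapping.lookup m i) ` Poly_Mapping.keys p))"

text \<open>Substitution of the variables X_i by polynomials s i.\<close>
definition msubst :: "(nat \<Rightarrow> 'a::comm_ring_1 mpoly) \<Rightarrow> 'a mpoly \<Rightarrow> 'a mpoly" where
  "msubst s p = (\<Sum>m\<in>Poly_Mapping.keys p. mconst (Poly_Mapping.lookup p m) * (\<Prod>i\<in>Poly_Mapping.keys m. s i ^ Poly_Mapping.lookup m i))"

text \<open>f is a projection of g: f = g(a_1,...,a_q), each a_i a constant or a variable.\<close>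
definition is_projection :: "'a::comm_ring_1 mpoly \<Rightarrow> 'a mpoly \<Rightarrow> bool" where
  "is_projection f g \<longleftrightarrow>
     (\<exists>s. (\<forall>i. s i \<in> range mconst \<or> s i \<in> range mvar) \<and> f = msubst s g)"

definition p_projection :: "(nat \<Rightarrow> 'a::comm_ring_1 mpoly) \<Rightarrow> (nat \<Rightarrow> 'a mpoly) \<Rightarrow> bool" where
  "p_projection f g \<longleftrightarrow> (\<exists>r :: nat poly. \<forall>n. is_projection (f n) (g (poly r n)))"

section \<open>Arithmetic circuits and VP\<close>

text \<open>A circuit is a list of gates; a gate may refer to earlier gates by index.
  The output is the last gate.\<close>
datatype 'a gate = GVar nat | GConst 'a | GPlus nat nat | GTimes nat nat

fun gate_eval :: "'a::comm_ring_1 mpoly list \<Rightarrow> 'a gate \<Rightarrow> 'a mpoly" where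
  "gate_eval vs (GVar i) = mvar i"
| "gate_eval vs (GConst c) = mconst c"
| "gate_eval vs (GPlus j k) = (if j < length vs \<and> k < length vs then vs ! j + vs ! k else 0)"
| "gate_eval vs (GTimes j k) = (if j < length vs \<and> k < length vs then vs ! j * vs ! k else 0)"

definition circ_vals :: "'a::comm_ring_1 gate list \<Rightarrow> 'a mpoly list" where
  "circ_vals C = foldl (\<lambda>vs g. vs @ [gate_eval vs g]) [] C"

definition circ_computes :: "'a::comm_ring_1 gate list \<Rightarrow> 'a mpoly \<Rightarrow> bool" where
  "circ_computes C f \<longleftrightarrow> C \<noteq> [] \<and> last (circ_vals C) = f"

definition in_VP :: "(nat \<Rightarrow> 'a::field mpoly) \<Rightarrow> bool" where
  "in_VP f \<longleftrightarrow> (\<exists>p :: nat poly.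
      (\<forall>n. total_degree (f n) \<le> poly p n) \<and>
      (\<forall>n. \<exists>C. length C \<le> poly p n \<and> circ_computes C (f n)))"

section \<open>Conjunctive queries\<close>

text \<open>A conjunctive query: a finite structure (domain, list of relations given as sets of
  tuples; relation symbol i is interpreted by rels ! i) and a formula in prenex form
  exists y. A_1 and ... and A_m, given by its set of free variables and its list of atoms
  (relation symbol, argument variables). All non-free variables are existentially quantified.\<close>
record cq =
  cq_dom :: "nat set"
  cq_rels :: "nat list set list"
  cq_free :: "nat set"
  cq_atoms :: "(nat \<times> nat list) list"

definition cq_wf :: "cq \<Rightarrow> bool" where
  "cq_wf \<Phi> \<longleftrightarrow> finite (cq_dom \<Phi>) \<and> finite (cq_free \<Phi>) \<and>
     (\<forall>R\<in>set (cq_rels \<Phi>). finite R \<and> (\<forall>t\<in>R. set t \<subseteq> cq_dom \<Phi>) \<and>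
        (\<forall>t\<in>R. \<forall>t'\<in>R. length t = length t')) \<and>
     (\<forall>(r, xs)\<in>set (cq_atoms \<Phi>). r < length (cq_rels \<Phi>) \<and>
        (\<forall>t\<in>cq_rels \<Phi> ! r. length t = length xs))"

definition cq_size :: "cq \<Rightarrow> nat" where
  "cq_size \<Phi> = card (cq_dom \<Phi>) + (\<Sum>R\<leftarrow>cq_rels \<Phi>. 1 + (\<Sum>t\<in>R. 1 + length t))
      + card (cq_free \<Phi>) + (\<Sum>(r, xs)\<leftarrow>cq_atoms \<Phi>. 1 + length xs)"

definition cq_vars :: "cq \<Rightarrow> nat set" where
  "cq_vars \<Phi> = cq_free \<Phi> \<union> (\<Union>(r, xs)\<in>set (cq_atoms \<Phi>). set xs)"

definition cq_edges :: "cq \<Rightarrow> nat set set" where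
  "cq_edges \<Phi> = (\<lambda>(r, xs). set xs) ` set (cq_atoms \<Phi>)"

definition cq_quantifier_free :: "cq \<Rightarrow> bool" where
  "cq_quantifier_free \<Phi> \<longleftrightarrow> cq_vars \<Phi> \<subseteq> cq_free \<Phi>"

text \<open>a (an assignment of the free variables) satisfies the query\<close>
definition cq_sat :: "cq \<Rightarrow> (nat \<Rightarrow> nat) \<Rightarrow> bool" where
  "cq_sat \<Phi> a \<longleftrightarrow> (\<exists>b. (\<forall>x\<in>cq_free \<Phi>. b x = a x) \<and> (\<forall>x\<in>cq_vars \<Phi>. b x \<in> cq_dom \<Phi>) \<and>
      (\<forall>(r, xs)\<in>set (cq_atoms \<Phi>). map b xs \<in> cq_rels \<Phi> ! r))"

definition cq_answers :: "cq \<Rightarrow> (nat \<Rightarrow> nat) set" where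
  "cq_answers \<Phi> = {a \<in> cq_free \<Phi> \<rightarrow>\<^sub>E cq_dom \<Phi>. cq_sat \<Phi> a}"

definition cq_poly :: "cq \<Rightarrow> 'a::comm_ring_1 mpoly" where
  "cq_poly \<Phi> = (\<Sum>a\<in>cq_answers \<Phi>. \<Prod>x\<in>cq_free \<Phi>. mvar (a x))"

section \<open>Hypergraphs: trees, join trees, acyclicity, quantified star size\<close>

definition adj_in :: "'v set set \<Rightarrow> 'v set \<Rightarrow> ('v \<times> 'v) set" where
  "adj_in T S = {(u, v). u \<in> S \<and> v \<in> S \<and> {u, v} \<in> T}"

definition connected_on :: "'v set \<Rightarrow> 'v set set \<Rightarrow> bool" where
  "connected_on S T \<longleftrightarrow> (\<forall>u\<in>S. \<forall>v\<in>S. (u, v) \<in> (adj_in T S)\<^sup>*)"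

text \<open>A (finite) tree with node set N and edge set T (edges are 2-element sets):
  connected with |N| - 1 edges.\<close>
definition is_tree :: "'v set \<Rightarrow> 'v set set \<Rightarrow> bool" where
  "is_tree N T \<longleftrightarrow> finite N \<and> T \<subseteq> {{u, v} | u v. u \<in> N \<and> v \<in> N \<and> u \<noteq> v} \<and>
     connected_on N T \<and> card T = card N - 1"

definition has_join_tree :: "'v set set \<Rightarrow> bool" where
  "has_join_tree E \<longleftrightarrow> (\<exists>(N :: nat set) T lab. is_tree N T \<and> lab ` N = E \<and>
      (\<forall>x. connected_on {t\<in>N. x \<in> lab t} T))"

definition cq_acyclic :: "cq \<Rightarrow> bool" where
  "cq_acyclic \<Phi> \<longleftrightarrow> has_join_tree (cq_edges \<Phi>)"

text \<open>The hypergraph of the query is a tree: all hyperedges have exactly two vertices and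
  the resulting graph is a tree.\<close>
definition cq_hypergraph_tree :: "cq \<Rightarrow> bool" where
  "cq_hypergraph_tree \<Phi> \<longleftrightarrow> (\<forall>e\<in>cq_edges \<Phi>. card e = 2) \<and> is_tree (cq_vars \<Phi>) (cq_edges \<Phi>)"

text \<open>Edges of the induced hypergraph H[S].\<close>
definition ind_edges :: "'v set set \<Rightarrow> 'v set \<Rightarrow> 'v set set" where
  "ind_edges E S = {e \<inter> S | e. e \<in> E \<and> e \<inter> S \<noteq> {}}"

text \<open>ps is a path from A to B in a hypergraph with edge set E.\<close>
definition hpath :: "'v set set \<Rightarrow> 'v set \<Rightarrow> 'v set \<Rightarrow> 'v set list \<Rightarrow> bool" where
  "hpath E A B ps \<longleftrightarrow> ps \<noteq> [] \<and> set ps \<subseteq> E \<and> hd ps \<inter> A \<noteq> {} \<and> last ps \<inter> B \<noteq> {} \<and>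
     (\<forall>i. Suc i < length ps \<longrightarrow> ps ! i \<inter> ps ! Suc i \<noteq> {})"

text \<open>Edge set of the S-component of e (for e not contained in S).\<close>
definition component_edges :: "'v set \<Rightarrow> 'v set set \<Rightarrow> 'v set \<Rightarrow> 'v set \<Rightarrow> 'v set set" where
  "component_edges V E S e =
     {e' \<in> E. \<not> e' \<subseteq> S \<and> (\<exists>ps. hpath (ind_edges E (V - S)) (e - S) (e' - S) ps)}"

text \<open>The S-component of e is an S-k-star.\<close>
definition is_star :: "'v set \<Rightarrow> 'v set set \<Rightarrow> 'v set \<Rightarrow> 'v set \<Rightarrow> nat \<Rightarrow> bool" where
  "is_star V E S e k \<longleftrightarrow> e \<in> E \<and> \<not> e \<subseteq> S \<and>
     (\<exists>Y. finite Y \<and> card Y = k \<and> Y \<subseteq> \<Union>(component_edges V E S e) \<inter> S \<and>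
          (\<forall>e'\<in>E. card (e' \<inter> Y) \<le> 1))"

definition quantified_star_size :: "cq \<Rightarrow> nat" where
  "quantified_star_size \<Phi> =
     Max (insert 0 {k. \<exists>e. is_star (cq_vars \<Phi>) (cq_edges \<Phi>) (cq_free \<Phi>) e k})"

end

theory Submission
  imports Defs "HOL-Library.Countable"
begin

text \<open>Upper bound. Fix a join tree. The nodes whose hyperedges belong to a given component form a
  subtree, so replacing all their labels by the set of free variables of the component gives a join
  tree of an equivalent quantifier-free query. In an acyclic hypergraph a vertex set whose
  independent subsets have at most \<open>k\<close> elements is covered by \<open>k\<close> hyperedges; hence bounded star size
  leaves polynomially many partial answers per node, and dynamic programming over the tree gives
  the circuit.

  Hardness. The homogeneous components of the values of the gates satisfy
  \<open>F\<^sub>d = \<Sum>\<^sub>j F\<^sub>j * F\<^sub>d\<^sub>-\<^sub>j\<close> for a bilinear product \<open>*\<close>. Cutting every bracketing of \<open>d\<close> leaves at the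
  last subtree with more than \<open>d / 2\<close> leaves on the heavy path expresses \<open>F\<^sub>d\<close> by products of three
  terms of half the degree: two components and an entry of the resolvent of the multiplication
  operators, which can itself be cut in the middle. The recursion has logarithmic depth, so
  its derivations are labelings of a complete ternary tree of polynomial size, with constraints
  only along the edges of that tree.\<close>

subsection \<open>Computing sets of polynomials by circuits\<close>

text \<open>A circuit reuses the value of a gate freely, a tree-shaped query cannot: unfolding a
  circuit into a tree may be exponential. This is why hardness needs depth \<open>O(log d)\<close>
  at bounded branching: \<open>3 ^ O(log d)\<close> nodes are polynomial in the degree. Two
  obstacles shape the expansion. Constant terms of gates would make a component of degree
  \<open>i\<close> depend on others of the same degree; they are absorbed into the coefficients, so
  that only products of two positive degrees remain. The bilinear product is neither commutative nor
  associative, so a heavy path is described by operators that multiply from either side. When the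
  resolvent is cut in the middle, the operator at the cut may still carry the full degree. Each
  halving of the degree therefore costs two levels of the tree, and the depth is about
  \<open>2 * log d\<close>. In the upper bound the exponent comes from a duality of acyclic
  hypergraphs: peeling leaves yields a cover together with an independent set at least as large, and
  an independent set of free variables in one component is exactly a star.\<close>

lemma circ_vals_snoc:
  "circ_vals (C @ [g]) = circ_vals C @ [gate_eval (circ_vals C) g]"
  by (simp add: circ_vals_def)

lemma length_circ_vals [simp]: "length (circ_vals C) = length C"
  by (induction C rule: rev_induct) (simp_all add: circ_vals_snoc, simp add: circ_vals_def)

lemma circ_vals_take: "circ_vals (take n C) = take n (circ_vals C)"
proof (induction C rule: rev_induct)
  case Nil
  show ?case by (simp add: circ_vals_def)
next
  case (snoc g C)
  then show ?case
    by (cases "n \<le> length C") (simp_all add: circ_vals_snoc)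
qed

lemma circ_vals_nth:
  assumes "i < length C"
  shows "circ_vals C ! i = gate_eval (take i (circ_vals C)) (C ! i)"
proof -
  have "circ_vals C ! i = circ_vals (take (Suc i) C) ! i"
    using assms by (simp add: circ_vals_take)
  also have "\<dots> = gate_eval (circ_vals (take i C)) (C ! i)"
    using assms by (simp add: take_Suc_conv_app_nth circ_vals_snoc nth_append)
  finally show ?thesis by (simp add: circ_vals_take)
qed

text \<open>A set of polynomials instead of a single one, so that intermediate values stay available
  to later gates.\<close>

definition computable :: "'a::comm_ring_1 mpoly set \<Rightarrow> nat \<Rightarrow> bool" where
  "computable F n \<longleftrightarrow> (\<exists>C. length C \<le> n \<and> F \<subseteq> set (circ_vals C))"

lemma computable_empty: "computable {} 0"
  by (auto simp: computable_def)

lemma computable_mono: "computable F n \<Longrightarrow> G \<subseteq> F \<Longrightarrow> n \<le> m \<Longrightarrow> computable G m"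
  unfolding computable_def by (meson order_trans)

lemma computable_gate:
  assumes "length C \<le> n" "F \<subseteq> set (circ_vals C)"
  shows "computable (insert (gate_eval (circ_vals C) g) F) (Suc n)"
  unfolding computable_def
  by (rule exI[of _ "C @ [g]"]) (use assms in \<open>auto simp: circ_vals_snoc\<close>)

lemma computable_var: "computable F n \<Longrightarrow> computable (insert (mvar i) F) (Suc n)"
  by (metis computable_def computable_gate gate_eval.simps(1))

lemma computable_const: "computable F n \<Longrightarrow> computable (insert (mconst c) F) (Suc n)"
  by (metis computable_def computable_gate gate_eval.simps(2))

lemma computable_plus:
  assumes "computable F n" "p \<in> F" "q \<in> F"
  shows "computable (insert (p + q) F) (Suc n)"
proof -
  obtain C where C: "length C \<le> n" "F \<subseteq> set (circ_vals C)"
    using assms(1) by (auto simp: computable_def)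
  obtain i j where "i < length (circ_vals C)" "circ_vals C ! i = p"
      "j < length (circ_vals C)" "circ_vals C ! j = q"
    using assms C(2) by (metis in_set_conv_nth subsetD)
  then show ?thesis using computable_gate[OF C, of "GPlus i j"] by simp
qed

lemma computable_times:
  assumes "computable F n" "p \<in> F" "q \<in> F"
  shows "computable (insert (p * q) F) (Suc n)"
proof -
  obtain C where C: "length C \<le> n" "F \<subseteq> set (circ_vals C)"
    using assms(1) by (auto simp: computable_def)
  obtain i j where "i < length (circ_vals C)" "circ_vals C ! i = p"
      "j < length (circ_vals C)" "circ_vals C ! j = q"
    using assms C(2) by (metis in_set_conv_nth subsetD)
  then show ?thesis using computable_gate[OF C, of "GTimes i j"] by simp
qed

lemma mconst_0: "mconst 0 = 0" and mconst_1: "mconst 1 = 1"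
  by (simp_all add: mconst_def)

lemma computable_sum:
  assumes "finite J" "computable F n" "f ` J \<subseteq> F"
  shows "computable (insert (sum f J) F) (n + card J + 1)"
  using assms(1,3)
proof (induction J rule: finite_induct)
  case empty
  \<comment> \<open>The empty sum needs a gate for the constant 0, which is the \<open>+ 1\<close>
    in the bound.\<close>
  show ?case using computable_const[OF assms(2), of 0] by (simp add: mconst_0)
next
  case (insert j J)
  from insert have "computable (insert (sum f J) F) (n + card J + 1)" by auto
  from computable_plus[OF this, of "f j" "sum f J"]
  have "computable (insert (f j + sum f J) (insert (sum f J) F)) (Suc (n + card J + 1))"
    using insert by auto
  then show ?case
    by (rule computable_mono) (use insert in auto)
qed

text \<open>\<open>step\<close> is required for every larger set \<open>G\<close>, because the
  values for earlier indices are already present when the one for \<open>j\<close> is added.\<close>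

lemma computable_family:
  assumes "finite J" "computable F n"
    and step: "\<And>j G m. j \<in> J \<Longrightarrow> F \<subseteq> G \<Longrightarrow> computable G m \<Longrightarrow> computable (insert (f j) G) (m + k)"
  shows "computable (f ` J \<union> F) (n + card J * k)"
  using assms(1) step
proof (induction J rule: finite_induct)
  case empty
  show ?case using assms(2) by simp
next
  case (insert j J)
  then have "computable (f ` J \<union> F) (n + card J * k)" by blast
  then have "computable (insert (f j) (f ` J \<union> F)) (n + card J * k + k)"
    by (intro insert.prems) auto
  then show ?case
    using insert by (simp add: algebra_simps)
qed

text \<open>The output is the last gate, so the circuit is cut off right behind the gate with value
  \<open>f\<close>.\<close>

lemma computable_circuit:
  assumes "computable {f} n"
  shows "\<exists>C. length C \<le> n \<and> circ_computes C f"
proof -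
  obtain C where C: "length C \<le> n" "f \<in> set (circ_vals C)"
    using assms by (auto simp: computable_def)
  then obtain i where i: "i < length C" "circ_vals C ! i = f"
    by (auto simp: in_set_conv_nth)
  have "last (circ_vals (take (Suc i) C)) = f"
    unfolding circ_vals_take using i by (simp add: take_Suc_conv_app_nth)
  then have "circ_computes (take (Suc i) C) f"
    using i by (auto simp: circ_computes_def)
  moreover have "length (take (Suc i) C) \<le> n" using C(1) by simp
  ultimately show ?thesis by blast
qed

section \<open>Acyclic hypergraphs: peeling leaves, covers against independent sets\<close>

subsection \<open>The running intersection property\<close>

text \<open>A join tree written as an order of leaf removals: the head \<open>e\<close> is a leaf of
  what is left, and \<open>u\<close> is the neighbour that it hangs on.\<close>

fun running_intersection :: "'v set list \<Rightarrow> bool" where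
  "running_intersection [] \<longleftrightarrow> True"
| "running_intersection (e # es) \<longleftrightarrow>
     running_intersection es \<and> (es = [] \<or> (\<exists>u\<in>set es. e \<inter> \<Union>(set es) \<subseteq> u))"

lemma running_intersection_remdups:
  "running_intersection es \<Longrightarrow> running_intersection (remdups es)"
  by (induction es) auto

text \<open>A singleton hangs on any set that contains its point; if there is none, its intersection
  with the rest is empty and any set will do. The inserted \<open>{}\<close> ensures that there is
  one.\<close>

lemma running_intersection_singletons:
  "running_intersection es \<Longrightarrow> running_intersection (map (\<lambda>x. {x}) xs @ {} # es)"
proof (induction xs)
  case Nil
  then show ?case by (cases es) auto
next
  case (Cons x xs)
  show ?case
  proof (cases "x \<in> \<Union>(set (map (\<lambda>x. {x}) xs @ {} # es))")
    case True
    then obtain u where "u \<in> set (map (\<lambda>x. {x}) xs @ {} # es)" "x \<in> u" by blast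
    with Cons show ?thesis by auto
  next
    case False
    with Cons show ?thesis by auto
  qed
qed

text \<open>Greedy duality along the leaf order. If some \<open>x\<close> in \<open>F\<close> occurs
  only in the leaf \<open>e\<close>, then \<open>e\<close> joins the cover, \<open>x\<close> joins
  the independent set, and the recursion continues with \<open>F - e\<close>, so that
  \<open>e\<close> meets \<open>Y\<close> in \<open>x\<close> alone. Otherwise \<open>e\<close> is
  skipped: its part of \<open>F\<close> lies in the rest, hence in the neighbour \<open>u\<close>,
  and \<open>e\<close> inherits from \<open>u\<close> that it meets \<open>Y\<close> at most
  once.\<close>

lemma running_intersection_cover:
  assumes "running_intersection es" "finite F" "F \<subseteq> \<Union>(set es)" "\<And>e. e \<in> set es \<Longrightarrow> finite e"
  shows "\<exists>Y C. Y \<subseteq> F \<and> C \<subseteq> set es \<and> F \<subseteq> \<Union>C \<and> card C \<le> card Y \<and>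
           (\<forall>e\<in>set es. card (e \<inter> Y) \<le> 1)"
  using assms
proof (induction es arbitrary: F)
  case Nil
  then show ?case by auto
next
  case (Cons e es)
  show ?case
  proof (cases "F \<inter> e \<subseteq> \<Union>(set es)")
    case True
    with Cons.prems have F: "F \<subseteq> \<Union>(set es)" by auto
    obtain Y C where YC: "Y \<subseteq> F" "C \<subseteq> set es" "F \<subseteq> \<Union>C" "card C \<le> card Y"
        "\<forall>e\<in>set es. card (e \<inter> Y) \<le> 1"
      using Cons.IH[of F] Cons.prems F by auto
    have "card (e \<inter> Y) \<le> 1"
    proof (cases "es = []")
      case True
      with F YC(1) have "Y = {}" by auto
      then show ?thesis by simp
    next
      case False
      then obtain u where u: "u \<in> set es" "e \<inter> \<Union>(set es) \<subseteq> u"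
        using Cons.prems(1) by auto
      have "e \<inter> Y \<subseteq> u \<inter> Y" using u(2) YC(1) F by blast
      then have "card (e \<inter> Y) \<le> card (u \<inter> Y)"
        using Cons.prems(2) YC(1) by (meson card_mono finite_Int finite_subset)
      then show ?thesis using YC(5) u(1) by fastforce
    qed
    with YC show ?thesis by (intro exI[of _ Y] exI[of _ C]) auto
  next
    case False
    then obtain x where x: "x \<in> F" "x \<in> e" "x \<notin> \<Union>(set es)" by auto
    obtain Y C where YC: "Y \<subseteq> F - e" "C \<subseteq> set es" "F - e \<subseteq> \<Union>C" "card C \<le> card Y"
        "\<forall>e\<in>set es. card (e \<inter> Y) \<le> 1"
    proof -
      have "running_intersection es" "finite (F - e)" "F - e \<subseteq> \<Union>(set es)"
        "\<And>e. e \<in> set es \<Longrightarrow> finite e"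
        using Cons.prems by auto
      from Cons.IH[OF this] show ?thesis using that by blast
    qed
    have "finite Y" "x \<notin> Y"
      using YC(1) x(2) finite_subset[OF YC(1)] Cons.prems(2) by auto
    then have "card (insert e C) \<le> card (insert x Y)"
      using YC(2,4) by (simp add: card_insert_if finite_subset)
    moreover have "card (e \<inter> insert x Y) \<le> 1"
    proof -
      have "e \<inter> insert x Y = {x}" using YC(1) x(2) by auto
      then show ?thesis by simp
    qed
    moreover have "e' \<inter> insert x Y = e' \<inter> Y" if "e' \<in> set es" for e'
      using x(3) that by auto
    ultimately show ?thesis
      using YC x by (intro exI[of _ "insert x Y"] exI[of _ "insert e C"]) auto
  qed
qed

subsection \<open>Join trees\<close>

lemma adj_in_mono: "S \<subseteq> S' \<Longrightarrow> adj_in T S \<subseteq> adj_in T S'"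
  by (auto simp: adj_in_def)

lemma sym_adj_in: "sym (adj_in T S)"
  by (auto simp: adj_in_def sym_def insert_commute)

text \<open>A path can enter and leave \<open>v\<close> only through \<open>u\<close>, so visits to
  \<open>v\<close> can be cut out. In the induction a path that currently sits at \<open>v\<close>
  is recorded as waiting at \<open>u\<close>.\<close>

lemma connected_on_remove_leaf:
  assumes conn: "connected_on S T" and leaf: "\<And>w. w \<in> S \<Longrightarrow> {v, w} \<in> T \<Longrightarrow> w = u"
  shows "connected_on (S - {v}) T"
proof -
  have main: "(b \<noteq> v \<longrightarrow> (a, b) \<in> (adj_in T (S - {v}))\<^sup>*) \<and>
              (b = v \<longrightarrow> (a, u) \<in> (adj_in T (S - {v}))\<^sup>*)"
    if "(a, b) \<in> (adj_in T S)\<^sup>*" "a \<noteq> v" for a b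
    using that
  proof (induction rule: rtrancl_induct)
    case base
    then show ?case by simp
  next
    case (step b c)
    from step.hyps have bc: "b \<in> S" "c \<in> S" "{b, c} \<in> T" by (auto simp: adj_in_def)
    then have cb: "{c, b} \<in> T" by (simp add: insert_commute)
    consider "b \<noteq> v" "c \<noteq> v" | "b = v" | "b \<noteq> v" "c = v" by blast
    then show ?case
    proof cases
      case 1
      then have "(b, c) \<in> adj_in T (S - {v})" using bc by (auto simp: adj_in_def)
      with 1 step show ?thesis by auto
    next
      case 2
      then have "c = u" using leaf bc by auto
      with 2 step show ?thesis by auto
    next
      case 3
      then have "b = u" using leaf bc cb by auto
      with 3 step show ?thesis by auto
    qed
  qed
  then show ?thesis using conn unfolding connected_on_def by blast
qed

text \<open>The degrees add up to \<open>2 * (card N - 1)\<close>, less than 2 per node, so some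
  node has degree at most 1; connectedness makes it exactly 1.\<close>

lemma is_tree_leaf:
  assumes tree: "is_tree N T" and card: "card N \<ge> 2"
  shows "\<exists>v\<in>N. \<exists>u\<in>N. u \<noteq> v \<and> {e\<in>T. v \<in> e} = {{u, v}}"
proof -
  from tree have fin: "finite N" and T: "T \<subseteq> {{u, v} | u v. u \<in> N \<and> v \<in> N \<and> u \<noteq> v}"
    and conn: "connected_on N T" and cT: "card T = card N - 1"
    by (auto simp: is_tree_def)
  have "T \<subseteq> Pow N" using T by auto
  then have finT: "finite T" using fin finite_subset by blast
  have "card {v\<in>N. v \<in> e} = 2" if "e \<in> T" for e
  proof -
    from that T obtain u v where "e = {u, v}" "u \<in> N" "v \<in> N" "u \<noteq> v" by auto
    then have "{v\<in>N. v \<in> e} = {u, v}" by auto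
    with \<open>u \<noteq> v\<close> show ?thesis by simp
  qed
  then have "(\<Sum>v\<in>N. card {e\<in>T. v \<in> e}) = 2 * card T"
    by (intro sum_multicount[OF fin finT]) auto
  also have "\<dots> < (\<Sum>v\<in>N. 2)" using cT card by simp
  finally obtain v where v: "v \<in> N" "card {e\<in>T. v \<in> e} < 2"
    by (meson not_le sum_mono)
  obtain w where w: "w \<in> N" "w \<noteq> v"
    using card v(1) fin
    by (metis One_nat_def card_le_Suc0_iff_eq not_less_eq_eq numeral_2_eq_2)
  then have "(v, w) \<in> (adj_in T N)\<^sup>*" using conn v(1) by (auto simp: connected_on_def)
  then obtain u where "(v, u) \<in> adj_in T N" using w(2) by (metis converse_rtranclE)
  then have u: "u \<in> N" "{u, v} \<in> T" by (auto simp: adj_in_def insert_commute)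
  have "u \<noteq> v"
  proof
    assume "u = v"
    then have "{v} \<in> T" using u by simp
    with T obtain x y where "{v} = {x, y}" "x \<noteq> y" by auto
    then show False by (metis insertI1 insertCI singletonD)
  qed
  have "{e\<in>T. v \<in> e} = {{u, v}}"
  proof -
    have "{u, v} \<in> {e\<in>T. v \<in> e}" using u by auto
    moreover have "finite {e\<in>T. v \<in> e}" using finT by auto
    moreover have "card {e\<in>T. v \<in> e} \<le> Suc 0" using v(2) by simp
    ultimately show ?thesis by (metis (no_types, lifting) card_le_Suc0_iff_eq is_singletonI' is_singleton_def singletonD emptyE)
  qed
  with v u \<open>u \<noteq> v\<close> show ?thesis by blast
qed

text \<open>Tree leaves are removed one by one. Since \<open>lab\<close> may repeat labels, the
  resulting list may repeat sets.\<close>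

lemma join_tree_running_intersection:
  assumes "is_tree N T" "\<And>x. connected_on {t\<in>N. x \<in> lab t} T"
  shows "\<exists>es. running_intersection es \<and> set es = lab ` N"
  using assms
proof (induction "card N" arbitrary: N T)
  case 0
  then have "N = {}" by (auto simp: is_tree_def)
  then show ?case by (intro exI[of _ "[]"]) auto
next
  case (Suc k)
  show ?case
  proof (cases "k = 0")
    case True
    then obtain t where "N = {t}" using Suc.hyps(2) by (metis One_nat_def card_1_singletonE)
    then show ?thesis by (intro exI[of _ "[lab t]"]) auto
  next
    case False
    then have "card N \<ge> 2" using Suc.hyps(2) by simp
    then obtain v u where vu: "v \<in> N" "u \<in> N" "u \<noteq> v" "{e\<in>T. v \<in> e} = {{u, v}}"
      using is_tree_leaf[OF Suc.prems(1)] by blast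
    from Suc.prems(1) have fin: "finite N" and T: "T \<subseteq> {{u, v} | u v. u \<in> N \<and> v \<in> N \<and> u \<noteq> v}"
      and conn: "connected_on N T" and cT: "card T = card N - 1"
      by (auto simp: is_tree_def)
    define T' where "T' = T - {{u, v}}"
    define N' where "N' = N - {v}"
    have leaf: "w = u" if "{v, w} \<in> T" for w
    proof -
      have "{v, w} \<in> {e\<in>T. v \<in> e}" using that by auto
      then have "{v, w} = {u, v}" using vu(4) by auto
      then show ?thesis by (auto simp: doubleton_eq_iff)
    qed
    have adj: "adj_in T' (S - {v}) = adj_in T (S - {v})" for S
      by (auto simp: adj_in_def T'_def doubleton_eq_iff)
    have conn': "connected_on (S - {v}) T'" if "connected_on S T" for S
      using connected_on_remove_leaf[OF that, of v u] leaf
      unfolding connected_on_def adj by blast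
    have "T' \<subseteq> {{u, v} | u v. u \<in> N' \<and> v \<in> N' \<and> u \<noteq> v}"
    proof
      fix e assume e: "e \<in> T'"
      then obtain a b where ab: "e = {a, b}" "a \<in> N" "b \<in> N" "a \<noteq> b"
        using T unfolding T'_def by blast
      have "v \<notin> e" using e vu(4) by (auto simp: T'_def)
      then show "e \<in> {{u, v} | u v. u \<in> N' \<and> v \<in> N' \<and> u \<noteq> v}"
        using ab unfolding N'_def by blast
    qed
    moreover have "{u, v} \<in> T" using vu(4) by auto
    then have "card T' = card N' - 1"
      using cT vu(1) fin by (simp add: T'_def N'_def)
    ultimately have "is_tree N' T'"
      using fin conn'[OF conn] by (simp add: is_tree_def N'_def)
    moreover have "connected_on {t\<in>N'. x \<in> lab t} T'" for x
    proof -
      have "{t\<in>N'. x \<in> lab t} = {t\<in>N. x \<in> lab t} - {v}" by (auto simp: N'_def)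
      then show ?thesis using conn'[OF Suc.prems(2)] by metis
    qed
    moreover have "k = card N'" using Suc.hyps(2) vu(1) fin by (simp add: N'_def)
    ultimately obtain es where es: "running_intersection es" "set es = lab ` N'"
      using Suc.hyps(1) by blast
    \<comment> \<open>The nodes containing \<open>x\<close> are connected, and the first step from
      the leaf \<open>v\<close> to another of them can only go to \<open>u\<close>.\<close>
    have "lab v \<inter> \<Union>(set es) \<subseteq> lab u"
    proof
      fix x assume x: "x \<in> lab v \<inter> \<Union>(set es)"
      then obtain w where w: "w \<in> N" "w \<noteq> v" "x \<in> lab w" using es(2) by (auto simp: N'_def)
      have "(v, w) \<in> (adj_in T {t\<in>N. x \<in> lab t})\<^sup>*"
        using Suc.prems(2)[of x] w vu(1) x by (auto simp: connected_on_def)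
      then obtain y where "(v, y) \<in> adj_in T {t\<in>N. x \<in> lab t}"
        using w(2) by (metis converse_rtranclE)
      then show "x \<in> lab u" using leaf by (auto simp: adj_in_def)
    qed
    moreover have "lab u \<in> set es" using vu es(2) by (auto simp: N'_def)
    ultimately have "running_intersection (lab v # es)" using es(1) by auto
    moreover have "set (lab v # es) = lab ` N" using es(2) vu(1) by (auto simp: N'_def)
    ultimately show ?thesis by blast
  qed
qed


section \<open>The sum-product algorithm on a join tree\<close>

subsection \<open>Eliminating the leaves of a join tree\<close>

text \<open>The natural join of the relations \<open>B e\<close>, with tuples as extensional
  functions.\<close>

definition joins :: "('v set \<Rightarrow> ('v \<Rightarrow> 'd) set) \<Rightarrow> 'v set set \<Rightarrow> ('v \<Rightarrow> 'd) set" where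
  "joins B E = {a \<in> extensional (\<Union>E). \<forall>e\<in>E. restrict a e \<in> B e}"

text \<open>The distributive law: \<open>e\<close> touches the other edges only inside
  \<open>u\<close>, so a tuple over \<open>E\<close> extends to \<open>e\<close> by exactly the
  \<open>\<tau>\<close> that match it on \<open>e \<inter> u\<close>. Their total weight is the
  message of \<open>e\<close>, and it depends only on the restriction to \<open>u\<close>, so it can
  be multiplied into the weight there.\<close>

lemma sum_joins_eliminate_leaf:
  fixes w :: "'v set \<Rightarrow> ('v \<Rightarrow> 'd) \<Rightarrow> 'r::comm_ring_1"
  assumes fin: "finite E" "finite (joins B E)" "finite (B e)"
    and e: "e \<notin> E" "u \<in> E" "e \<inter> \<Union>E \<subseteq> u" and ext: "B e \<subseteq> extensional e"
  shows "(\<Sum>a\<in>joins B (insert e E). \<Prod>f\<in>insert e E. w f (restrict a f)) =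
    (\<Sum>a\<in>joins B E. \<Prod>f\<in>E. (if f = u then (\<lambda>\<sigma>. w u \<sigma> *
        (\<Sum>\<tau>\<in>{\<tau>\<in>B e. restrict \<tau> (e \<inter> u) = restrict \<sigma> (e \<inter> u)}. w e \<tau>)) else w f) (restrict a f))"
    (is "?L = ?R")
proof -
  define M where "M a = {\<tau>\<in>B e. restrict \<tau> (e \<inter> u) = restrict a (e \<inter> u)}" for a
  have ru: "restrict a (u \<inter> (e \<inter> u)) = restrict a (e \<inter> u)" for a :: "'v \<Rightarrow> 'd"
    by (simp add: Int_ac)
  have prod: "(\<Prod>f\<in>E. (if f = u then (\<lambda>\<sigma>. w u \<sigma> *
        (\<Sum>\<tau>\<in>{\<tau>\<in>B e. restrict \<tau> (e \<inter> u) = restrict \<sigma> (e \<inter> u)}. w e \<tau>)) else w f) (restrict a f))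
      = (\<Sum>\<tau>\<in>M a. w e \<tau> * (\<Prod>f\<in>E. w f (restrict a f)))" for a
    using prod.remove[OF fin(1) e(2), of "\<lambda>f. w f (restrict a f)"]
      prod.remove[OF fin(1) e(2), of "\<lambda>f. (if f = u then (\<lambda>\<sigma>. w u \<sigma> *
        (\<Sum>\<tau>\<in>{\<tau>\<in>B e. restrict \<tau> (e \<inter> u) = restrict \<sigma> (e \<inter> u)}. w e \<tau>)) else w f) (restrict a f)"]
    by (simp add: ru M_def sum_distrib_right[symmetric] sum_distrib_left[symmetric] algebra_simps)
  have "?R = (\<Sum>(a, \<tau>)\<in>Sigma (joins B E) M. w e \<tau> * (\<Prod>f\<in>E. w f (restrict a f)))"
    unfolding prod by (rule sum.Sigma) (use fin in \<open>auto simp: M_def\<close>)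
  also have "\<dots> = ?L"
  proof (rule sum.reindex_bij_witness[where
        j = "\<lambda>(a, \<tau>) x. if x \<in> e then \<tau> x else a x" and i = "\<lambda>b. (restrict b (\<Union>E), restrict b e)"])
    fix p assume p: "p \<in> Sigma (joins B E) M"
    obtain a \<tau> where p_eq: "p = (a, \<tau>)" by force
    define b where "b x = (if x \<in> e then \<tau> x else a x)" for x
    from p p_eq have a: "a \<in> extensional (\<Union>E)" "\<And>f. f \<in> E \<Longrightarrow> restrict a f \<in> B f"
      and \<tau>: "\<tau> \<in> B e" "restrict \<tau> (e \<inter> u) = restrict a (e \<inter> u)"
      by (auto simp: joins_def M_def)
    have agree: "\<tau> x = a x" if "x \<in> e" "x \<in> f" "f \<in> E" for x f
    proof -
      have "x \<in> e \<inter> u" using that e(3) by auto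
      then show ?thesis using \<tau>(2) by (metis restrict_apply')
    qed
    have re: "restrict b e = \<tau>"
      using \<tau>(1) ext by (intro extensionalityI[of _ e]) (auto simp: b_def)
    have rf: "restrict b f = restrict a f" if "f \<in> E" for f
      using agree that by (auto simp: b_def restrict_def)
    have rE: "restrict b (\<Union>E) = a"
      using a(1) agree by (intro extensionalityI[of _ "\<Union>E"]) (auto simp: b_def)
    have bext: "b \<in> extensional (\<Union>(insert e E))"
      using a(1) by (auto simp: extensional_def b_def)
    have beq: "(case p of (a, \<tau>) \<Rightarrow> \<lambda>x. if x \<in> e then \<tau> x else a x) = b"
      by (auto simp: p_eq b_def)
    show "(restrict (case p of (a, \<tau>) \<Rightarrow> \<lambda>x. if x \<in> e then \<tau> x else a x) (\<Union>E),
        restrict (case p of (a, \<tau>) \<Rightarrow> \<lambda>x. if x \<in> e then \<tau> x else a x) e) = p"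
      unfolding beq by (simp add: re rE p_eq)
    show "(case p of (a, \<tau>) \<Rightarrow> \<lambda>x. if x \<in> e then \<tau> x else a x) \<in> joins B (insert e E)"
      unfolding beq joins_def using bext re rf a \<tau> by auto
    show "(\<Prod>f\<in>insert e E. w f (restrict (case p of (a, \<tau>) \<Rightarrow> \<lambda>x. if x \<in> e then \<tau> x else a x) f)) =
         (case p of (a, \<tau>) \<Rightarrow> w e \<tau> * (\<Prod>f\<in>E. w f (restrict a f)))"
      unfolding beq using fin(1) e(1) re rf by (simp add: p_eq)
  next
    fix b assume b: "b \<in> joins B (insert e E)"
    then have bext: "b \<in> extensional (\<Union>(insert e E))" by (simp add: joins_def)
    show "(case (restrict b (\<Union>E), restrict b e) of (a, \<tau>) \<Rightarrow> \<lambda>x. if x \<in> e then \<tau> x else a x) = b"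
      by (rule HOL.ext) (use bext in \<open>auto simp: extensional_def\<close>)
    have "restrict (restrict b (\<Union>E)) f = restrict b f" if "f \<in> E" for f
      using that by (auto simp: restrict_def)
    moreover have "restrict (restrict b e) (e \<inter> u) = restrict (restrict b (\<Union>E)) (e \<inter> u)"
      using e(2) by (auto simp: restrict_def)
    ultimately show "(restrict b (\<Union>E), restrict b e) \<in> Sigma (joins B E) M"
      using b by (auto simp: joins_def M_def)
  qed
  finally show ?thesis by simp
qed

lemma finite_joins:
  assumes "finite E" "\<And>e. e \<in> E \<Longrightarrow> finite (B e)"
  shows "finite (joins B E)"
proof -
  have "inj_on (\<lambda>a. \<lambda>e\<in>E. restrict a e) (joins B E)"
  proof (rule inj_onI)
    fix a b assume ab: "a \<in> joins B E" "b \<in> joins B E"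
      and eq: "(\<lambda>e\<in>E. restrict a e) = (\<lambda>e\<in>E. restrict b e)"
    have "a x = b x" if "x \<in> e" "e \<in> E" for x e
      using that fun_cong[OF eq, of e] by (metis restrict_apply')
    then show "a = b"
      using ab by (intro extensionalityI[of _ "\<Union>E"]) (auto simp: joins_def)
  qed
  moreover have "(\<lambda>a. \<lambda>e\<in>E. restrict a e) ` joins B E \<subseteq> PiE E B"
    by (auto simp: joins_def)
  ultimately show ?thesis
    using finite_PiE[of E B] assms by (meson finite_imageD finite_subset)
qed

text \<open>Removing a leaf costs at most \<open>M + 2\<close> gates for each of at most
  \<open>M\<close> tuples of the neighbour: \<open>M + 1\<close> for the sum in the message, one for
  the product. The last remaining label takes \<open>M + 1\<close> gates. The induction generalizes
  \<open>w\<close> because the message changes the weight at \<open>u\<close>.\<close>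

lemma computable_sum_joins:
  fixes w :: "'v set \<Rightarrow> ('v \<Rightarrow> 'd) \<Rightarrow> 'a::comm_ring_1 mpoly"
  assumes "running_intersection es" "es \<noteq> []"
    and "\<And>e. e \<in> set es \<Longrightarrow> finite (B e) \<and> B e \<subseteq> extensional e \<and> card (B e) \<le> M"
    and "computable F n" "\<And>e \<tau>. e \<in> set es \<Longrightarrow> \<tau> \<in> B e \<Longrightarrow> w e \<tau> \<in> F"
  shows "computable {\<Sum>a\<in>joins B (set es). \<Prod>e\<in>set es. w e (restrict a e)}
           (n + length es * ((M + 1) * (M + 2)))"
  using assms
proof (induction es arbitrary: w F n)
  case Nil
  then show ?case by simp
next
  case (Cons e es)
  have Be: "finite (B e)" "B e \<subseteq> extensional e" "card (B e) \<le> M" using Cons.prems(3) by auto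
  show ?case
  proof (cases "es = []")
    case True
    have "joins B {e} = B e"
      using Be(2) by (auto simp: joins_def extensional_restrict subset_iff)
    moreover have "restrict a e = a" if "a \<in> B e" for a
      using that Be(2) by (auto simp: extensional_restrict)
    ultimately have eq: "(\<Sum>a\<in>joins B (set (e # es)). \<Prod>e\<in>set (e # es). w e (restrict a e)) = (\<Sum>a\<in>B e. w e a)"
      using True by simp
    have "computable (insert (\<Sum>a\<in>B e. w e a) F) (n + card (B e) + 1)"
      by (rule computable_sum) (use Be Cons.prems in auto)
    then show ?thesis
      unfolding eq by (rule computable_mono) (use True Be(3) in auto)
  next
    case False
    then obtain u where u: "u \<in> set es" "e \<inter> \<Union>(set es) \<subseteq> u" using Cons.prems(1) by auto
    have rec: "computable {\<Sum>a\<in>joins B (set es). \<Prod>e\<in>set es. w' e (restrict a e)}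
           (n' + length es * ((M + 1) * (M + 2)))"
      if "computable F' n'" "\<And>e \<tau>. e \<in> set es \<Longrightarrow> \<tau> \<in> B e \<Longrightarrow> w' e \<tau> \<in> F'"
      for F' n' and w' :: "'v set \<Rightarrow> ('v \<Rightarrow> 'd) \<Rightarrow> 'a mpoly"
      using that Cons.prems(1,3) False by (intro Cons.IH) simp_all
    show ?thesis
    proof (cases "e \<in> set es")
      case True
      \<comment> \<open>A repeated label contributes nothing new: join and product range over the
        set of labels.\<close>
      then have eq: "set (e # es) = set es" by auto
      have "computable {\<Sum>a\<in>joins B (set es). \<Prod>e\<in>set es. w e (restrict a e)}
          (n + length es * ((M + 1) * (M + 2)))"
        by (rule rec[OF Cons.prems(4)]) (rule Cons.prems(5), simp_all)
      then show ?thesis unfolding eq by (rule computable_mono[OF _ subset_refl]) simp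
    next
      case notin: False
      define m where "m \<sigma> = w u \<sigma> *
        (\<Sum>\<tau>\<in>{\<tau>\<in>B e. restrict \<tau> (e \<inter> u) = restrict \<sigma> (e \<inter> u)}. w e \<tau>)" for \<sigma>
      have Bu: "finite (B u)" "card (B u) \<le> M" using Cons.prems(3) u by auto
      have "computable (m ` B u \<union> F) (n + card (B u) * (M + 2))"
      proof (rule computable_family[OF Bu(1) Cons.prems(4)])
        fix \<sigma> G k assume \<sigma>: "\<sigma> \<in> B u" and G: "F \<subseteq> G" "computable G k"
        let ?J = "{\<tau>\<in>B e. restrict \<tau> (e \<inter> u) = restrict \<sigma> (e \<inter> u)}"
        have "card ?J \<le> card (B e)" by (rule card_mono) (use Be in auto)
        then have J: "card ?J \<le> M" using Be(3) by simp
        have "computable (insert (\<Sum>\<tau>\<in>?J. w e \<tau>) G) (k + card ?J + 1)"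
          by (rule computable_sum) (use Be G Cons.prems in auto)
        then have "computable (insert (m \<sigma>) (insert (\<Sum>\<tau>\<in>?J. w e \<tau>) G)) (Suc (k + card ?J + 1))"
          unfolding m_def
        proof (rule computable_times)
          show "w u \<sigma> \<in> insert (\<Sum>\<tau>\<in>?J. w e \<tau>) G"
            using Cons.prems(5)[of u \<sigma>] u(1) \<sigma> G(1) by auto
        qed simp
        then show "computable (insert (m \<sigma>) G) (k + (M + 2))"
          by (rule computable_mono) (use J in auto)
      qed
      then have "computable (m ` B u \<union> F) (n + M * (M + 2))"
        by (rule computable_mono) (use Bu in \<open>auto intro!: add_mono mult_le_mono simp del: mult_Suc_right add_2_eq_Suc'\<close>)
      then have "computable {\<Sum>a\<in>joins B (set es). \<Prod>f\<in>set es. (if f = u then m else w f) (restrict a f)}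
           (n + M * (M + 2) + length es * ((M + 1) * (M + 2)))"
        by (rule rec) (use Cons.prems(5) in auto)
      moreover have "(\<Sum>a\<in>joins B (set (e # es)). \<Prod>f\<in>set (e # es). w f (restrict a f)) =
          (\<Sum>a\<in>joins B (set es). \<Prod>f\<in>set es. (if f = u then m else w f) (restrict a f))"
      proof -
        have "finite (joins B (set es))" by (rule finite_joins) (use Cons.prems(3) in auto)
        then show ?thesis
          using sum_joins_eliminate_leaf[of "set es" B e u w] u notin Be
          unfolding m_def by simp
      qed
      ultimately show ?thesis by (simp only:) (erule computable_mono[OF _ subset_refl], simp)
    qed
  qed
qed

lemma card_image_le_card_image:
  assumes "finite (g ` A)" "\<And>a a'. a \<in> A \<Longrightarrow> a' \<in> A \<Longrightarrow> g a = g a' \<Longrightarrow> f a = f a'"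
  shows "card (f ` A) \<le> card (g ` A)"
proof -
  have "f (inv_into A g (g a)) = f a" if "a \<in> A" for a
    using that by (intro assms(2)) (auto intro: inv_into_into f_inv_into_f)
  then have "f ` A = (\<lambda>y. f (inv_into A g y)) ` g ` A" by (simp add: image_image)
  then show ?thesis using card_image_le[OF assms(1)] by metis
qed

text \<open>The variables enter through additional labels \<open>{x}\<close>, which carry the weights and also take care
  of the free variables that occur in no atom.\<close>

lemma computable_sum_join_tree:
  assumes ri: "running_intersection es"
    and fin: "finite A" "finite S" "finite D" and A: "A \<subseteq> S \<rightarrow>\<^sub>E D"
    and es: "\<And>e. e \<in> set es \<Longrightarrow> e \<subseteq> S"
    and complete: "\<And>a. a \<in> S \<rightarrow>\<^sub>E D \<Longrightarrow> A \<noteq> {} \<Longrightarrow>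
        (\<And>e. e \<in> set es \<Longrightarrow> \<exists>a'\<in>A. \<forall>x\<in>e. a' x = a x) \<Longrightarrow> a \<in> A"
    and bound: "\<And>e. e \<in> set es \<Longrightarrow> card ((\<lambda>a. restrict a e) ` A) \<le> M"
    and M: "card D \<le> M" "1 \<le> M"
  shows "computable {\<Sum>a\<in>A. \<Prod>x\<in>S. mvar (a x) :: 'a::comm_ring_1 mpoly}
     (card D + 1 + (card S + 1 + length es) * ((M + 1) * (M + 2)))"
proof -
  obtain xs where xs: "set xs = S" "distinct xs" using finite_distinct_list[OF fin(2)] by blast
  define ls where "ls = map (\<lambda>x. {x}) xs @ {} # es"
  define B where "B e = (\<lambda>a. restrict a e) ` A" for e
  define w where "w e \<tau> = (if \<exists>x\<in>S. e = {x} then mvar (\<tau> (the_elem e)) else 1 :: 'a mpoly)" for e \<tau>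
  have setls: "set ls = (\<lambda>x. {x}) ` S \<union> {{}} \<union> set es" using xs by (auto simp: ls_def)
  have len: "length ls = card S + 1 + length es"
    using xs by (auto simp: ls_def distinct_card)
  have Un: "\<Union>(set ls) = S" using es by (auto simp: setls)
  have B: "finite (B e) \<and> B e \<subseteq> extensional e \<and> card (B e) \<le> M" if e: "e \<in> set ls" for e
  proof -
    consider x where "x \<in> S" "e = {x}" | "e = {}" | "e \<in> set es"
      using e unfolding setls by blast
    then have "card (B e) \<le> M"
    proof cases
      case 1
      have "card (B e) \<le> card ((\<lambda>a. a x) ` A)"
        unfolding B_def 1(2)
        by (rule card_image_le_card_image) (simp_all add: fin restrict_def fun_eq_iff)
      also have "\<dots> \<le> card D" by (rule card_mono) (use A 1 fin in auto)
      finally show ?thesis using M by simp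
    next
      case 2
      have "card (B e) \<le> card ((\<lambda>a. ()) ` A)"
        unfolding B_def 2
        by (rule card_image_le_card_image) (simp_all add: fin restrict_def fun_eq_iff)
      also have "\<dots> \<le> card {()}" by (rule card_mono) auto
      finally show ?thesis using M by simp
    next
      case 3
      then show ?thesis using bound by (simp add: B_def)
    qed
    then show ?thesis using fin by (auto simp: B_def)
  qed
  have "computable (mvar ` D \<union> {} :: 'a mpoly set) (0 + card D * 1)"
    by (rule computable_family[OF fin(3) computable_empty]) (auto intro: computable_var)
  then have "computable (mvar ` D \<union> {} :: 'a mpoly set) (card D)" by simp
  from computable_const[OF this, of 1]
  have F: "computable (insert 1 (mvar ` D) :: 'a mpoly set) (card D + 1)" by (simp add: mconst_1)
  have wF: "w e \<tau> \<in> insert 1 (mvar ` D)" if "e \<in> set ls" "\<tau> \<in> B e" for e \<tau>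
    using that PiE_mem[OF subsetD[OF A]] by (auto simp: w_def B_def)
  have comp: "computable {\<Sum>a\<in>joins B (set ls). \<Prod>e\<in>set ls. w e (restrict a e)}
           (card D + 1 + length ls * ((M + 1) * (M + 2)))"
    by (rule computable_sum_joins[OF _ _ B F wF])
      (use running_intersection_singletons[OF ri, of xs] in \<open>auto simp: ls_def\<close>)
  have "joins B (set ls) = A"
  proof
    show "A \<subseteq> joins B (set ls)"
    proof
      fix a assume "a \<in> A"
      then have "a \<in> extensional (\<Union>(set ls))" using A unfolding Un by (auto simp: PiE_def)
      with \<open>a \<in> A\<close> show "a \<in> joins B (set ls)" unfolding joins_def B_def by blast
    qed
    show "joins B (set ls) \<subseteq> A"
    proof
      fix a assume "a \<in> joins B (set ls)"
      then have a: "a \<in> extensional S" "\<And>e. e \<in> set ls \<Longrightarrow> restrict a e \<in> B e"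
        unfolding joins_def Un by blast+
      have ex: "\<exists>a'\<in>A. \<forall>x\<in>e. a' x = a x" if e: "e \<in> set ls" for e
      proof -
        obtain a' where "a' \<in> A" "restrict a e = restrict a' e" using a(2)[OF e] by (auto simp: B_def)
        then show ?thesis by (metis restrict_apply')
      qed
      have aD: "a x \<in> D" if "x \<in> S" for x
      proof -
        have "{x} \<in> set ls" using that setls by blast
        from ex[OF this] obtain a' where "a' \<in> A" "a' x = a x" by blast
        with that A show ?thesis by (metis PiE_mem subsetD)
      qed
      \<comment> \<open>\<open>B {}\<close> contains the empty tuple exactly if \<open>A\<close> is
        nonempty. This label makes the join empty when \<open>A\<close> is empty, even if there are
        no other labels.\<close>
      have "{} \<in> set ls" using setls by blast
      from ex[OF this] have ne: "A \<noteq> {}" by blast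
      show "a \<in> A"
      proof (rule complete[OF _ ne])
        show "a \<in> S \<rightarrow>\<^sub>E D" using a(1) aD by (simp add: PiE_def)
        show "\<exists>a'\<in>A. \<forall>x\<in>e. a' x = a x" if "e \<in> set es" for e
          using ex[of e] that setls by blast
      qed
    qed
  qed
  moreover have "(\<Prod>e\<in>set ls. w e (restrict a e)) = (\<Prod>x\<in>S. mvar (a x))" for a
  proof -
    \<comment> \<open>If a label in \<open>es\<close> is itself a singleton, it coincides with the
      added one, so no variable is counted twice.\<close>
    have "(\<Prod>e\<in>set ls. w e (restrict a e)) = (\<Prod>e\<in>(\<lambda>x. {x}) ` S. w e (restrict a e))"
      by (rule prod.mono_neutral_right) (use fin in \<open>auto simp: setls w_def\<close>)
    also have "\<dots> = (\<Prod>x\<in>S. mvar (a x))"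
      by (subst prod.reindex) (auto simp: w_def inj_on_def)
    finally show ?thesis .
  qed
  ultimately show ?thesis using comp len by simp
qed


section \<open>Removing the quantifiers component by component, and the bound by star size\<close>

subsection \<open>Components of a query\<close>

text \<open>One step of a path outside \<open>S\<close>, taken on the edges themselves rather than
  on their traces on \<open>V - S\<close>; its closure takes the place of
  \<open>hpath\<close>.\<close>

definition comp_rel :: "'v set set \<Rightarrow> 'v set \<Rightarrow> ('v set \<times> 'v set) set" where
  "comp_rel E S = {(f, g). f \<in> E \<and> g \<in> E \<and> f \<inter> g - S \<noteq> {}}"

lemma sym_comp_rel: "sym (comp_rel E S)"
  by (auto simp: comp_rel_def sym_def)

lemma hpath_imp_comp_rel:
  assumes "hpath (ind_edges E (V - S)) (f - S) (f' - S) ps" "f \<in> E" "f' \<in> E"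
  shows "(f, f') \<in> (comp_rel E S)\<^sup>*"
  using assms(1,2)
proof (induction ps arbitrary: f)
  case Nil
  then show ?case by (simp add: hpath_def)
next
  case (Cons p ps)
  from Cons.prems(1) have "p \<in> ind_edges E (V - S)" by (simp add: hpath_def)
  then obtain g where g: "g \<in> E" "p = g \<inter> (V - S)" by (auto simp: ind_edges_def)
  have fg: "(f, g) \<in> comp_rel E S"
    using Cons.prems g by (auto simp: hpath_def comp_rel_def)
  show ?case
  proof (cases ps)
    case Nil
    then have "(g, f') \<in> comp_rel E S"
      using Cons.prems g assms(3) by (auto simp: hpath_def comp_rel_def)
    with fg show ?thesis by simp
  next
    case (Cons q qs)
    have "p \<inter> q \<noteq> {}" using Cons.prems(1) Cons by (force simp: hpath_def)
    moreover have "ps ! i \<inter> ps ! Suc i \<noteq> {}" if "Suc i < length ps" for i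
      using Cons.prems(1) that unfolding hpath_def
      by (metis Suc_less_eq length_Cons nth_Cons_Suc)
    ultimately have "hpath (ind_edges E (V - S)) (g - S) (f' - S) ps"
      using Cons.prems(1) Cons g(2) by (auto simp: hpath_def)
    from Cons.IH[OF this g(1)] fg show ?thesis by (rule converse_rtrancl_into_rtrancl[rotated])
  qed
qed

text \<open>The clause on \<open>last ps\<close> strengthens the induction: the next hyperedge must
  intersect the last one of the path, not merely some trace that meets \<open>f - S\<close>.\<close>

lemma comp_rel_imp_hpath:
  assumes "(e, f) \<in> (comp_rel E S)\<^sup>*" "e \<in> E" "\<not> e \<subseteq> S" "\<Union>E \<subseteq> V"
  shows "\<exists>ps. hpath (ind_edges E (V - S)) (e - S) (f - S) ps \<and> last ps = f \<inter> (V - S)"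
  using assms(1)
proof (induction rule: rtrancl_induct)
  case base
  show ?case
    by (rule exI[of _ "[e \<inter> (V - S)]"]) (use assms in \<open>auto simp: hpath_def ind_edges_def\<close>)
next
  case (step f g)
  then obtain ps where ps: "hpath (ind_edges E (V - S)) (e - S) (f - S) ps" "last ps = f \<inter> (V - S)"
    by auto
  from step.hyps(2) have g: "g \<in> E" "f \<inter> g - S \<noteq> {}" by (auto simp: comp_rel_def)
  define q where "q = g \<inter> (V - S)"
  have q: "q \<in> ind_edges E (V - S)" "q \<inter> (g - S) \<noteq> {}" "last ps \<inter> q \<noteq> {}"
    using g assms(4) ps(2) by (auto simp: q_def ind_edges_def)
  have "(ps @ [q]) ! i \<inter> (ps @ [q]) ! Suc i \<noteq> {}" if "Suc i < length (ps @ [q])" for i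
  proof (cases "Suc i < length ps")
    case True
    then show ?thesis using ps(1) by (auto simp: hpath_def nth_append)
  next
    case False
    then have "i = length ps - 1" "ps \<noteq> []" using that ps(1) by (auto simp: hpath_def)
    then show ?thesis using q(3) by (auto simp: nth_append last_conv_nth)
  qed
  then have "hpath (ind_edges E (V - S)) (e - S) (g - S) (ps @ [q])"
    using ps(1) q by (auto simp: hpath_def)
  then show ?case unfolding q_def by (intro exI[of _ "ps @ [g \<inter> (V - S)]"]) auto
qed

lemma component_edges_eq:
  assumes "e \<in> E" "\<not> e \<subseteq> S" "\<Union>E \<subseteq> V"
  shows "component_edges V E S e = {f. (e, f) \<in> (comp_rel E S)\<^sup>*}"
proof
  show "component_edges V E S e \<subseteq> {f. (e, f) \<in> (comp_rel E S)\<^sup>*}"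
    using hpath_imp_comp_rel[OF _ assms(1)] unfolding component_edges_def by blast
  show "{f. (e, f) \<in> (comp_rel E S)\<^sup>*} \<subseteq> component_edges V E S e"
  proof
    fix f assume "f \<in> {f. (e, f) \<in> (comp_rel E S)\<^sup>*}"
    then have f: "(e, f) \<in> (comp_rel E S)\<^sup>*" by simp
    then have "f \<in> E \<and> \<not> f \<subseteq> S"
      using assms by (cases rule: rtranclE) (auto simp: comp_rel_def)
    with comp_rel_imp_hpath[OF f assms] show "f \<in> component_edges V E S e"
      by (auto simp: component_edges_def)
  qed
qed

lemma component_edges_cong:
  assumes "e \<in> E" "f \<in> E" "y \<in> e" "y \<in> f" "y \<notin> S" "\<Union>E \<subseteq> V"
  shows "component_edges V E S e = component_edges V E S f"
proof -
  have "(e, f) \<in> comp_rel E S" "(f, e) \<in> comp_rel E S" using assms by (auto simp: comp_rel_def)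
  then have "(e, g) \<in> (comp_rel E S)\<^sup>* \<longleftrightarrow> (f, g) \<in> (comp_rel E S)\<^sup>*" for g
    by (meson converse_rtrancl_into_rtrancl)
  moreover have "\<not> e \<subseteq> S" "\<not> f \<subseteq> S" using assms by auto
  ultimately show ?thesis using assms by (simp add: component_edges_eq)
qed

definition free_label :: "'v set \<Rightarrow> 'v set set \<Rightarrow> 'v set \<Rightarrow> 'v set \<Rightarrow> 'v set" where
  "free_label V E S e = (if e \<subseteq> S then e else \<Union>(component_edges V E S e) \<inter> S)"

text \<open>Consecutive edges of a component share a vertex outside \<open>S\<close>; the nodes
  containing that vertex are connected and all belong to the component, so the nodes of a component
  are connected. A node whose new label contains \<open>x\<close> can thus walk inside its component
  to a node whose old label contains \<open>x\<close>, and these are connected in the given join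
  tree. Every node passed has \<open>x\<close> in its new label.\<close>

lemma connected_on_free_label:
  assumes conn: "\<And>x. connected_on {t\<in>N. x \<in> lab t} T" and lab: "lab ` N = E" and V: "\<Union>E \<subseteq> V"
  shows "connected_on {t\<in>N. x \<in> free_label V E S (lab t)} T"
proof -
  define U where "U = {t\<in>N. x \<in> free_label V E S (lab t)}"
  have component: "(t, t') \<in> (adj_in T {s\<in>N. (e, lab s) \<in> (comp_rel E S)\<^sup>*})\<^sup>*"
    if ef: "(e, f) \<in> (comp_rel E S)\<^sup>*" and e: "e \<in> E" "\<not> e \<subseteq> S" and t: "t \<in> N" "lab t = e"
      and t': "t' \<in> N" "lab t' = f" for e f t t'
    using ef t'
  proof (induction arbitrary: t' rule: rtrancl_induct)
    case base
    obtain y where y: "y \<in> e" "y \<notin> S" using e by auto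
    have "(t, t') \<in> (adj_in T {s\<in>N. y \<in> lab s})\<^sup>*"
      using conn[of y] y t base by (auto simp: connected_on_def)
    moreover have "{s\<in>N. y \<in> lab s} \<subseteq> {s\<in>N. (e, lab s) \<in> (comp_rel E S)\<^sup>*}"
      using y e lab by (auto simp: comp_rel_def)
    ultimately show ?case by (meson adj_in_mono rtrancl_mono subsetD)
  next
    case (step f g)
    from step.hyps(2) have fg: "f \<in> E" "g \<in> E" "f \<inter> g - S \<noteq> {}" by (auto simp: comp_rel_def)
    then obtain y where y: "y \<in> f" "y \<in> g" "y \<notin> S" by auto
    obtain s where s: "s \<in> N" "lab s = f" using fg(1) lab by auto
    have "(s, t') \<in> (adj_in T {s\<in>N. y \<in> lab s})\<^sup>*"
      using conn[of y] y s step.prems by (auto simp: connected_on_def)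
    moreover have "{s\<in>N. y \<in> lab s} \<subseteq> {s\<in>N. (e, lab s) \<in> (comp_rel E S)\<^sup>*}"
    proof
      fix r assume "r \<in> {s\<in>N. y \<in> lab s}"
      then have "r \<in> N" "(f, lab r) \<in> comp_rel E S" using y fg lab by (auto simp: comp_rel_def)
      then show "r \<in> {s\<in>N. (e, lab s) \<in> (comp_rel E S)\<^sup>*}" using step.hyps(1) by auto
    qed
    ultimately have "(s, t') \<in> (adj_in T {s\<in>N. (e, lab s) \<in> (comp_rel E S)\<^sup>*})\<^sup>*"
      by (meson adj_in_mono rtrancl_mono subsetD)
    with step.IH[OF s] show ?case by auto
  qed
  have near: "\<exists>s\<in>N. x \<in> lab s \<and> (t, s) \<in> (adj_in T U)\<^sup>*" if t: "t \<in> U" for t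
  proof (cases "lab t \<subseteq> S")
    case True
    then show ?thesis using t by (auto simp: U_def free_label_def)
  next
    case False
    have tN: "t \<in> N" "lab t \<in> E" using t lab by (auto simp: U_def)
    obtain f where f: "(lab t, f) \<in> (comp_rel E S)\<^sup>*" "x \<in> f" "x \<in> S"
      using t False tN V by (auto simp: U_def free_label_def component_edges_eq)
    have "f \<in> E" using f(1) tN by (cases rule: rtranclE) (auto simp: comp_rel_def)
    then obtain s where s: "s \<in> N" "lab s = f" using lab by auto
    have "{s\<in>N. (lab t, lab s) \<in> (comp_rel E S)\<^sup>*} \<subseteq> U"
    proof
      fix r assume r: "r \<in> {s\<in>N. (lab t, lab s) \<in> (comp_rel E S)\<^sup>*}"
      then have "(lab t, lab r) \<in> (comp_rel E S)\<^sup>*" by simp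
      then have "\<not> lab r \<subseteq> S"
        by (cases rule: rtranclE) (use False in \<open>auto simp: comp_rel_def\<close>)
      moreover have "(lab r, f) \<in> (comp_rel E S)\<^sup>*"
        using symE[OF sym_rtrancl[OF sym_comp_rel] \<open>(lab t, lab r) \<in> (comp_rel E S)\<^sup>*\<close>] f(1)
        by (rule rtrancl_trans)
      moreover have "r \<in> N" "lab r \<in> E" using r lab by auto
      ultimately have "f \<in> component_edges V E S (lab r)" using V by (simp add: component_edges_eq)
      then show "r \<in> U"
        using \<open>r \<in> N\<close> \<open>\<not> lab r \<subseteq> S\<close> f(2,3) unfolding U_def free_label_def by auto
    qed
    with component[OF f(1) tN(2) False tN(1) refl s]
    have "(t, s) \<in> (adj_in T U)\<^sup>*" by (meson adj_in_mono rtrancl_mono subsetD)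
    then show ?thesis using s f by auto
  qed
  have sub: "{t\<in>N. x \<in> lab t} \<subseteq> U" if "x \<in> S"
  proof
    fix t assume t: "t \<in> {t\<in>N. x \<in> lab t}"
    then have "lab t \<in> E" using lab by auto
    then show "t \<in> U"
      using t that V unfolding U_def free_label_def
      by (cases "lab t \<subseteq> S") (auto simp: component_edges_eq)
  qed
  have "(t, t') \<in> (adj_in T U)\<^sup>*" if t: "t \<in> U" "t' \<in> U" for t t'
  proof -
    have xS: "x \<in> S" using t(1) by (auto simp: U_def free_label_def split: if_splits)
    obtain s s' where s: "s \<in> N" "x \<in> lab s" "(t, s) \<in> (adj_in T U)\<^sup>*"
      "s' \<in> N" "x \<in> lab s'" "(t', s') \<in> (adj_in T U)\<^sup>*"
      using near t by meson
    have "(s, s') \<in> (adj_in T {t\<in>N. x \<in> lab t})\<^sup>*"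
      using conn[of x] s by (auto simp: connected_on_def)
    then have "(s, s') \<in> (adj_in T U)\<^sup>*" using rtrancl_mono[OF adj_in_mono[OF sub[OF xS]]] by blast
    moreover have "(s', t') \<in> (adj_in T U)\<^sup>*"
      using s(6) sym_rtrancl[OF sym_adj_in] by (meson symE)
    ultimately show ?thesis using s(3) by (meson rtrancl_trans)
  qed
  then show ?thesis by (simp add: connected_on_def flip: U_def)
qed

text \<open>The restriction to \<open>F\<close> is determined by the restrictions to the edges of
  the cover, with at most \<open>n\<close> choices for each.\<close>

lemma card_restrict_cover:
  assumes fin: "finite A" "finite C" and F: "F \<subseteq> \<Union>C \<inter> S"
    and bound: "\<And>g. g \<in> C \<Longrightarrow> card ((\<lambda>a. restrict a (g \<inter> S)) ` A) \<le> n"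
  shows "card ((\<lambda>a. restrict a F) ` A) \<le> n ^ card C"
proof -
  let ?\<rho> = "\<lambda>a. \<lambda>g\<in>C. restrict a (g \<inter> S)"
  have "card ((\<lambda>a. restrict a F) ` A) \<le> card (?\<rho> ` A)"
  proof (rule card_image_le_card_image)
    fix a a' assume eq: "?\<rho> a = ?\<rho> a'"
    have "a x = a' x" if x: "x \<in> F" for x
    proof -
      obtain g where "g \<in> C" "x \<in> g \<inter> S" using x F by auto
      then show ?thesis using fun_cong[OF eq, of g] by (metis restrict_apply')
    qed
    then show "restrict a F = restrict a' F" by (auto simp: restrict_def)
  qed (use fin in auto)
  also have "\<dots> \<le> card (PiE C (\<lambda>g. (\<lambda>a. restrict a (g \<inter> S)) ` A))"
    by (rule card_mono) (use fin in \<open>auto intro: finite_PiE\<close>)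
  also have "\<dots> = (\<Prod>g\<in>C. card ((\<lambda>a. restrict a (g \<inter> S)) ` A))"
    using fin by (simp add: card_PiE)
  also have "\<dots> \<le> (\<Prod>g\<in>C. n)" by (rule prod_mono) (use bound in auto)
  finally show ?thesis by simp
qed

subsection \<open>Circuits for query polynomials\<close>

lemma prod_mvar:
  "(\<Prod>x\<in>X. mvar (a x) :: 'a::comm_ring_1 mpoly) =
     Poly_Mapping.single (\<Sum>x\<in>X. Poly_Mapping.single (a x) 1) 1"
proof (induction X rule: infinite_finite_induct)
  case (insert x X)
  then show ?case
    unfolding prod.insert[OF insert.hyps] sum.insert[OF insert.hyps] by (simp add: mvar_def mult_single)
qed simp_all

context
  fixes \<Phi> :: cq
  assumes wf: "cq_wf \<Phi>"
begin

lemma cq_finite: "finite (cq_dom \<Phi>)" "finite (cq_free \<Phi>)" "finite (cq_vars \<Phi>)" "finite (cq_edges \<Phi>)"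
  using wf by (auto simp: cq_wf_def cq_vars_def cq_edges_def)

lemma cq_edges_subset: "\<Union>(cq_edges \<Phi>) \<subseteq> cq_vars \<Phi>"
  by (auto simp: cq_edges_def cq_vars_def)

lemma cq_edge_finite: "e \<in> cq_edges \<Phi> \<Longrightarrow> finite e"
  by (auto simp: cq_edges_def)

lemma cq_answers_subset: "cq_answers \<Phi> \<subseteq> cq_free \<Phi> \<rightarrow>\<^sub>E cq_dom \<Phi>"
  by (auto simp: cq_answers_def)

lemma finite_cq_answers: "finite (cq_answers \<Phi>)"
  using cq_answers_subset finite_PiE cq_finite by (metis finite_subset)

lemma card_dom_le: "card (cq_dom \<Phi>) \<le> cq_size \<Phi>"
  and card_free_le: "card (cq_free \<Phi>) \<le> cq_size \<Phi>"
  by (auto simp: cq_size_def)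

lemma card_edges_le: "card (cq_edges \<Phi>) \<le> cq_size \<Phi>"
proof -
  have length_le: "length as \<le> (\<Sum>(r, xs)\<leftarrow>as. 1 + length xs)" for as :: "(nat \<times> nat list) list"
    by (induction as) auto
  have "card (cq_edges \<Phi>) \<le> length (cq_atoms \<Phi>)"
    unfolding cq_edges_def by (meson card_image_le card_length finite_set le_trans)
  also have "\<dots> \<le> (\<Sum>(r, xs)\<leftarrow>cq_atoms \<Phi>. 1 + length xs)"
    by (rule length_le)
  finally show ?thesis by (simp add: cq_size_def)
qed

lemma card_rel_le:
  assumes "R \<in> set (cq_rels \<Phi>)"
  shows "card R \<le> cq_size \<Phi>"
proof -
  have fin: "finite R" using wf assms by (auto simp: cq_wf_def)
  have "card R = (\<Sum>t\<in>R. 1)" by simp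
  also have "\<dots> \<le> (\<Sum>t\<in>R. 1 + length t)" by (rule sum_mono) simp
  also have "\<dots> \<le> 1 + (\<Sum>t\<in>R. 1 + length t)" by simp
  also have "\<dots> \<le> (\<Sum>R\<leftarrow>cq_rels \<Phi>. 1 + (\<Sum>t\<in>R. 1 + length t))"
    by (rule member_le_sum_list) (use assms in auto)
  finally show ?thesis by (simp add: cq_size_def)
qed

text \<open>A witness of an answer maps the atom on \<open>g\<close> to a tuple of its relation, and
  this tuple determines the answer on the free variables of \<open>g\<close>.\<close>

lemma card_restrict_edge:
  assumes g: "g \<in> cq_edges \<Phi>"
  shows "card ((\<lambda>a. restrict a (g \<inter> cq_free \<Phi>)) ` cq_answers \<Phi>) \<le> cq_size \<Phi>"
proof -
  obtain r xs where rxs: "(r, xs) \<in> set (cq_atoms \<Phi>)" "set xs = g"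
    using g by (auto simp: cq_edges_def)
  have R: "cq_rels \<Phi> ! r \<in> set (cq_rels \<Phi>)" using wf rxs by (auto simp: cq_wf_def)
  then have finR: "finite (cq_rels \<Phi> ! r)" using wf by (auto simp: cq_wf_def)
  have "\<exists>b. (\<forall>x\<in>cq_free \<Phi>. b x = a x) \<and> map b xs \<in> cq_rels \<Phi> ! r" if "a \<in> cq_answers \<Phi>" for a
    using that rxs by (auto simp: cq_answers_def cq_sat_def)
  then obtain \<beta> where \<beta>: "\<And>a x. a \<in> cq_answers \<Phi> \<Longrightarrow> x \<in> cq_free \<Phi> \<Longrightarrow> \<beta> a x = a x"
    "\<And>a. a \<in> cq_answers \<Phi> \<Longrightarrow> map (\<beta> a) xs \<in> cq_rels \<Phi> ! r"
    by metis
  have "card ((\<lambda>a. restrict a (g \<inter> cq_free \<Phi>)) ` cq_answers \<Phi>)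
      \<le> card ((\<lambda>a. map (\<beta> a) xs) ` cq_answers \<Phi>)"
  proof (rule card_image_le_card_image)
    fix a a' assume a: "a \<in> cq_answers \<Phi>" "a' \<in> cq_answers \<Phi>" "map (\<beta> a) xs = map (\<beta> a') xs"
    then have "a x = a' x" if "x \<in> g \<inter> cq_free \<Phi>" for x
      using that rxs(2) \<beta>(1) by (metis IntD1 IntD2 map_eq_conv)
    then show "restrict a (g \<inter> cq_free \<Phi>) = restrict a' (g \<inter> cq_free \<Phi>)"
      by (auto simp: restrict_def)
  qed (use finite_cq_answers in auto)
  also have "\<dots> \<le> card (cq_rels \<Phi> ! r)"
    by (rule card_mono[OF finR]) (use \<beta>(2) in auto)
  finally show ?thesis using card_rel_le[OF R] by simp
qed

text \<open>Star sizes are bounded by the number of free variables, so the \<open>Max\<close> in the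
  definition is taken over a finite set.\<close>

lemma is_star_le:
  assumes "is_star (cq_vars \<Phi>) (cq_edges \<Phi>) (cq_free \<Phi>) e k"
  shows "k \<le> quantified_star_size \<Phi>"
proof -
  have "k \<le> card (cq_free \<Phi>)" if "is_star (cq_vars \<Phi>) (cq_edges \<Phi>) (cq_free \<Phi>) e k" for k e
    using that cq_finite by (auto simp: is_star_def intro!: card_mono)
  then have "{k. \<exists>e. is_star (cq_vars \<Phi>) (cq_edges \<Phi>) (cq_free \<Phi>) e k} \<subseteq> {..card (cq_free \<Phi>)}"
    by auto
  then have "finite {k. \<exists>e. is_star (cq_vars \<Phi>) (cq_edges \<Phi>) (cq_free \<Phi>) e k}"
    using finite_subset by blast
  then show ?thesis
    using assms unfolding quantified_star_size_def by (intro Max_ge) auto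
qed

abbreviation (input) "lab\<Phi> \<equiv> free_label (cq_vars \<Phi>) (cq_edges \<Phi>) (cq_free \<Phi>)"

text \<open>The independent set \<open>Y\<close> that accompanies the cover \<open>C\<close>
  witnesses a star, so the cover has at most as many edges as the star size. The \<open>+ 1\<close>
  in the exponent serves edges of free variables only, which need one factor even if the star size
  is 0; the \<open>+ 1\<close> in the base keeps powers monotone in the exponent.\<close>

lemma card_restrict_free_label:
  assumes ri: "running_intersection es" "set es = cq_edges \<Phi>" and e: "e \<in> cq_edges \<Phi>"
  shows "card ((\<lambda>a. restrict a (lab\<Phi> e)) ` cq_answers \<Phi>)
     \<le> (cq_size \<Phi> + 1) ^ (quantified_star_size \<Phi> + 1)"
proof (cases "e \<subseteq> cq_free \<Phi>")
  case True
  then have "lab\<Phi> e = e \<inter> cq_free \<Phi>" by (auto simp: free_label_def)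
  then have "card ((\<lambda>a. restrict a (lab\<Phi> e)) ` cq_answers \<Phi>) \<le> cq_size \<Phi> + 1"
    using card_restrict_edge[OF e] by simp
  also have "\<dots> \<le> (cq_size \<Phi> + 1) ^ (quantified_star_size \<Phi> + 1)"
    by (rule self_le_power) auto
  finally show ?thesis .
next
  case False
  define F where "F = \<Union>(component_edges (cq_vars \<Phi>) (cq_edges \<Phi>) (cq_free \<Phi>) e) \<inter> cq_free \<Phi>"
  have "finite F" "F \<subseteq> \<Union>(set es)"
    using cq_finite(2) ri(2) by (auto simp: F_def component_edges_def)
  then obtain Y C where YC: "Y \<subseteq> F" "C \<subseteq> set es" "F \<subseteq> \<Union>C" "card C \<le> card Y"
       "\<forall>e\<in>set es. card (e \<inter> Y) \<le> 1"
    using running_intersection_cover[OF ri(1)] cq_edge_finite unfolding ri(2) by meson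
  have "is_star (cq_vars \<Phi>) (cq_edges \<Phi>) (cq_free \<Phi>) e (card Y)"
    unfolding is_star_def using YC False e \<open>finite F\<close> ri(2)
    by (auto simp flip: F_def intro!: exI[of _ Y] intro: finite_subset)
  then have le: "card C \<le> quantified_star_size \<Phi> + 1"
    using is_star_le YC(4) by fastforce
  have "card ((\<lambda>a. restrict a F) ` cq_answers \<Phi>) \<le> (cq_size \<Phi> + 1) ^ card C"
  proof (rule card_restrict_cover)
    show "finite C" using YC(2) finite_subset by auto
    show "F \<subseteq> \<Union>C \<inter> cq_free \<Phi>" using YC(3) by (auto simp: F_def)
    show "card ((\<lambda>a. restrict a (g \<inter> cq_free \<Phi>)) ` cq_answers \<Phi>) \<le> cq_size \<Phi> + 1" if "g \<in> C" for g
      using card_restrict_edge[of g] that YC(2) ri(2) by auto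
  qed (rule finite_cq_answers)
  also have "\<dots> \<le> (cq_size \<Phi> + 1) ^ (quantified_star_size \<Phi> + 1)"
    by (rule power_increasing[OF le]) simp
  finally show ?thesis using False by (simp add: free_label_def F_def)
qed

text \<open>Witnesses are chosen per component: a quantified variable determines its component, so the
  choices can be glued.\<close>

lemma cq_answers_complete:
  assumes a: "a \<in> cq_free \<Phi> \<rightarrow>\<^sub>E cq_dom \<Phi>" and ne: "cq_answers \<Phi> \<noteq> {}"
    and loc: "\<And>e. e \<in> cq_edges \<Phi> \<Longrightarrow> \<exists>a'\<in>cq_answers \<Phi>. \<forall>x\<in>lab\<Phi> e. a' x = a x"
  shows "a \<in> cq_answers \<Phi>"
proof -
  let ?S = "cq_free \<Phi>" and ?E = "cq_edges \<Phi>"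
  let ?c = "component_edges (cq_vars \<Phi>) (cq_edges \<Phi>) (cq_free \<Phi>)"
  have wit: "\<exists>b. (\<forall>x\<in>lab\<Phi> e. b x = a x) \<and> (\<forall>x\<in>cq_vars \<Phi>. b x \<in> cq_dom \<Phi>) \<and>
      (\<forall>(r, xs)\<in>set (cq_atoms \<Phi>). map b xs \<in> cq_rels \<Phi> ! r)" if e: "e \<in> ?E" for e
  proof -
    obtain a' where a': "a' \<in> cq_answers \<Phi>" "\<forall>x\<in>lab\<Phi> e. a' x = a x" using loc[OF e] by auto
    obtain b where b: "\<forall>x\<in>?S. b x = a' x" "\<forall>x\<in>cq_vars \<Phi>. b x \<in> cq_dom \<Phi>"
      "\<forall>(r, xs)\<in>set (cq_atoms \<Phi>). map b xs \<in> cq_rels \<Phi> ! r"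
      using a'(1) unfolding cq_answers_def cq_sat_def by auto
    have "lab\<Phi> e \<subseteq> ?S" by (auto simp: free_label_def)
    then show ?thesis using a'(2) b by (intro exI[of _ b]) auto
  qed
  have "\<exists>b. (\<forall>x\<in>\<Union>K \<inter> ?S. b x = a x) \<and> (\<forall>x\<in>cq_vars \<Phi>. b x \<in> cq_dom \<Phi>) \<and>
      (\<forall>(r, xs)\<in>set (cq_atoms \<Phi>). map b xs \<in> cq_rels \<Phi> ! r)"
    if K: "K \<in> ?c ` {e\<in>?E. \<not> e \<subseteq> ?S}" for K
  proof -
    obtain e where "e \<in> ?E" "\<not> e \<subseteq> ?S" "K = ?c e" using K by auto
    then show ?thesis using wit[of e] by (simp add: free_label_def)
  qed
  then obtain \<beta> where \<beta>:
    "\<And>K x. K \<in> ?c ` {e\<in>?E. \<not> e \<subseteq> ?S} \<Longrightarrow> x \<in> \<Union>K \<inter> ?S \<Longrightarrow> \<beta> K x = a x"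
    "\<And>K x. K \<in> ?c ` {e\<in>?E. \<not> e \<subseteq> ?S} \<Longrightarrow> x \<in> cq_vars \<Phi> \<Longrightarrow> \<beta> K x \<in> cq_dom \<Phi>"
    "\<And>K r xs. K \<in> ?c ` {e\<in>?E. \<not> e \<subseteq> ?S} \<Longrightarrow> (r, xs) \<in> set (cq_atoms \<Phi>) \<Longrightarrow> map (\<beta> K) xs \<in> cq_rels \<Phi> ! r"
    by (metis (no_types, lifting) case_prodD)
  have "\<exists>e. e \<in> ?E \<and> x \<in> e" if "x \<in> cq_vars \<Phi>" "x \<notin> ?S" for x
    using that by (force simp: cq_vars_def cq_edges_def)
  then obtain \<epsilon> where \<epsilon>: "\<And>x. x \<in> cq_vars \<Phi> \<Longrightarrow> x \<notin> ?S \<Longrightarrow> \<epsilon> x \<in> ?E \<and> x \<in> \<epsilon> x" by metis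
  define b where "b x = (if x \<in> ?S then a x else \<beta> (?c (\<epsilon> x)) x)" for x
  have "b x \<in> cq_dom \<Phi>" if "x \<in> cq_vars \<Phi>" for x
    using that a \<epsilon>[OF that] \<beta>(2)[of "?c (\<epsilon> x)"] by (auto simp: b_def)
  moreover have "map b xs \<in> cq_rels \<Phi> ! r" if rxs: "(r, xs) \<in> set (cq_atoms \<Phi>)" for r xs
  proof -
    have e: "set xs \<in> ?E" using rxs by (force simp: cq_edges_def)
    show ?thesis
    proof (cases "set xs \<subseteq> ?S")
      case True
      then obtain b' where "\<forall>x\<in>set xs. b' x = a x" "map b' xs \<in> cq_rels \<Phi> ! r"
        using wit[OF e] rxs by (auto simp: free_label_def)
      moreover have "b x = a x" if "x \<in> set xs" for x using that True by (auto simp: b_def)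
      ultimately show ?thesis by (metis (no_types, lifting) map_eq_conv)
    next
      case False
      have K: "?c (set xs) \<in> ?c ` {e\<in>?E. \<not> e \<subseteq> ?S}" using e False by auto
      have "b x = \<beta> (?c (set xs)) x" if x: "x \<in> set xs" for x
      proof (cases "x \<in> ?S")
        case True
        have "set xs \<in> ?c (set xs)" using e False by (simp add: component_edges_eq cq_edges_subset)
        with True x have "x \<in> \<Union>(?c (set xs)) \<inter> ?S" by auto
        from \<beta>(1)[OF K this] show ?thesis using True by (simp add: b_def)
      next
        case False
        have "x \<in> cq_vars \<Phi>" using x e cq_edges_subset by auto
        with \<epsilon>[OF this False] x e False have "?c (\<epsilon> x) = ?c (set xs)"
          using cq_edges_subset by (intro component_edges_cong[of _ _ _ x]) auto
        then show ?thesis using False by (simp add: b_def)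
      qed
      then have eq: "map b xs = map (\<beta> (?c (set xs))) xs" by auto
      show ?thesis unfolding eq by (rule \<beta>(3)[OF K rxs])
    qed
  qed
  moreover have "\<forall>x\<in>?S. b x = a x" by (simp add: b_def)
  ultimately show ?thesis using a unfolding cq_answers_def cq_sat_def by blast
qed

lemma computable_cq_poly:
  assumes acyclic: "cq_acyclic \<Phi>"
  defines "s \<equiv> cq_size \<Phi>"
  defines "M \<equiv> (s + 1) ^ (quantified_star_size \<Phi> + 1)"
  shows "computable {cq_poly \<Phi> :: 'a::comm_ring_1 mpoly} (s + 1 + (s + 1 + s) * ((M + 1) * (M + 2)))"
proof -
  obtain N :: "nat set" and T lab where tree: "is_tree N T" "lab ` N = cq_edges \<Phi>"
    "\<And>x. connected_on {t\<in>N. x \<in> lab t} T"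
    using acyclic by (auto simp: cq_acyclic_def has_join_tree_def)
  \<comment> \<open>The same tree is used twice: with its original labels to find covers by edges,
    with the free labels to build the circuit.\<close>
  obtain es0 where es0: "running_intersection es0" "set es0 = cq_edges \<Phi>"
    using join_tree_running_intersection[OF tree(1,3)] tree(2) by auto
  have "connected_on {t\<in>N. x \<in> (lab\<Phi> \<circ> lab) t} T" for x
    using connected_on_free_label[OF tree(3) tree(2) cq_edges_subset] by simp
  from join_tree_running_intersection[OF tree(1) this]
  obtain es' where es': "running_intersection es'" "set es' = lab\<Phi> ` cq_edges \<Phi>"
    by (metis image_comp tree(2))
  \<comment> \<open>A join tree may have arbitrarily many nodes; without duplicates the list is no
    longer than the number of edges.\<close>
  define es where "es = remdups es'"
  have es: "running_intersection es" "set es = lab\<Phi> ` cq_edges \<Phi>"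
    using es' running_intersection_remdups by (auto simp: es_def)
  have "length es = card (set es)" by (simp add: es_def length_remdups_card_conv)
  also have "\<dots> \<le> card (cq_edges \<Phi>)" unfolding es by (rule card_image_le) (rule cq_finite)
  also have "\<dots> \<le> s" unfolding s_def by (rule card_edges_le)
  finally have len: "length es \<le> s" .
  have sM: "s + 1 \<le> M" unfolding M_def by (rule self_le_power) auto
  have "computable {\<Sum>a\<in>cq_answers \<Phi>. \<Prod>x\<in>cq_free \<Phi>. mvar (a x) :: 'a mpoly}
     (card (cq_dom \<Phi>) + 1 + (card (cq_free \<Phi>) + 1 + length es) * ((M + 1) * (M + 2)))"
  proof (rule computable_sum_join_tree[OF es(1) finite_cq_answers cq_finite(2,1) cq_answers_subset])
    show "e \<subseteq> cq_free \<Phi>" if "e \<in> set es" for e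
      using that by (auto simp: es(2) free_label_def split: if_splits)
    show "a \<in> cq_answers \<Phi>" if "a \<in> cq_free \<Phi> \<rightarrow>\<^sub>E cq_dom \<Phi>" "cq_answers \<Phi> \<noteq> {}"
      "\<And>e. e \<in> set es \<Longrightarrow> \<exists>a'\<in>cq_answers \<Phi>. \<forall>x\<in>e. a' x = a x" for a
      using cq_answers_complete that es(2) by blast
    show "card ((\<lambda>a. restrict a e) ` cq_answers \<Phi>) \<le> M" if "e \<in> set es" for e
      using card_restrict_free_label[OF es0] that by (auto simp: es(2) M_def s_def)
    show "card (cq_dom \<Phi>) \<le> M" using sM card_dom_le by (simp add: s_def)
    show "1 \<le> M" using sM by simp
  qed
  moreover have "card (cq_dom \<Phi>) + 1 + (card (cq_free \<Phi>) + 1 + length es) * ((M + 1) * (M + 2))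
      \<le> s + 1 + (s + 1 + s) * ((M + 1) * (M + 2))"
    by (intro add_mono mult_le_mono len order_refl) (simp_all add: s_def card_dom_le card_free_le)
  ultimately show ?thesis
    unfolding cq_poly_def by (rule computable_mono[OF _ subset_refl])
qed

lemma total_degree_cq_poly: "total_degree (cq_poly \<Phi> :: 'a::comm_ring_1 mpoly) \<le> card (cq_free \<Phi>)"
proof -
  have "(\<Sum>i\<in>Poly_Mapping.keys m. Poly_Mapping.lookup m i) \<le> card (cq_free \<Phi>)"
    if m: "m \<in> Poly_Mapping.keys (cq_poly \<Phi> :: 'a mpoly)" for m
  proof -
    obtain a where "m \<in> Poly_Mapping.keys (\<Prod>x\<in>cq_free \<Phi>. mvar (a x) :: 'a mpoly)"
      using subsetD[OF keys_sum m[unfolded cq_poly_def]] by (rule UN_E)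
    then have m: "m = (\<Sum>x\<in>cq_free \<Phi>. Poly_Mapping.single (a x) 1)"
      unfolding prod_mvar by (simp split: if_splits)
    have "(\<Sum>i\<in>Poly_Mapping.keys m. Poly_Mapping.lookup m i) \<le>
        (\<Sum>i\<in>a ` cq_free \<Phi>. Poly_Mapping.lookup m i)"
    proof (rule sum_mono2)
      have "Poly_Mapping.keys m \<subseteq> (\<Union>x\<in>cq_free \<Phi>. Poly_Mapping.keys (Poly_Mapping.single (a x) (1::nat)))"
        unfolding m by (rule keys_sum)
      then show "Poly_Mapping.keys m \<subseteq> a ` cq_free \<Phi>" by auto
    qed (use cq_finite in auto)
    also have "\<dots> = (\<Sum>x\<in>cq_free \<Phi>. \<Sum>i\<in>a ` cq_free \<Phi>. if a x = i then 1 else 0)"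
      unfolding m lookup_sum by (subst sum.swap) (simp only: lookup_single when_def)
    also have "\<dots> = card (cq_free \<Phi>)" using cq_finite by (simp add: sum.delta)
    finally show ?thesis .
  qed
  then show ?thesis unfolding total_degree_def by (subst Max_le_iff) auto
qed

end


subsection \<open>Polynomially bounded functions\<close>

definition poly_bounded :: "(nat \<Rightarrow> nat) \<Rightarrow> bool" where
  "poly_bounded f \<longleftrightarrow> (\<exists>p :: nat poly. \<forall>n. f n \<le> poly p n)"

lemma poly_bounded_mono: "poly_bounded g \<Longrightarrow> (\<And>n. f n \<le> g n) \<Longrightarrow> poly_bounded f"
  unfolding poly_bounded_def by (meson le_trans)

lemma poly_bounded_poly: "poly_bounded (poly p)"
  unfolding poly_bounded_def by auto

lemma poly_bounded_const: "poly_bounded (\<lambda>_. c)"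
  unfolding poly_bounded_def by (intro exI[of _ "[:c:]"]) simp

lemma poly_bounded_add: "poly_bounded f \<Longrightarrow> poly_bounded g \<Longrightarrow> poly_bounded (\<lambda>n. f n + g n)"
  unfolding poly_bounded_def by (metis add_mono poly_add)

lemma poly_bounded_mult: "poly_bounded f \<Longrightarrow> poly_bounded g \<Longrightarrow> poly_bounded (\<lambda>n. f n * g n)"
  unfolding poly_bounded_def by (metis mult_le_mono poly_mult)

lemma poly_bounded_power: "poly_bounded f \<Longrightarrow> poly_bounded (\<lambda>n. f n ^ k)"
  by (induction k) (auto intro: poly_bounded_const poly_bounded_mult simp del: One_nat_def)

lemmas poly_bounded_intros =
  poly_bounded_poly poly_bounded_const poly_bounded_add poly_bounded_mult poly_bounded_power

lemma in_VP_cq_poly: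
  assumes wf: "\<And>n. cq_wf (\<Phi> n)" and acyclic: "\<And>n. cq_acyclic (\<Phi> n)"
    and size: "poly_bounded (\<lambda>n. cq_size (\<Phi> n))" and star: "\<And>n. quantified_star_size (\<Phi> n) \<le> c"
  shows "in_VP (\<lambda>n. cq_poly (\<Phi> n) :: 'a::field mpoly)"
proof -
  define s where "s n = cq_size (\<Phi> n)" for n
  define M where "M n = (s n + 1) ^ (c + 1)" for n
  define b where "b n = s n + 1 + (s n + 1 + s n) * ((M n + 1) * (M n + 2))" for n
  have s: "poly_bounded s" using size by (simp add: s_def[abs_def])
  have "poly_bounded b"
    unfolding b_def M_def by (intro poly_bounded_intros s)
  then obtain p where p: "\<And>n. b n \<le> poly p n" by (auto simp: poly_bounded_def)
  have "total_degree (cq_poly (\<Phi> n) :: 'a mpoly) \<le> poly p n" for n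
  proof -
    have "total_degree (cq_poly (\<Phi> n) :: 'a mpoly) \<le> card (cq_free (\<Phi> n))"
      by (rule total_degree_cq_poly[OF wf])
    also have "\<dots> \<le> s n" by (simp add: s_def cq_size_def)
    also have "\<dots> \<le> b n" by (simp add: b_def)
    finally show ?thesis using p[of n] by simp
  qed
  moreover have "\<exists>C. length C \<le> poly p n \<and> circ_computes C (cq_poly (\<Phi> n) :: 'a mpoly)" for n
  proof (rule computable_circuit)
    define M' where "M' = (s n + 1) ^ (quantified_star_size (\<Phi> n) + 1)"
    have M': "M' \<le> M n"
      unfolding M'_def M_def by (rule power_increasing) (use star[of n] in auto)
    have "computable {cq_poly (\<Phi> n) :: 'a mpoly}
        (s n + 1 + (s n + 1 + s n) * ((M' + 1) * (M' + 2)))"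
      using computable_cq_poly[OF wf acyclic, of n] by (simp add: s_def M'_def)
    moreover have "s n + 1 + (s n + 1 + s n) * ((M' + 1) * (M' + 2)) \<le> b n"
      unfolding b_def by (intro add_mono mult_le_mono order_refl M')
    ultimately show "computable {cq_poly (\<Phi> n) :: 'a mpoly} (poly p n)"
      using p[of n] by (meson computable_mono le_trans subset_refl)
  qed
  ultimately show ?thesis unfolding in_VP_def by blast
qed

lemma mconst_add: "mconst (a + b) = mconst a + mconst b"
  by (simp add: mconst_def single_add)

lemma mconst_mult: "mconst (a * b) = mconst a * mconst b"
  by (simp add: mconst_def mult_single)

section \<open>Hardness: from circuits to quadratic systems for homogeneous components\<close>

subsection \<open>Homogeneous components\<close>

definition mon_degree :: "(nat \<Rightarrow>\<^sub>0 nat) \<Rightarrow> nat" where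
  "mon_degree m = (\<Sum>i\<in>Poly_Mapping.keys m. Poly_Mapping.lookup m i)"

lemma mon_degree_add: "mon_degree (m + m') = mon_degree m + mon_degree m'"
  unfolding mon_degree_def by (rule setsum_keys_plus_distrib) auto

lemma mon_degree_eq_0_iff: "mon_degree m = 0 \<longleftrightarrow> m = 0"
  by (auto simp: mon_degree_def in_keys_iff intro: poly_mapping_eqI)

lemma mon_degree_single: "mon_degree (Poly_Mapping.single i 1) = 1"
  by (simp add: mon_degree_def)

definition hom_comp :: "nat \<Rightarrow> 'a::comm_ring_1 mpoly \<Rightarrow> 'a mpoly" where
  "hom_comp i p = (\<Sum>m\<in>{m\<in>Poly_Mapping.keys p. mon_degree m = i}. Poly_Mapping.single m (Poly_Mapping.lookup p m))"

lemma lookup_hom_comp: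
  "Poly_Mapping.lookup (hom_comp i p) m = (if mon_degree m = i then Poly_Mapping.lookup p m else 0)"
  by (simp add: hom_comp_def lookup_sum lookup_single when_def in_keys_iff)

lemma hom_comp_add: "hom_comp i (p + q) = hom_comp i p + hom_comp i q"
  by (rule poly_mapping_eqI) (simp add: lookup_hom_comp lookup_add)

lemma hom_comp_zero: "hom_comp i 0 = 0"
  by (simp add: hom_comp_def)

lemma hom_comp_sum: "hom_comp i (sum f A) = (\<Sum>x\<in>A. hom_comp i (f x))"
  by (induction A rule: infinite_finite_induct) (auto simp: hom_comp_add hom_comp_zero)

lemma hom_comp_single:
  "hom_comp i (Poly_Mapping.single m c) = (if mon_degree m = i then Poly_Mapping.single m c else 0)"
  by (rule poly_mapping_eqI) (auto simp: lookup_hom_comp lookup_single when_def)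

lemma sum_monomials: "p = (\<Sum>m\<in>Poly_Mapping.keys p. Poly_Mapping.single m (Poly_Mapping.lookup p m))"
  by (rule poly_mapping_eqI) (simp add: lookup_sum lookup_single when_def in_keys_iff)

text \<open>Both sides are bilinear in \<open>p\<close> and \<open>q\<close>, so monomials suffice,
  and their degrees add.\<close>

lemma hom_comp_mult: "hom_comp i (p * q) = (\<Sum>j\<le>i. hom_comp j p * hom_comp (i - j) q)"
proof -
  define s where "s r m = Poly_Mapping.single m (Poly_Mapping.lookup r m)" for r :: "'a mpoly" and m
  have expand: "r = (\<Sum>m\<in>Poly_Mapping.keys r. s r m)" for r
    unfolding s_def by (rule sum_monomials)
  have hom: "hom_comp j r = (\<Sum>m\<in>Poly_Mapping.keys r. hom_comp j (s r m))" for j r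
    by (subst expand) (rule hom_comp_sum)
  have single: "hom_comp i (s p m * s q m') = (\<Sum>j\<le>i. hom_comp j (s p m) * hom_comp (i - j) (s q m'))" for m m'
  proof -
    have "(\<Sum>j\<le>i. hom_comp j (s p m) * hom_comp (i - j) (s q m')) =
        (\<Sum>j\<le>i. if j = mon_degree m then s p m * hom_comp (i - j) (s q m') else 0)"
      by (rule sum.cong) (auto simp: s_def hom_comp_single)
    also have "\<dots> = (if mon_degree m \<le> i then s p m * hom_comp (i - mon_degree m) (s q m') else 0)"
      by simp
    also have "\<dots> = hom_comp i (s p m * s q m')"
      by (auto simp: s_def hom_comp_single mult_single mon_degree_add)
    finally show ?thesis by simp
  qed
  have "hom_comp i (p * q) = hom_comp i (\<Sum>m\<in>Poly_Mapping.keys p. \<Sum>m'\<in>Poly_Mapping.keys q. s p m * s q m')"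
    using expand[of p] expand[of q] sum_product[of "s p" "Poly_Mapping.keys p" "s q" "Poly_Mapping.keys q"]
    by argo
  also have "\<dots> = (\<Sum>m\<in>Poly_Mapping.keys p. \<Sum>m'\<in>Poly_Mapping.keys q.
      \<Sum>j\<le>i. hom_comp j (s p m) * hom_comp (i - j) (s q m'))"
    by (simp add: hom_comp_sum single)
  also have "\<dots> = (\<Sum>m\<in>Poly_Mapping.keys p. \<Sum>j\<le>i. \<Sum>m'\<in>Poly_Mapping.keys q.
      hom_comp j (s p m) * hom_comp (i - j) (s q m'))"
    by (intro sum.cong refl sum.swap)
  also have "\<dots> = (\<Sum>j\<le>i. \<Sum>m\<in>Poly_Mapping.keys p. \<Sum>m'\<in>Poly_Mapping.keys q.
      hom_comp j (s p m) * hom_comp (i - j) (s q m'))"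
    by (rule sum.swap)
  also have "\<dots> = (\<Sum>j\<le>i. hom_comp j p * hom_comp (i - j) q)"
    by (simp add: hom[of _ p] hom[of _ q] sum_product)
  finally show ?thesis .
qed

lemma hom_comp_0: "hom_comp 0 p = mconst (Poly_Mapping.lookup p 0)"
  by (rule poly_mapping_eqI)
    (auto simp: lookup_hom_comp mon_degree_eq_0_iff mconst_def lookup_single when_def)

lemma hom_comp_mvar: "hom_comp i (mvar v) = (if i = 1 then mvar v else 0)"
  by (auto simp: mvar_def hom_comp_single mon_degree_single simp del: One_nat_def)

lemma hom_comp_mconst: "hom_comp i (mconst c) = (if i = 0 then mconst c else 0)"
  by (auto simp: mconst_def hom_comp_single mon_degree_def)

lemma hom_comp_scale: "hom_comp i (mconst k * r) = mconst k * hom_comp i r"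
proof -
  have "hom_comp i (mconst k * r) = (\<Sum>j\<le>i. if j = 0 then mconst k * hom_comp (i - j) r else 0)"
    unfolding hom_comp_mult by (rule sum.cong) (auto simp: hom_comp_mconst)
  then show ?thesis by simp
qed

lemma sum_hom_comp:
  assumes "total_degree p \<le> d"
  shows "p = (\<Sum>i\<le>d. hom_comp i p)"
proof (rule poly_mapping_eqI)
  fix m
  have "mon_degree m \<le> d" if "m \<in> Poly_Mapping.keys p"
  proof -
    have "mon_degree m \<le> total_degree p"
      unfolding total_degree_def mon_degree_def by (rule Max_ge) (use that in auto)
    with assms show ?thesis by simp
  qed
  then show "Poly_Mapping.lookup p m = Poly_Mapping.lookup (\<Sum>i\<le>d. hom_comp i p) m"
    by (auto simp: lookup_sum lookup_hom_comp in_keys_iff)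
qed

subsection \<open>Circuits as quadratic systems\<close>

text \<open>The coefficients \<open>l\<close> and \<open>c\<close> are the same for all degrees, and
  the products use only degrees from 1 to \<open>i - 1\<close>. Thus the homogeneous components of
  all gates satisfy one system of bilinear recursions with linear forms as initial values.\<close>

definition quadratic_over ::
    "nat set \<Rightarrow> 'a::comm_ring_1 mpoly list \<Rightarrow> (nat \<Rightarrow> 'a) \<Rightarrow> (nat \<Rightarrow> nat \<Rightarrow> 'a) \<Rightarrow> 'a mpoly \<Rightarrow> bool" where
  "quadratic_over V vs l c p \<longleftrightarrow>
     hom_comp 1 p = (\<Sum>v\<in>V. mconst (l v) * mvar v) \<and>
     (\<forall>i\<ge>2. hom_comp i p = (\<Sum>a<length vs. \<Sum>b<length vs.
        mconst (c a b) * (\<Sum>j\<in>{1..<i}. hom_comp j (vs ! a) * hom_comp (i - j) (vs ! b))))"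

lemma quadratic_over_zero: "quadratic_over V vs (\<lambda>_. 0) (\<lambda>_ _. 0) 0"
  by (simp add: quadratic_over_def hom_comp_zero mconst_0)

lemma quadratic_over_const: "quadratic_over V vs (\<lambda>_. 0) (\<lambda>_ _. 0) (mconst k)"
  by (simp add: quadratic_over_def hom_comp_mconst mconst_0)

lemma quadratic_over_var:
  assumes "finite V" "v \<in> V"
  shows "quadratic_over V vs (\<lambda>v'. of_bool (v' = v)) (\<lambda>_ _. 0) (mvar v :: 'a::comm_ring_1 mpoly)"
proof -
  have "(\<Sum>v'\<in>V. (mconst (of_bool (v' = v)) :: 'a mpoly) * mvar v') = (\<Sum>v'\<in>V. if v' = v then mvar v else 0)"
    by (rule sum.cong) (auto simp: mconst_0 mconst_1)
  then show ?thesis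
    using assms by (simp add: quadratic_over_def hom_comp_mvar mconst_0 del: of_bool_eq_iff)
qed

lemma quadratic_over_add:
  assumes "quadratic_over V vs l c p" "quadratic_over V vs l' c' q"
  shows "quadratic_over V vs (\<lambda>v. l v + l' v) (\<lambda>a b. c a b + c' a b) (p + q)"
  using assms unfolding quadratic_over_def
  by (simp add: hom_comp_add mconst_add algebra_simps sum.distrib)

lemma quadratic_over_scale:
  assumes "quadratic_over V vs l c p"
  shows "quadratic_over V vs (\<lambda>v. k * l v) (\<lambda>a b. k * c a b) (mconst k * p)"
proof -
  show ?thesis
    using assms unfolding quadratic_over_def
    by (simp add: hom_comp_scale mconst_mult sum_distrib_left mult.assoc)
qed

lemma hom_comp_mult_split:
  assumes "i \<ge> 1"
  shows "hom_comp i (p * q) = hom_comp i (mconst (Poly_Mapping.lookup p 0) * q) +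
     hom_comp i (mconst (Poly_Mapping.lookup q 0) * p) + (\<Sum>j\<in>{1..<i}. hom_comp j p * hom_comp (i - j) q)"
proof -
  have "{..i} = insert 0 (insert i {1..<i})" using assms by auto
  then show ?thesis
    using assms by (simp add: hom_comp_scale hom_comp_mult[of i p q] hom_comp_0 mult.commute[of "hom_comp i p"])
qed

text \<open>The terms of degree 0 in one factor are scalar multiples of the other factor and are
  collected in \<open>r\<close>, which is covered by the hypotheses on both factors. What remains is
  the single product \<open>(a, b)\<close>, added to the coefficients by an indicator.\<close>

lemma quadratic_over_mult:
  assumes "a < length vs" "b < length vs"
    and "quadratic_over V vs l c (vs ! a)" "quadratic_over V vs l' c' (vs ! b)"
  shows "\<exists>l c. quadratic_over V vs l c (vs ! a * vs ! b)"
proof -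
  define k where "k = Poly_Mapping.lookup (vs ! a) 0"
  define k' where "k' = Poly_Mapping.lookup (vs ! b) 0"
  define r where "r = mconst k * vs ! b + mconst k' * vs ! a"
  obtain l0 c0 where r: "quadratic_over V vs l0 c0 r"
    using quadratic_over_add[OF quadratic_over_scale[OF assms(4)] quadratic_over_scale[OF assms(3)]]
    unfolding r_def by blast
  have split: "hom_comp i (vs ! a * vs ! b) =
      hom_comp i r + (\<Sum>j\<in>{1..<i}. hom_comp j (vs ! a) * hom_comp (i - j) (vs ! b))" if "i \<ge> 1" for i
    using hom_comp_mult_split[OF that] by (simp add: r_def k_def k'_def hom_comp_add)
  define X where "X i a' b' = (\<Sum>j\<in>{1..<i}. hom_comp j (vs ! a') * hom_comp (i - j) (vs ! b'))" for i a' b'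
  have delta: "(\<Sum>a'<length vs. \<Sum>b'<length vs. mconst (of_bool (a' = a \<and> b' = b)) * X i a' b') = X i a b" for i
  proof -
    have "(\<Sum>a'<length vs. \<Sum>b'<length vs. mconst (of_bool (a' = a \<and> b' = b)) * X i a' b') =
       (\<Sum>a'<length vs. if a' = a then (\<Sum>b'<length vs. if b' = b then X i a b else 0) else 0)"
    proof (rule sum.cong)
      fix a'
      have "(\<Sum>b'<length vs. mconst (of_bool (a' = a \<and> b' = b)) * X i a' b') =
          (\<Sum>b'<length vs. if a' = a then (if b' = b then X i a b else 0) else 0)"
        by (rule sum.cong) (auto simp: mconst_0 mconst_1)
      then show "(\<Sum>b'<length vs. mconst (of_bool (a' = a \<and> b' = b)) * X i a' b') =
          (if a' = a then (\<Sum>b'<length vs. if b' = b then X i a b else 0) else 0)"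
        by (cases "a' = a") simp_all
    qed simp
    also have "\<dots> = X i a b" using assms by simp
    finally show ?thesis .
  qed
  have "quadratic_over V vs l0 (\<lambda>a' b'. c0 a' b' + of_bool (a' = a \<and> b' = b)) (vs ! a * vs ! b)"
    unfolding quadratic_over_def
  proof (intro conjI allI impI)
    show "hom_comp 1 (vs ! a * vs ! b) = (\<Sum>v\<in>V. mconst (l0 v) * mvar v)"
      using r split[of 1] by (simp add: quadratic_over_def)
    fix i :: nat assume i: "i \<ge> 2"
    have "hom_comp i (vs ! a * vs ! b) = hom_comp i r + X i a b"
      using split[of i] i by (simp add: X_def)
    also have "hom_comp i r = (\<Sum>a'<length vs. \<Sum>b'<length vs. mconst (c0 a' b') * X i a' b')"
      using r i by (simp add: quadratic_over_def X_def)
    finally show "hom_comp i (vs ! a * vs ! b) = (\<Sum>a'<length vs. \<Sum>b'<length vs.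
        mconst (c0 a' b' + of_bool (a' = a \<and> b' = b)) *
        (\<Sum>j\<in>{1..<i}. hom_comp j (vs ! a') * hom_comp (i - j) (vs ! b')))"
      unfolding X_def[symmetric] using delta[of i] by (simp add: mconst_add distrib_right sum.distrib)
  qed
  then show ?thesis by blast
qed

lemma circuit_quadratic:
  assumes "g < length C"
  shows "\<exists>l c. quadratic_over {v. GVar v \<in> set C} (circ_vals C) l c (circ_vals C ! g)"
  using assms
proof (induction g rule: less_induct)
  case (less g)
  let ?V = "{v. GVar v \<in> set C}" and ?vs = "circ_vals C"
  have "?V \<subseteq> (\<lambda>x. case x of GVar v \<Rightarrow> v | _ \<Rightarrow> 0) ` set C" by force
  then have fin: "finite ?V" by (meson finite_imageI finite_set finite_subset)
  have val: "?vs ! g = gate_eval (take g ?vs) (C ! g)" by (rule circ_vals_nth[OF less.prems])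
  have zero: "\<exists>l c. quadratic_over ?V ?vs l c 0" using quadratic_over_zero by blast
  have arg: "\<exists>l c. quadratic_over ?V ?vs l c (?vs ! j)" "take g ?vs ! j = ?vs ! j" "j < length ?vs"
    if "j < length (take g ?vs)" for j
    using that less by auto
  show ?case
  proof (cases "C ! g")
    case (GVar v)
    then have "v \<in> ?V" using less.prems by (metis mem_Collect_eq nth_mem)
    with quadratic_over_var[OF fin] show ?thesis using val GVar by auto
  next
    case (GConst k)
    then have "?vs ! g = mconst k" using val by simp
    then show ?thesis using quadratic_over_const by metis
  next
    case (GPlus j k)
    show ?thesis
    proof (cases "j < length (take g ?vs) \<and> k < length (take g ?vs)")
      case True
      then have "?vs ! g = ?vs ! j + ?vs ! k" using val GPlus arg(2) by simp
      moreover obtain l c l' c' where "quadratic_over ?V ?vs l c (?vs ! j)"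
          "quadratic_over ?V ?vs l' c' (?vs ! k)"
        using arg(1) True by blast
      ultimately show ?thesis using quadratic_over_add by (intro exI) simp
    next
      case False
      \<comment> \<open>A gate that does not point to earlier gates has the default value 0.\<close>
      then have "?vs ! g = 0" unfolding val GPlus gate_eval.simps by (rule if_not_P)
      then show ?thesis using zero by simp
    qed
  next
    case (GTimes j k)
    show ?thesis
    proof (cases "j < length (take g ?vs) \<and> k < length (take g ?vs)")
      case True
      then have "?vs ! g = ?vs ! j * ?vs ! k" using val GTimes arg(2) by simp
      moreover obtain l c l' c' where "quadratic_over ?V ?vs l c (?vs ! j)"
          "quadratic_over ?V ?vs l' c' (?vs ! k)"
        using arg(1) True by blast
      moreover have "j < length ?vs" "k < length ?vs" using True by auto
      ultimately show ?thesis using quadratic_over_mult[of j ?vs k ?V l c l' c'] by (simp only:)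
    next
      case False
      then have "?vs ! g = 0" unfolding val GTimes gate_eval.simps by (rule if_not_P)
      then show ?thesis using zero by simp
    qed
  qed
qed

lemma circuit_quadratic_system:
  fixes C :: "'a::comm_ring_1 gate list"
  defines "s \<equiv> length C"
  defines "V \<equiv> {v. GVar v \<in> set C}"
  shows "finite V" "card V \<le> s"
    "\<exists>l c. \<forall>g<s. hom_comp 1 (circ_vals C ! g) = (\<Sum>v\<in>V. mconst (l g v) * mvar v) \<and>
       (\<forall>i\<ge>2. hom_comp i (circ_vals C ! g) = (\<Sum>a<s. \<Sum>b<s. mconst (c g a b) *
          (\<Sum>j\<in>{1..<i}. hom_comp j (circ_vals C ! a) * hom_comp (i - j) (circ_vals C ! b))))"
proof -
  have sub: "V \<subseteq> (\<lambda>x. case x of GVar v \<Rightarrow> v | _ \<Rightarrow> 0) ` set C" unfolding V_def by force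
  then show "finite V" by (meson finite_imageI finite_set finite_subset)
  have "card V \<le> card (set C)" using surj_card_le[OF _ sub] by simp
  then show "card V \<le> s" unfolding s_def using card_length le_trans by blast
  have "\<forall>g<s. \<exists>l c. quadratic_over V (circ_vals C) l c (circ_vals C ! g)"
    using circuit_quadratic unfolding s_def V_def by blast
  then obtain l c where "\<forall>g<s. quadratic_over V (circ_vals C) (l g) (c g) (circ_vals C ! g)"
    by metis
  then show "\<exists>l c. \<forall>g<s. hom_comp 1 (circ_vals C ! g) = (\<Sum>v\<in>V. mconst (l g v) * mvar v) \<and>
       (\<forall>i\<ge>2. hom_comp i (circ_vals C ! g) = (\<Sum>a<s. \<Sum>b<s. mconst (c g a b) *
          (\<Sum>j\<in>{1..<i}. hom_comp j (circ_vals C ! a) * hom_comp (i - j) (circ_vals C ! b))))"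
    unfolding quadratic_over_def s_def by (intro exI[of _ l] exI[of _ c]) simp
qed

section \<open>Depth reduction by cutting heavy paths\<close>

subsection \<open>Balanced expansion of quadratic systems\<close>

text \<open>The coefficient of degree \<open>j\<close> of the matrix \<open>(1 - (M\<^sub>1 + M\<^sub>2 + \<dots>))\<inverse>\<close> of size \<open>s\<close>,
  with \<open>M\<^sub>b\<close> in degree \<open>b\<close>.\<close>

fun resolvent :: "nat \<Rightarrow> (nat \<Rightarrow> nat \<Rightarrow> nat \<Rightarrow> 'r::comm_ring_1) \<Rightarrow> nat \<Rightarrow> nat \<Rightarrow> nat \<Rightarrow> 'r" where
  "resolvent s M 0 g h = of_bool (g = h)"
| "resolvent s M (Suc j) g h = (\<Sum>b\<le>j. \<Sum>x<s. M (Suc b) g x * resolvent s M (j - b) x h)"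

lemma resolvent_rec:
  assumes "j \<ge> 1"
  shows "resolvent s M j g h = (\<Sum>b\<in>{1..j}. \<Sum>x<s. M b g x * resolvent s M (j - b) x h)"
proof -
  obtain i where j: "j = Suc i" using assms by (cases j) auto
  have "{1..j} = Suc ` {..i}" unfolding j by (simp add: atMost_atLeast0)
  then show ?thesis by (simp add: j sum.reindex)
qed

text \<open>Above degree \<open>m\<close> the hypothesis reads \<open>V = K + M V\<close>, hence
  \<open>V = (1 - M)^(-1) K\<close>. The bound \<open>b \<le> d - m - 1\<close> says that the
  recursion is followed only while the degree \<open>d - b\<close> stays above
  \<open>m\<close>.\<close>

lemma resolvent_expansion:
  fixes V K :: "nat \<Rightarrow> nat \<Rightarrow> 'r::comm_ring_1"
  assumes rec: "\<And>g d. g < s \<Longrightarrow> m < d \<Longrightarrow> d \<le> D \<Longrightarrow>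
      V g d = K g d + (\<Sum>b\<in>{1..d - m - 1}. \<Sum>x<s. M b g x * V x (d - b))"
    and "g < s" "m < d" "d \<le> D"
  shows "V g d = (\<Sum>e\<in>{m<..d}. \<Sum>x<s. resolvent s M (d - e) g x * K x e)"
  using assms(2-)
proof (induction d arbitrary: g rule: less_induct)
  case (less d)
  have app: "(\<Sum>b\<in>{1..j}. \<Sum>x<s. M b g x * (\<Sum>y<s. resolvent s M (j - b) x y * W y)) =
      (\<Sum>y<s. resolvent s M j g y * W y)" if "j \<ge> 1" for j W
  proof -
    have "(\<Sum>b\<in>{1..j}. \<Sum>x<s. M b g x * (\<Sum>y<s. resolvent s M (j - b) x y * W y)) =
      (\<Sum>b\<in>{1..j}. \<Sum>x<s. \<Sum>y<s. M b g x * resolvent s M (j - b) x y * W y)"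
      by (simp add: sum_distrib_left mult.assoc)
    also have "\<dots> = (\<Sum>b\<in>{1..j}. \<Sum>y<s. \<Sum>x<s. M b g x * resolvent s M (j - b) x y * W y)"
      by (intro sum.cong refl sum.swap)
    also have "\<dots> = (\<Sum>y<s. \<Sum>b\<in>{1..j}. \<Sum>x<s. M b g x * resolvent s M (j - b) x y * W y)"
      by (rule sum.swap)
    also have "\<dots> = (\<Sum>y<s. resolvent s M j g y * W y)"
      by (simp add: resolvent_rec[OF that] sum_distrib_right)
    finally show ?thesis .
  qed
  let ?f = "\<lambda>b e. \<Sum>x<s. M b g x * (\<Sum>y<s. resolvent s M (d - b - e) x y * K y e)"
  have "V g d = K g d + (\<Sum>b\<in>{1..d - m - 1}. \<Sum>x<s. M b g x * V x (d - b))"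
    using rec less.prems by blast
  also have "(\<Sum>b\<in>{1..d - m - 1}. \<Sum>x<s. M b g x * V x (d - b)) =
      (\<Sum>b\<in>{1..d - m - 1}. \<Sum>x<s. M b g x * (\<Sum>e\<in>{m<..d - b}. \<Sum>y<s. resolvent s M (d - b - e) x y * K y e))"
    by (intro sum.cong refl arg_cong2[of _ _ _ _ "(*)"] less.IH) (use less.prems in auto)
  also have "\<dots> = (\<Sum>b\<in>{1..d - m - 1}. \<Sum>e\<in>{m<..d - b}. ?f b e)"
    unfolding sum_distrib_left[where A = "{m<.._}"] by (intro sum.cong refl sum.swap)
  also have "\<dots> = (\<Sum>(b, e)\<in>Sigma {1..d - m - 1} (\<lambda>b. {m<..d - b}). ?f b e)"
    by (rule sum.Sigma) auto
  also have "\<dots> = (\<Sum>(e, b)\<in>Sigma {m<..<d} (\<lambda>e. {1..d - e}). ?f b e)"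
    by (rule sum.reindex_bij_witness[where i = "\<lambda>(e, b). (b, e)" and j = "\<lambda>(b, e). (e, b)"]) auto
  also have "\<dots> = (\<Sum>e\<in>{m<..<d}. \<Sum>b\<in>{1..d - e}. ?f b e)"
    by (rule sum.Sigma[symmetric]) auto
  also have "\<dots> = (\<Sum>e\<in>{m<..<d}. \<Sum>x<s. resolvent s M (d - e) g x * K x e)"
  proof (rule sum.cong)
    fix e assume "e \<in> {m<..<d}"
    then have "d - e \<ge> 1" by auto
    from app[OF this, of "\<lambda>y. K y e"]
    show "(\<Sum>b\<in>{1..d - e}. ?f b e) = (\<Sum>x<s. resolvent s M (d - e) g x * K x e)"
      by (simp add: add.commute)
  qed simp
  also have "K g d = (\<Sum>x<s. resolvent s M (d - d) g x * K x d)"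
  proof -
    have "(\<Sum>x<s. resolvent s M (d - d) g x * K x d) = (\<Sum>x<s. if x = g then K x d else 0)"
      by (rule sum.cong) auto
    then show ?thesis using less.prems by simp
  qed
  also have "(\<Sum>x<s. resolvent s M (d - d) g x * K x d) +
      (\<Sum>e\<in>{m<..<d}. \<Sum>x<s. resolvent s M (d - e) g x * K x e) =
      (\<Sum>e\<in>insert d {m<..<d}. \<Sum>x<s. resolvent s M (d - e) g x * K x e)"
    by simp
  also have "insert d {m<..<d} = {m<..d}" using less.prems by auto
  finally show ?case .
qed

text \<open>\<open>L b\<close> is the operator of multiplying, from the left and from the right, by
  components of degree \<open>b\<close>: one step down the heavy path from gate \<open>g\<close> to
  \<open>x\<close>, with the light sibling \<open>z\<close> of degree \<open>b\<close>.\<close>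

context
  fixes s :: nat and c :: "nat \<Rightarrow> nat \<Rightarrow> nat \<Rightarrow> 'r::comm_ring_1" and F :: "nat \<Rightarrow> nat \<Rightarrow> 'r"
    and L :: "nat \<Rightarrow> nat \<Rightarrow> nat \<Rightarrow> 'r"
  assumes quad: "\<And>g d. g < s \<Longrightarrow> d \<ge> 2 \<Longrightarrow>
      F g d = (\<Sum>a<s. \<Sum>b<s. c g a b * (\<Sum>j\<in>{1..<d}. F a j * F b (d - j)))"
  defines "L \<equiv> \<lambda>b g x. \<Sum>z<s. (c g z x + c g x z) * F z b"
begin

text \<open>As \<open>d \<le> 2 * m + 1\<close>, at most one of \<open>j\<close> and
  \<open>d - j\<close> exceeds \<open>m\<close>. Terms with a factor above \<open>m\<close> are
  \<open>L\<close> applied to that factor; the others form the inhomogeneous part \<open>K\<close>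
  of \<open>resolvent_expansion\<close>. In the result, \<open>x\<close> and \<open>e\<close> are
  gate and degree of the last node on the heavy path whose degree exceeds \<open>m\<close>.\<close>

lemma quadratic_expansion:
  assumes "g < s" "1 \<le> m" "m < d" "d \<le> 2 * m + 1"
  shows "F g d = (\<Sum>e\<in>{m<..d}. \<Sum>x<s. resolvent s L (d - e) g x *
     (\<Sum>a<s. \<Sum>b<s. c x a b * (\<Sum>j\<in>{j. 1 \<le> j \<and> j \<le> m \<and> j < e \<and> e \<le> j + m}. F a j * F b (e - j))))"
proof (rule resolvent_expansion[where D = "2 * m + 1"])
  fix g d assume gd: "g < s" "m < d" "d \<le> 2 * m + 1"
  let ?H = "{j. 1 \<le> j \<and> j \<le> m \<and> j < d \<and> d \<le> j + m}"
  have split: "(\<Sum>j\<in>{1..<d}. F a j * F b (d - j)) = (\<Sum>j\<in>?H. F a j * F b (d - j)) +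
     (\<Sum>i\<in>{1..d - m - 1}. F b i * F a (d - i)) + (\<Sum>i\<in>{1..d - m - 1}. F a i * F b (d - i))" for a b
  proof -
    have un: "{1..<d} = ?H \<union> {m<..<d} \<union> {1..d - m - 1}" using gd by auto
    have "(\<Sum>j\<in>{1..<d}. F a j * F b (d - j)) = (\<Sum>j\<in>?H \<union> {m<..<d}. F a j * F b (d - j)) +
        (\<Sum>i\<in>{1..d - m - 1}. F a i * F b (d - i))"
      unfolding un by (rule sum.union_disjoint) (use gd in auto)
    also have "(\<Sum>j\<in>?H \<union> {m<..<d}. F a j * F b (d - j)) = (\<Sum>j\<in>?H. F a j * F b (d - j)) +
        (\<Sum>j\<in>{m<..<d}. F a j * F b (d - j))"
      by (rule sum.union_disjoint) (use gd in auto)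
    also have "(\<Sum>j\<in>{m<..<d}. F a j * F b (d - j)) = (\<Sum>i\<in>{1..d - m - 1}. F b i * F a (d - i))"
      by (rule sum.reindex_bij_witness[where i = "\<lambda>i. d - i" and j = "\<lambda>i. d - i"])
        (use gd in \<open>auto simp: mult.commute\<close>)
    finally show ?thesis .
  qed
  have "(\<Sum>i\<in>{1..d - m - 1}. \<Sum>x<s. L i g x * F x (d - i)) =
      (\<Sum>i\<in>{1..d - m - 1}. \<Sum>a<s. \<Sum>b<s. c g a b * (F b i * F a (d - i)) + c g a b * (F a i * F b (d - i)))"
  proof (rule sum.cong)
    fix i
    have "(\<Sum>x<s. L i g x * F x (d - i)) =
        (\<Sum>x<s. \<Sum>z<s. c g z x * (F z i * F x (d - i))) + (\<Sum>x<s. \<Sum>z<s. c g x z * (F z i * F x (d - i)))"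
      unfolding L_def sum_distrib_right sum.distrib[symmetric]
      by (intro sum.cong refl) (simp add: algebra_simps)
    also have "(\<Sum>x<s. \<Sum>z<s. c g z x * (F z i * F x (d - i))) = (\<Sum>a<s. \<Sum>b<s. c g a b * (F a i * F b (d - i)))"
      by (rule sum.swap)
    finally show "(\<Sum>x<s. L i g x * F x (d - i)) =
        (\<Sum>a<s. \<Sum>b<s. c g a b * (F b i * F a (d - i)) + c g a b * (F a i * F b (d - i)))"
      by (simp add: sum.distrib add.commute)
  qed simp
  also have "\<dots> = (\<Sum>a<s. \<Sum>b<s. \<Sum>i\<in>{1..d - m - 1}. c g a b * (F b i * F a (d - i)) + c g a b * (F a i * F b (d - i)))"
    by (subst sum.swap) (intro sum.cong refl sum.swap)
  also have "\<dots> = (\<Sum>a<s. \<Sum>b<s. c g a b * ((\<Sum>i\<in>{1..d - m - 1}. F b i * F a (d - i)) +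
      (\<Sum>i\<in>{1..d - m - 1}. F a i * F b (d - i))))"
    by (simp add: sum.distrib sum_distrib_left distrib_left)
  finally have L: "(\<Sum>i\<in>{1..d - m - 1}. \<Sum>x<s. L i g x * F x (d - i)) = \<dots>" .
  have "F g d = (\<Sum>a<s. \<Sum>b<s. c g a b * (\<Sum>j\<in>{1..<d}. F a j * F b (d - j)))"
    by (rule quad) (use gd assms in auto)
  also have "\<dots> = (\<Sum>a<s. \<Sum>b<s. c g a b * (\<Sum>j\<in>?H. F a j * F b (d - j))) +
      (\<Sum>a<s. \<Sum>b<s. c g a b * ((\<Sum>i\<in>{1..d - m - 1}. F b i * F a (d - i)) +
      (\<Sum>i\<in>{1..d - m - 1}. F a i * F b (d - i))))"
    unfolding split by (simp add: distrib_left sum.distrib add.assoc)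
  finally show "F g d = (\<Sum>a<s. \<Sum>b<s. c g a b * (\<Sum>j\<in>?H. F a j * F b (d - j))) +
      (\<Sum>i\<in>{1..d - m - 1}. \<Sum>x<s. L i g x * F x (d - i))"
    unfolding L .
qed (use assms in auto)

text \<open>A product of operators of total degree \<open>j\<close> is cut at the factor where the
  remaining degree drops from \<open>e > m\<close> to \<open>k \<le> m\<close>. That factor has
  degree \<open>e - k\<close>, which can be as large as \<open>j\<close>.\<close>

lemma resolvent_balanced:
  assumes "g < s" "m < j"
  shows "resolvent s L j g h = (\<Sum>e\<in>{m<..j}. \<Sum>x<s. resolvent s L (j - e) g x *
     (\<Sum>k\<le>m. \<Sum>y<s. L (e - k) x y * resolvent s L k y h))"
proof (rule resolvent_expansion[where V = "\<lambda>g j. resolvent s L j g h" and D = j])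
  fix g d assume gd: "g < s" "m < d" "d \<le> j"
  have un: "{1..d} = {d - m..d} \<union> {1..d - m - 1}" using gd by auto
  have "resolvent s L d g h = (\<Sum>b\<in>{1..d}. \<Sum>x<s. L b g x * resolvent s L (d - b) x h)"
    by (rule resolvent_rec) (use gd in auto)
  also have "\<dots> = (\<Sum>b\<in>{d - m..d}. \<Sum>x<s. L b g x * resolvent s L (d - b) x h) +
      (\<Sum>b\<in>{1..d - m - 1}. \<Sum>x<s. L b g x * resolvent s L (d - b) x h)"
    unfolding un by (rule sum.union_disjoint) (use gd in auto)
  also have "(\<Sum>b\<in>{d - m..d}. \<Sum>x<s. L b g x * resolvent s L (d - b) x h) =
      (\<Sum>k\<le>m. \<Sum>y<s. L (d - k) g y * resolvent s L k y h)"
    by (rule sum.reindex_bij_witness[where i = "\<lambda>k. d - k" and j = "\<lambda>k. d - k"]) (use gd in auto)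
  finally show "resolvent s L d g h = (\<Sum>k\<le>m. \<Sum>y<s. L (d - k) g y * resolvent s L k y h) +
      (\<Sum>b\<in>{1..d - m - 1}. \<Sum>x<s. L b g x * resolvent s L (d - b) x h)" .
qed (use assms in auto)

end

section \<open>Weighted ternary grammars as tree-shaped queries\<close>

subsection \<open>Substitution\<close>

definition mon_subst :: "(nat \<Rightarrow> 'a::comm_ring_1 mpoly) \<Rightarrow> (nat \<Rightarrow>\<^sub>0 nat) \<Rightarrow> 'a mpoly" where
  "mon_subst s m = (\<Prod>i\<in>Poly_Mapping.keys m. s i ^ Poly_Mapping.lookup m i)"

lemma mon_subst_superset:
  "finite K \<Longrightarrow> Poly_Mapping.keys m \<subseteq> K \<Longrightarrow> mon_subst s m = (\<Prod>i\<in>K. s i ^ Poly_Mapping.lookup m i)"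
  unfolding mon_subst_def by (rule prod.mono_neutral_left) (auto simp: in_keys_iff)

lemma mon_subst_add: "mon_subst s (m + m') = mon_subst s m * mon_subst s m'"
proof -
  let ?K = "Poly_Mapping.keys m \<union> Poly_Mapping.keys m'"
  have "mon_subst s n = (\<Prod>i\<in>?K. s i ^ Poly_Mapping.lookup n i)" if "n \<in> {m, m', m + m'}" for n
    by (rule mon_subst_superset) (use that keys_add[of m m'] in auto)
  then show ?thesis by (simp add: lookup_add power_add prod.distrib)
qed

lemma mon_subst_sum_single:
  "mon_subst s (\<Sum>x\<in>X. Poly_Mapping.single (a x) 1) = (\<Prod>x\<in>X. s (a x))"
proof (induction X rule: infinite_finite_induct)
  case (insert x X)
  have "mon_subst s (Poly_Mapping.single (a x) 1) = s (a x)" by (simp add: mon_subst_def)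
  then show ?case using insert by (simp add: mon_subst_add del: One_nat_def)
qed (simp_all add: mon_subst_def)

lemma msubst_superset:
  assumes "finite K" "Poly_Mapping.keys p \<subseteq> K"
  shows "msubst s p = (\<Sum>m\<in>K. mconst (Poly_Mapping.lookup p m) * mon_subst s m)"
  unfolding msubst_def mon_subst_def[symmetric]
  by (rule sum.mono_neutral_left) (use assms in \<open>auto simp: in_keys_iff mconst_0\<close>)

lemma msubst_add: "msubst s (p + q) = msubst s p + msubst s q"
proof -
  let ?K = "Poly_Mapping.keys p \<union> Poly_Mapping.keys q"
  have "msubst s r = (\<Sum>m\<in>?K. mconst (Poly_Mapping.lookup r m) * mon_subst s m)" if "r \<in> {p, q, p + q}" for r
    by (rule msubst_superset) (use that keys_add[of p q] in auto)
  then show ?thesis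
    by (simp add: lookup_add mconst_def single_add distrib_right sum.distrib)
qed

lemma msubst_sum_prod_mvar:
  "msubst s (\<Sum>a\<in>A. \<Prod>x\<in>X. mvar (a x)) = (\<Sum>a\<in>A. \<Prod>x\<in>X. s (a x))"
proof (induction A rule: infinite_finite_induct)
  case (insert a A)
  have "msubst s (Poly_Mapping.single m 1) = mon_subst s m" for m
    by (subst msubst_superset[of "{m}"]) (auto simp: mconst_1)
  then have "msubst s (\<Prod>x\<in>X. mvar (a x)) = (\<Prod>x\<in>X. s (a x))"
    unfolding prod_mvar by (simp only: mon_subst_sum_single)
  then show ?case using insert by (simp add: msubst_add)
qed (simp_all add: msubst_def)

subsection \<open>Ternary tree grammars as tree-shaped queries\<close>

text \<open>The nodes of the complete ternary tree of depth \<open>k\<close>, as paths from the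
  root.\<close>

definition addresses :: "nat \<Rightarrow> nat list set" where
  "addresses k = {p. set p \<subseteq> {..<3} \<and> length p \<le> k}"

lemma finite_addresses: "finite (addresses k)"
  unfolding addresses_def by (rule finite_lists_length_le) simp

lemma card_addresses: "card (addresses k) \<le> 3 ^ (k + 1)"
proof -
  have "card (addresses k) = (\<Sum>i\<le>k. 3 ^ i)"
    unfolding addresses_def by (subst card_lists_length_le) auto
  also have "\<dots> \<le> 3 ^ (k + 1)" by (induction k) auto
  finally show ?thesis .
qed

lemma addresses_0: "addresses 0 = {[]}"
  by (auto simp: addresses_def)

lemma addresses_Suc: "addresses (Suc k) = insert [] ((\<lambda>(i, p). i # p) ` ({..<3} \<times> addresses k))"
  (is "?L = ?R")
proof
  show "?L \<subseteq> ?R"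
  proof
    fix p assume "p \<in> ?L"
    then show "p \<in> ?R" by (cases p) (auto simp: addresses_def)
  qed
qed (auto simp: addresses_def)

text \<open>The generating polynomial of a weighted grammar, restricted to derivation trees in which
  all leaves have depth exactly \<open>k\<close>.\<close>

fun tree_value ::
    "'s list set \<Rightarrow> ('s list \<Rightarrow> 'a) \<Rightarrow> ('s \<Rightarrow> 'a::comm_ring_1 mpoly) \<Rightarrow> nat \<Rightarrow> 's \<Rightarrow> 'a mpoly" where
  "tree_value R w u 0 \<sigma> = u \<sigma>"
| "tree_value R w u (Suc k) \<sigma> =
     (\<Sum>ts\<in>{ts. \<sigma> # ts \<in> R}. mconst (w (\<sigma> # ts)) * (\<Prod>i<3. tree_value R w u k (ts ! i)))"

text \<open>A derivation tree of depth \<open>k\<close> labels the inner nodes with rules \<open>\<sigma> # ts\<close> and the leaves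
  with one-element lists, so that the head of the label of a child is the symbol the label of the
  parent prescribes for it.\<close>

definition derivations :: "'s set \<Rightarrow> 's list set \<Rightarrow> nat \<Rightarrow> 's \<Rightarrow> (nat list \<Rightarrow> 's list) set" where
  "derivations Sym R k \<sigma> = {b \<in> extensional (addresses k). hd (b []) = \<sigma> \<and>
     (\<forall>p\<in>addresses k. if length p < k then b p \<in> R else b p \<in> (\<lambda>\<sigma>. [\<sigma>]) ` Sym) \<and>
     (\<forall>p\<in>addresses k. length p < k \<longrightarrow> (\<forall>i<3. hd (b (p @ [i])) = b p ! Suc i))}"

text \<open>The length tells leaf labels (one symbol) from rules (four symbols).\<close>

definition label_weight :: "('s list \<Rightarrow> 'a) \<Rightarrow> ('s \<Rightarrow> 'a::comm_ring_1 mpoly) \<Rightarrow> 's list \<Rightarrow> 'a mpoly" where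
  "label_weight w u v = (if length v = 1 then u (hd v) else mconst (w v))"

lemma finite_derivations:
  assumes "finite Sym" "finite R"
  shows "finite (derivations Sym R k \<sigma>)"
proof -
  have "derivations Sym R k \<sigma> \<subseteq> addresses k \<rightarrow>\<^sub>E (R \<union> (\<lambda>\<sigma>. [\<sigma>]) ` Sym)"
    by (auto simp: derivations_def PiE_def split: if_splits)
  then show ?thesis
    by (rule finite_subset) (use assms finite_addresses in \<open>auto intro!: finite_PiE\<close>)
qed

text \<open>\<open>j\<close> grafts three subtrees onto a root rule; the first letter of an address
  selects the subtree.\<close>

lemma derivations_Suc_bij:
  assumes R: "\<And>v. v \<in> R \<Longrightarrow> length v = 4"
  defines "j \<equiv> \<lambda>k \<sigma> (ts, g). \<lambda>p\<in>addresses (Suc k). case p of [] \<Rightarrow> \<sigma> # ts | i # q \<Rightarrow> g i q"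
  shows "bij_betw (j k \<sigma>)
    (Sigma {ts. \<sigma> # ts \<in> R} (\<lambda>ts. PiE {..<3} (\<lambda>i. derivations Sym R k (ts ! i))))
    (derivations Sym R (Suc k) \<sigma>)"
proof (rule bij_betw_byWitness[where
      f' = "\<lambda>b. (tl (b []), \<lambda>i\<in>{..<3}. \<lambda>q\<in>addresses k. b (i # q))"])
  let ?X = "Sigma {ts. \<sigma> # ts \<in> R} (\<lambda>ts. PiE {..<3} (\<lambda>i. derivations Sym R k (ts ! i)))"
  have root: "[] \<in> addresses (Suc k)" "[] \<in> addresses k" by (auto simp: addresses_def)
  have child: "i # q \<in> addresses (Suc k) \<longleftrightarrow> i < 3 \<and> q \<in> addresses k" for i q
    by (auto simp: addresses_def)
  show "\<forall>x\<in>?X. (tl (j k \<sigma> x []), \<lambda>i\<in>{..<3}. \<lambda>q\<in>addresses k. j k \<sigma> x (i # q)) = x"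
  proof
    fix x assume x: "x \<in> ?X"
    obtain ts g where x_eq: "x = (ts, g)" by force
    have g: "g \<in> PiE {..<3} (\<lambda>i. derivations Sym R k (ts ! i))" using x x_eq by auto
    have "(\<lambda>i\<in>{..<3}. \<lambda>q\<in>addresses k. j k \<sigma> x (i # q)) = g"
    proof (rule extensionalityI[of _ "{..<3}"])
      show "g \<in> extensional {..<3}" using g by (auto simp: PiE_def)
      fix i :: nat assume i: "i \<in> {..<3}"
      then have "g i \<in> extensional (addresses k)" using g by (auto simp: derivations_def)
      then have "(\<lambda>q\<in>addresses k. j k \<sigma> x (i # q)) = g i"
        by (intro extensionalityI[of _ "addresses k"]) (use i in \<open>auto simp: j_def x_eq child\<close>)
      with i show "(\<lambda>i\<in>{..<3}. \<lambda>q\<in>addresses k. j k \<sigma> x (i # q)) i = g i" by simp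
    qed simp
    then show "(tl (j k \<sigma> x []), \<lambda>i\<in>{..<3}. \<lambda>q\<in>addresses k. j k \<sigma> x (i # q)) = x"
      by (simp add: x_eq j_def root)
  qed
  show "\<forall>b\<in>derivations Sym R (Suc k) \<sigma>.
      j k \<sigma> (tl (b []), \<lambda>i\<in>{..<3}. \<lambda>q\<in>addresses k. b (i # q)) = b"
  proof
    fix b assume b: "b \<in> derivations Sym R (Suc k) \<sigma>"
    then have "b [] \<in> R" "hd (b []) = \<sigma>" using root by (auto simp: derivations_def)
    then have b0: "\<sigma> # tl (b []) = b []" using R by (metis list.collapse list.size(3) zero_neq_numeral)
    show "j k \<sigma> (tl (b []), \<lambda>i\<in>{..<3}. \<lambda>q\<in>addresses k. b (i # q)) = b"
    proof (rule extensionalityI[of _ "addresses (Suc k)"])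
      show "b \<in> extensional (addresses (Suc k))" using b by (simp add: derivations_def)
      fix p assume "p \<in> addresses (Suc k)"
      then show "j k \<sigma> (tl (b []), \<lambda>i\<in>{..<3}. \<lambda>q\<in>addresses k. b (i # q)) p = b p"
        using b0 child by (cases p) (auto simp: j_def)
    qed (simp add: j_def)
  qed
  show "j k \<sigma> ` ?X \<subseteq> derivations Sym R (Suc k) \<sigma>"
  proof
    fix b assume "b \<in> j k \<sigma> ` ?X"
    then obtain ts g where b: "b = j k \<sigma> (ts, g)" "\<sigma> # ts \<in> R"
      and g: "g \<in> PiE {..<3} (\<lambda>i. derivations Sym R k (ts ! i))" by auto
    have b0: "b [] = \<sigma> # ts" using root by (simp add: b j_def)
    have bi: "b (i # q) = g i q" if "i < 3" "q \<in> addresses k" for i q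
      using that child by (simp add: b j_def)
    have gi: "g i \<in> derivations Sym R k (ts ! i)" if "i < 3" for i
      using g that by auto
    have "b \<in> extensional (addresses (Suc k))" by (simp add: b j_def)
    moreover have "if length p < Suc k then b p \<in> R else b p \<in> (\<lambda>\<sigma>. [\<sigma>]) ` Sym"
      if p: "p \<in> addresses (Suc k)" for p
    proof (cases p)
      case Nil
      then show ?thesis using b0 b(2) by simp
    next
      case (Cons i q)
      then have iq: "i < 3" "q \<in> addresses k" using p child by auto
      have "if length q < k then g i q \<in> R else g i q \<in> (\<lambda>\<sigma>. [\<sigma>]) ` Sym"
        using gi[OF iq(1)] iq(2) by (auto simp: derivations_def)
      then show ?thesis using bi[OF iq] Cons by simp
    qed
    moreover have "hd (b (p @ [i])) = b p ! Suc i"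
      if p: "p \<in> addresses (Suc k)" "length p < Suc k" and i: "i < 3" for p i
    proof (cases p)
      case Nil
      have "hd (b [i]) = ts ! i"
        using bi[OF i root(2)] gi[OF i] by (simp add: derivations_def)
      then show ?thesis using Nil b0 by simp
    next
      case (Cons i' q)
      then have iq: "i' < 3" "q \<in> addresses k" "length q < k" using p child by auto
      then have "q @ [i] \<in> addresses k" using i by (auto simp: addresses_def)
      moreover have "hd (g i' (q @ [i])) = g i' q ! Suc i"
        using gi[OF iq(1)] iq(2,3) i by (simp add: derivations_def)
      ultimately show ?thesis using Cons bi iq by simp
    qed
    ultimately show "b \<in> derivations Sym R (Suc k) \<sigma>"
      using b0 by (simp add: derivations_def)
  qed
  show "(\<lambda>b. (tl (b []), \<lambda>i\<in>{..<3}. \<lambda>q\<in>addresses k. b (i # q))) ` derivations Sym R (Suc k) \<sigma> \<subseteq> ?X"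
  proof
    fix x assume "x \<in> (\<lambda>b. (tl (b []), \<lambda>i\<in>{..<3}. \<lambda>q\<in>addresses k. b (i # q))) ` derivations Sym R (Suc k) \<sigma>"
    then obtain b where x: "x = (tl (b []), \<lambda>i\<in>{..<3}. \<lambda>q\<in>addresses k. b (i # q))"
      and b: "b \<in> derivations Sym R (Suc k) \<sigma>" by auto
    have b0: "b [] \<in> R" "hd (b []) = \<sigma>" using b root by (auto simp: derivations_def)
    then have b0': "\<sigma> # tl (b []) = b []" using R by (metis list.collapse list.size(3) zero_neq_numeral)
    have "(\<lambda>q\<in>addresses k. b (i # q)) \<in> derivations Sym R k (tl (b []) ! i)" if i: "i < 3" for i
    proof -
      have "hd (b ([] @ [i])) = b [] ! Suc i"
        using b i unfolding derivations_def by (auto dest!: bspec[OF _ root(1)])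
      then have "hd (b [i]) = tl (b []) ! i" by (metis append_Nil b0' nth_Cons_Suc)
      moreover have "if length q < k then b (i # q) \<in> R else b (i # q) \<in> (\<lambda>\<sigma>. [\<sigma>]) ` Sym"
        if "q \<in> addresses k" for q
      proof -
        have "i # q \<in> addresses (Suc k)" using child i that by simp
        then have "if length (i # q) < Suc k then b (i # q) \<in> R else b (i # q) \<in> (\<lambda>\<sigma>. [\<sigma>]) ` Sym"
          using b unfolding derivations_def by blast
        then show ?thesis by simp
      qed
      moreover have "hd (b (i # q @ [i'])) = b (i # q) ! Suc i'"
        if "q \<in> addresses k" "length q < k" "i' < 3" for q i'
      proof -
        have "i # q \<in> addresses (Suc k)" using child i that by simp
        then have "hd (b ((i # q) @ [i'])) = b (i # q) ! Suc i'"
          using b that by (auto simp: derivations_def dest!: bspec[of _ _ "i # q"])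
        then show ?thesis by simp
      qed
      moreover have "q @ [i'] \<in> addresses k" if "q \<in> addresses k" "length q < k" "i' < 3" for q i'
        using that by (auto simp: addresses_def)
      ultimately show ?thesis using root by (simp add: derivations_def)
    qed
    then show "x \<in> ?X" using b0 b0' by (auto simp: x)
  qed
qed

text \<open>The product of the three sums over subtrees is distributed into a sum over triples of
  subtrees, which \<open>derivations_Suc_bij\<close> identifies with derivations.\<close>

lemma tree_value_eq_sum_derivations:
  assumes fin: "finite Sym" "finite R" and R: "\<And>v. v \<in> R \<Longrightarrow> length v = 4 \<and> set v \<subseteq> Sym"
    and \<sigma>: "\<sigma> \<in> Sym"
  shows "tree_value R w u k \<sigma> = (\<Sum>b\<in>derivations Sym R k \<sigma>. \<Prod>p\<in>addresses k. label_weight w u (b p))"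
  using \<sigma>
proof (induction k arbitrary: \<sigma>)
  case 0
  have "derivations Sym R 0 \<sigma> = {\<lambda>p\<in>{[]}. [\<sigma>]}"
  proof
    show "derivations Sym R 0 \<sigma> \<subseteq> {\<lambda>p\<in>{[]}. [\<sigma>]}"
    proof
      fix b assume "b \<in> derivations Sym R 0 \<sigma>"
      then have "b \<in> extensional {[]}" "b [] = [\<sigma>]" by (auto simp: derivations_def addresses_0)
      then have "b = (\<lambda>p\<in>{[]}. [\<sigma>])" by (intro extensionalityI[of _ "{[]}"]) auto
      then show "b \<in> {\<lambda>p\<in>{[]}. [\<sigma>]}" by simp
    qed
    show "{\<lambda>p\<in>{[]}. [\<sigma>]} \<subseteq> derivations Sym R 0 \<sigma>"
      using 0 by (auto simp: derivations_def addresses_0)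
  qed
  then show ?case by (simp add: addresses_0 label_weight_def)
next
  case (Suc k)
  define J where "J = (\<lambda>(ts, g). \<lambda>p\<in>addresses (Suc k). case p of [] \<Rightarrow> \<sigma> # ts | i # q \<Rightarrow> g i q)"
  define W where "W b = (\<Prod>p\<in>addresses (Suc k). label_weight w u (b p))" for b
  have finR: "finite {ts. \<sigma> # ts \<in> R}"
    using finite_vimageI[OF fin(2), of "(#) \<sigma>"] by (simp add: vimage_def)
  have WJ: "W (J (ts, g)) = mconst (w (\<sigma> # ts)) * (\<Prod>i<3. \<Prod>q\<in>addresses k. label_weight w u (g i q))"
    if "\<sigma> # ts \<in> R" for ts g
  proof -
    have inj: "inj_on (\<lambda>(i, p). i # p) ({..<3} \<times> addresses k)" by (auto simp: inj_on_def)
    have ni: "[] \<notin> (\<lambda>(i, p). i # p) ` ({..<3} \<times> addresses k)" by auto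
    have "W (J (ts, g)) = label_weight w u (\<sigma> # ts) *
        (\<Prod>x\<in>{..<3} \<times> addresses k. label_weight w u (J (ts, g) (case x of (i, p) \<Rightarrow> i # p)))"
      unfolding W_def addresses_Suc
      by (subst prod.insert) (use ni inj finite_addresses in
        \<open>auto simp: prod.reindex J_def addresses_def\<close>)
    also have "label_weight w u (\<sigma> # ts) = mconst (w (\<sigma> # ts))"
      using R[OF that] by (simp add: label_weight_def)
    also have "(\<Prod>x\<in>{..<3} \<times> addresses k. label_weight w u (J (ts, g) (case x of (i, p) \<Rightarrow> i # p))) =
        (\<Prod>(i, q)\<in>{..<3} \<times> addresses k. label_weight w u (g i q))"
      by (rule prod.cong) (auto simp: J_def addresses_def)
    also have "\<dots> = (\<Prod>i<3. \<Prod>q\<in>addresses k. label_weight w u (g i q))"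
      by (rule prod.cartesian_product[symmetric])
    finally show ?thesis .
  qed
  have "tree_value R w u (Suc k) \<sigma> = (\<Sum>ts\<in>{ts. \<sigma> # ts \<in> R}. mconst (w (\<sigma> # ts)) *
      (\<Prod>i<3. \<Sum>b\<in>derivations Sym R k (ts ! i). \<Prod>p\<in>addresses k. label_weight w u (b p)))"
    unfolding tree_value.simps
  proof (intro sum.cong refl arg_cong2[of _ _ _ _ "(*)"] prod.cong)
    fix ts and i :: nat assume ts: "ts \<in> {ts. \<sigma> # ts \<in> R}" and i: "i \<in> {..<3}"
    then have "ts ! i \<in> set ts" "set ts \<subseteq> Sym" using R[of "\<sigma> # ts"] by auto
    then show "tree_value R w u k (ts ! i) =
        (\<Sum>b\<in>derivations Sym R k (ts ! i). \<Prod>p\<in>addresses k. label_weight w u (b p))"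
      by (intro Suc.IH) auto
  qed
  also have "\<dots> = (\<Sum>ts\<in>{ts. \<sigma> # ts \<in> R}. mconst (w (\<sigma> # ts)) *
      (\<Sum>g\<in>PiE {..<3} (\<lambda>i. derivations Sym R k (ts ! i)). \<Prod>i<3. \<Prod>p\<in>addresses k. label_weight w u (g i p)))"
    by (subst prod_sum_PiE) (auto simp: finite_derivations fin)
  also have "\<dots> = (\<Sum>ts\<in>{ts. \<sigma> # ts \<in> R}.
      \<Sum>g\<in>PiE {..<3} (\<lambda>i. derivations Sym R k (ts ! i)). W (J (ts, g)))"
    unfolding sum_distrib_left by (intro sum.cong refl) (simp add: WJ)
  also have "\<dots> = (\<Sum>(ts, g)\<in>Sigma {ts. \<sigma> # ts \<in> R} (\<lambda>ts. PiE {..<3} (\<lambda>i. derivations Sym R k (ts ! i))). W (J (ts, g)))"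
    by (rule sum.Sigma) (use finR in \<open>auto simp: finite_derivations fin intro!: finite_PiE\<close>)
  also have "\<dots> = (\<Sum>x\<in>Sigma {ts. \<sigma> # ts \<in> R} (\<lambda>ts. PiE {..<3} (\<lambda>i. derivations Sym R k (ts ! i))). W (J x))"
    by (rule sum.cong) auto
  also have "\<dots> = (\<Sum>b\<in>derivations Sym R (Suc k) \<sigma>. W b)"
    unfolding J_def by (rule sum.reindex_bij_betw[OF derivations_Suc_bij]) (use R in auto)
  finally show ?case unfolding W_def .
qed


text \<open>\<open>(p, i)\<close> is the edge from \<open>p\<close> to \<open>p @ [i]\<close>. Its
  position in the list is its relation symbol, so every edge can have its own relation.\<close>

definition tree_edges :: "nat \<Rightarrow> (nat list \<times> nat) list" where
  "tree_edges k = (SOME es. distinct es \<and> set es = {(p, i). p \<in> addresses k \<and> length p < k \<and> i < 3})"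

lemma tree_edges: "distinct (tree_edges k)"
    "set (tree_edges k) = {(p, i). p \<in> addresses k \<and> length p < k \<and> i < 3}"
proof -
  have "{(p, i). p \<in> addresses k \<and> length p < k \<and> i < 3} \<subseteq> addresses k \<times> {..<3}" by auto
  then have "finite {(p, i :: nat). p \<in> addresses k \<and> length p < k \<and> i < 3}"
    by (rule finite_subset) (simp add: finite_addresses)
  from finite_distinct_list[OF this]
  have "\<exists>es. distinct es \<and> set es = {(p, i :: nat). p \<in> addresses k \<and> length p < k \<and> i < 3}"
    by blast
  then have "distinct (tree_edges k) \<and>
      set (tree_edges k) = {(p, i). p \<in> addresses k \<and> length p < k \<and> i < 3}"
    unfolding tree_edges_def by (rule someI_ex)
  then show "distinct (tree_edges k)"
    "set (tree_edges k) = {(p, i). p \<in> addresses k \<and> length p < k \<and> i < 3}" by auto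
qed

lemma length_tree_edges: "length (tree_edges k) \<le> card (addresses k) * 3"
proof -
  have "length (tree_edges k) = card (set (tree_edges k))" by (simp add: tree_edges(1) distinct_card)
  also have "\<dots> \<le> card (addresses k \<times> {..<3::nat})"
    by (rule card_mono) (auto simp: tree_edges(2) finite_addresses)
  finally show ?thesis by (simp add: card_cartesian_product)
qed

text \<open>Since a label is a whole rule, consistency of a derivation is a condition on adjacent
  labels only. The position of the edge decides whether the lower label is a rule or a leaf label,
  and edges at the root also fix the start symbol.\<close>

definition edge_rel :: "'s::countable set \<Rightarrow> 's list set \<Rightarrow> nat \<Rightarrow> 's \<Rightarrow> nat list \<times> nat \<Rightarrow> nat list set" where
  "edge_rel Sym R k \<sigma> = (\<lambda>(p, i). (\<lambda>(v, v'). [to_nat v, to_nat v']) `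
     {(v, v'). v \<in> R \<and> v' \<in> (if Suc (length p) < k then R else (\<lambda>\<sigma>. [\<sigma>]) ` Sym) \<and>
        hd v' = v ! Suc i \<and> (p = [] \<longrightarrow> hd v = \<sigma>)})"

definition edge_args :: "nat list \<times> nat \<Rightarrow> nat list" where
  "edge_args = (\<lambda>(p, i). [to_nat p, to_nat (p @ [i])])"

text \<open>Conditions on a single node are part of the relations of the edges at it; for
  \<open>k \<ge> 1\<close> every node lies on an edge. The domain elements, hence the variables of
  the polynomial, are coded labels.\<close>

definition tree_query :: "'s::countable set \<Rightarrow> 's list set \<Rightarrow> nat \<Rightarrow> 's \<Rightarrow> cq" where
  "tree_query Sym R k \<sigma> = \<lparr>
     cq_dom = to_nat ` (R \<union> (\<lambda>\<sigma>. [\<sigma>]) ` Sym),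
     cq_rels = map (edge_rel Sym R k \<sigma>) (tree_edges k),
     cq_free = to_nat ` addresses k,
     cq_atoms = map (\<lambda>j. (j, edge_args (tree_edges k ! j))) [0..<length (tree_edges k)]\<rparr>"

context
  fixes Sym :: "'s::countable set" and R :: "'s list set" and k :: nat and \<sigma> :: 's
  assumes fin: "finite Sym" "finite R"
    and R: "\<And>v. v \<in> R \<Longrightarrow> length v = 4 \<and> set v \<subseteq> Sym"
    and k: "k \<ge> 1" and \<sigma>: "\<sigma> \<in> Sym"
begin

abbreviation (input) "Q \<equiv> tree_query Sym R k \<sigma>"

lemma edge_rel_cases:
  assumes "t \<in> edge_rel Sym R k \<sigma> e"
  obtains v v' where "t = [to_nat v, to_nat v']" "v \<in> R" "v' \<in> R \<union> (\<lambda>\<sigma>. [\<sigma>]) ` Sym"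
proof -
  obtain p i where "e = (p, i)" by force
  with assms obtain v v' where v: "t = [to_nat v, to_nat v']" "v \<in> R"
    and v': "v' \<in> (if Suc (length p) < k then R else (\<lambda>\<sigma>. [\<sigma>]) ` Sym)"
    unfolding edge_rel_def by auto
  from v' have "v' \<in> R \<union> (\<lambda>\<sigma>. [\<sigma>]) ` Sym" by (cases "Suc (length p) < k") simp_all
  with v show ?thesis by (rule that)
qed

lemma finite_edge_rel: "finite (edge_rel Sym R k \<sigma> e)"
  and card_edge_rel: "card (edge_rel Sym R k \<sigma> e) \<le> (card R + card Sym) ^ 2"
proof -
  let ?V = "R \<union> (\<lambda>\<sigma>. [\<sigma>]) ` Sym"
  have sub: "edge_rel Sym R k \<sigma> e \<subseteq> (\<lambda>(v, v'). [to_nat v, to_nat v']) ` (?V \<times> ?V)"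
    by (rule subsetI) (erule edge_rel_cases, auto)
  have finV: "finite (?V \<times> ?V)" using fin by auto
  show "finite (edge_rel Sym R k \<sigma> e)" by (rule finite_subset[OF sub]) (use finV in auto)
  have "card ?V \<le> card R + card Sym"
    using card_Un_le[of R "(\<lambda>\<sigma>. [\<sigma>]) ` Sym"] card_image_le[OF fin(1), of "\<lambda>\<sigma>. [\<sigma>]"] by simp
  then have "card (?V \<times> ?V) \<le> (card R + card Sym) ^ 2"
    by (simp add: card_cartesian_product power2_eq_square mult_le_mono)
  then show "card (edge_rel Sym R k \<sigma> e) \<le> (card R + card Sym) ^ 2"
    using surj_card_le[OF finV sub] by simp
qed

lemma edge_args_subset:
  assumes "e \<in> set (tree_edges k)"
  shows "set (edge_args e) \<subseteq> to_nat ` addresses k"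
  using assms by (auto simp: tree_edges edge_args_def addresses_def)

lemma cq_vars_tree_query: "cq_vars Q = to_nat ` addresses k"
proof -
  have "(\<Union>(r, xs)\<in>set (cq_atoms Q). set xs) \<subseteq> to_nat ` addresses k"
    using edge_args_subset[OF nth_mem] unfolding tree_query_def by fastforce
  moreover have "cq_free Q = to_nat ` addresses k" by (simp add: tree_query_def)
  ultimately show ?thesis unfolding cq_vars_def by blast
qed

lemma cq_wf_tree_query: "cq_wf Q"
proof -
  have len: "length t = 2" if "t \<in> edge_rel Sym R k \<sigma> e" for t e
    using that by (rule edge_rel_cases) simp
  have "set t \<subseteq> to_nat ` (R \<union> (\<lambda>\<sigma>. [\<sigma>]) ` Sym)" if "t \<in> edge_rel Sym R k \<sigma> e" for t e
    using that by (rule edge_rel_cases) auto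
  moreover have "length (edge_args e) = 2" for e by (simp add: edge_args_def split: prod.splits)
  ultimately show ?thesis
    using fin finite_addresses finite_edge_rel len by (auto simp: cq_wf_def tree_query_def)
qed

lemma cq_quantifier_free_tree_query: "cq_quantifier_free Q"
  unfolding cq_quantifier_free_def cq_vars_tree_query by (simp add: tree_query_def)

text \<open>Indexing edges by their lower ends makes it visible that there is one edge fewer than
  nodes.\<close>

lemma cq_edges_tree_query:
  "cq_edges Q = (\<lambda>p. {to_nat (butlast p), to_nat p}) ` (addresses k - {[]})"
proof -
  have "set (tree_edges k) = (!) (tree_edges k) ` {..<length (tree_edges k)}"
    by (auto simp: set_conv_nth)
  then have "cq_edges Q = (\<lambda>e. set (edge_args e)) ` set (tree_edges k)"
    by (simp add: cq_edges_def tree_query_def image_image lessThan_atLeast0)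
  also have "\<dots> = (\<lambda>p. {to_nat (butlast p), to_nat p}) ` (addresses k - {[]})"
  proof
    show "(\<lambda>e. set (edge_args e)) ` set (tree_edges k)
        \<subseteq> (\<lambda>p. {to_nat (butlast p), to_nat p}) ` (addresses k - {[]})"
    proof
      fix x assume "x \<in> (\<lambda>e. set (edge_args e)) ` set (tree_edges k)"
      then obtain p i where pi: "p \<in> addresses k" "length p < k" "i < 3"
        and x: "x = {to_nat p, to_nat (p @ [i])}"
        by (auto simp: tree_edges edge_args_def)
      have "p @ [i] \<in> addresses k - {[]}" using pi by (auto simp: addresses_def)
      then show "x \<in> (\<lambda>p. {to_nat (butlast p), to_nat p}) ` (addresses k - {[]})"
        by (rule rev_image_eqI) (simp add: x)
    qed
    show "(\<lambda>p. {to_nat (butlast p), to_nat p}) ` (addresses k - {[]})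
        \<subseteq> (\<lambda>e. set (edge_args e)) ` set (tree_edges k)"
    proof
      fix x assume "x \<in> (\<lambda>p. {to_nat (butlast p), to_nat p}) ` (addresses k - {[]})"
      then obtain p where p: "p \<in> addresses k" "p \<noteq> []" and x: "x = {to_nat (butlast p), to_nat p}"
        by auto
      obtain q i where q: "p = q @ [i]" using p(2) by (metis append_butlast_last_id)
      have "(q, i) \<in> set (tree_edges k)" using p q by (auto simp: tree_edges addresses_def)
      then show "x \<in> (\<lambda>e. set (edge_args e)) ` set (tree_edges k)"
        by (rule rev_image_eqI) (simp add: x q edge_args_def)
    qed
  qed
  finally show ?thesis .
qed

lemma cq_hypergraph_tree_tree_query: "cq_hypergraph_tree Q"
proof -
  let ?N = "to_nat ` addresses k" and ?T = "(\<lambda>p. {to_nat (butlast p), to_nat p}) ` (addresses k - {[]})"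
  have but: "butlast p \<in> addresses k" "butlast p \<noteq> p" if "p \<in> addresses k - {[]}" for p
  proof -
    show "butlast p \<in> addresses k" using that by (auto simp: addresses_def dest: in_set_butlastD)
    have "length (butlast p) \<noteq> length p" using that by (cases p rule: rev_cases) auto
    then show "butlast p \<noteq> p" by metis
  qed
  have card2: "card e = 2" if e: "e \<in> ?T" for e
  proof -
    obtain p where p: "p \<in> addresses k - {[]}" "e = {to_nat (butlast p), to_nat p}"
      using e by blast
    have "to_nat (butlast p) \<noteq> to_nat p" using but(2)[OF p(1)] by simp
    with p(2) show ?thesis by simp
  qed
  have sub: "?T \<subseteq> {{u, v} | u v. u \<in> ?N \<and> v \<in> ?N \<and> u \<noteq> v}"
    using but by fastforce
  have root: "(to_nat p, to_nat ([] :: nat list)) \<in> (adj_in ?T ?N)\<^sup>*" if "p \<in> addresses k" for p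
    using that
  proof (induction p rule: rev_induct)
    case (snoc i p)
    have p: "p \<in> addresses k" using snoc.prems by (auto simp: addresses_def)
    have "{to_nat (butlast (p @ [i])), to_nat (p @ [i])} \<in> ?T" using snoc.prems by blast
    then have "(to_nat (p @ [i]), to_nat p) \<in> adj_in ?T ?N"
      using snoc.prems p by (simp add: adj_in_def insert_commute)
    with snoc.IH[OF p] show ?case by (rule converse_rtrancl_into_rtrancl[rotated])
  qed simp
  have "connected_on ?N ?T"
    unfolding connected_on_def
  proof (intro ballI)
    fix u v assume "u \<in> ?N" "v \<in> ?N"
    then have "(u, to_nat ([] :: nat list)) \<in> (adj_in ?T ?N)\<^sup>*" "(v, to_nat ([] :: nat list)) \<in> (adj_in ?T ?N)\<^sup>*"
      using root by auto
    moreover from this(2) have "(to_nat ([] :: nat list), v) \<in> (adj_in ?T ?N)\<^sup>*"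
      using sym_rtrancl[OF sym_adj_in] by (meson symE)
    ultimately show "(u, v) \<in> (adj_in ?T ?N)\<^sup>*" by (meson rtrancl_trans)
  qed
  moreover have "card ?T = card ?N - 1"
  proof -
    have "inj_on (\<lambda>p :: nat list. {to_nat (butlast p), to_nat p}) (addresses k - {[]})"
    proof (rule inj_onI)
      fix p q :: "nat list" assume p: "p \<in> addresses k - {[]}" and q: "q \<in> addresses k - {[]}"
        and eq: "{to_nat (butlast p), to_nat p} = {to_nat (butlast q), to_nat q}"
      show "p = q"
      proof (rule ccontr)
        assume "p \<noteq> q"
        then have "butlast p = q" "butlast q = p" using eq by (auto simp: doubleton_eq_iff)
        then have "length p - 1 = length q" "length q - 1 = length p" by (metis length_butlast)+
        moreover have "length p > 0" using p by simp
        ultimately show False by linarith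
      qed
    qed
    then have "card ?T = card (addresses k - {[]})" by (rule card_image)
    also have "\<dots> = card (addresses k) - 1" by (simp add: finite_addresses addresses_def)
    also have "card (addresses k) = card ?N" by (simp add: card_image)
    finally show ?thesis .
  qed
  ultimately have "is_tree ?N ?T" using sub finite_addresses by (simp add: is_tree_def)
  then show ?thesis
    using card2 unfolding cq_hypergraph_tree_def cq_vars_tree_query cq_edges_tree_query by blast
qed

lemma cq_size_tree_query:
  defines "q \<equiv> card R + card Sym"
  shows "cq_size Q \<le> q + 3 ^ (k + 1) * (13 + 9 * q ^ 2)"
proof -
  let ?N = "card (addresses k)" and ?l = "length (tree_edges k)"
  have V: "card (cq_dom Q) \<le> q"
  proof -
    have "card (cq_dom Q) \<le> card (R \<union> (\<lambda>\<sigma>. [\<sigma>]) ` Sym)"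
      unfolding tree_query_def using fin by (simp add: card_image_le)
    also have "\<dots> \<le> q"
      using card_Un_le[of R "(\<lambda>\<sigma>. [\<sigma>]) ` Sym"] card_image_le[OF fin(1), of "\<lambda>\<sigma>. [\<sigma>]"]
      by (simp add: q_def)
    finally show ?thesis .
  qed
  have F: "card (cq_free Q) \<le> ?N" by (simp add: tree_query_def card_image_le finite_addresses)
  have rel: "1 + (\<Sum>t\<in>edge_rel Sym R k \<sigma> e. 1 + length t) \<le> 1 + 3 * q ^ 2" for e
  proof -
    have "(\<Sum>t\<in>edge_rel Sym R k \<sigma> e. 1 + length t) = (\<Sum>t\<in>edge_rel Sym R k \<sigma> e. 3)"
      by (rule sum.cong) (auto elim: edge_rel_cases)
    then show ?thesis using card_edge_rel[of e] by (simp add: q_def)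
  qed
  have "(\<Sum>R\<leftarrow>cq_rels Q. 1 + (\<Sum>t\<in>R. 1 + length t)) \<le> (\<Sum>e\<leftarrow>tree_edges k. 1 + 3 * q ^ 2)"
    unfolding tree_query_def cq.simps map_map by (rule sum_list_mono) (use rel in simp)
  also have "\<dots> = ?l * (1 + 3 * q ^ 2)" by (simp add: sum_list_triv)
  finally have Rl: "(\<Sum>R\<leftarrow>cq_rels Q. 1 + (\<Sum>t\<in>R. 1 + length t)) \<le> ?l * (1 + 3 * q ^ 2)" .
  have "length (edge_args e) = 2" for e by (simp add: edge_args_def split: prod.splits)
  then have At: "(\<Sum>(r, xs)\<leftarrow>cq_atoms Q. 1 + length xs) = ?l * 3"
    by (simp add: tree_query_def comp_def sum_list_triv)
  have "cq_size Q \<le> q + ?l * (1 + 3 * q ^ 2) + ?N + ?l * 3"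
    unfolding cq_size_def using V F Rl At by linarith
  also have "\<dots> \<le> q + (?N * 3) * (1 + 3 * q ^ 2) + ?N + (?N * 3) * 3"
    by (intro add_mono mult_le_mono1 order_refl length_tree_edges)
  \<comment> \<open>Per node: 1 for the free variable and three edges, each with size
    \<open>1 + 3 * q ^ 2\<close> for the relation (pairs of size 3) and 3 for the atom.\<close>
  also have "\<dots> = q + ?N * (13 + 9 * q ^ 2)" by (simp add: algebra_simps)
  also have "\<dots> \<le> q + 3 ^ (k + 1) * (13 + 9 * q ^ 2)"
    by (intro add_mono mult_le_mono1 order_refl card_addresses)
  finally show ?thesis .
qed

lemma cq_sat_tree_query:
  assumes a: "a \<in> cq_free Q \<rightarrow>\<^sub>E cq_dom Q"
  shows "cq_sat Q a \<longleftrightarrow> (\<forall>e\<in>set (tree_edges k). map a (edge_args e) \<in> edge_rel Sym R k \<sigma> e)"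
proof -
  have cong: "map b (edge_args e) = map a (edge_args e)"
    if "\<forall>x\<in>cq_free Q. b x = a x" "e \<in> set (tree_edges k)" for b e
    using that edge_args_subset[OF that(2)] by (auto simp: tree_query_def)
  have atoms: "(\<forall>(r, xs)\<in>set (cq_atoms Q). map b xs \<in> cq_rels Q ! r) \<longleftrightarrow>
      (\<forall>e\<in>set (tree_edges k). map b (edge_args e) \<in> edge_rel Sym R k \<sigma> e)" for b
    by (auto simp: tree_query_def all_set_conv_all_nth)
  have "\<forall>x\<in>cq_vars Q. a x \<in> cq_dom Q"
    using a unfolding cq_vars_tree_query by (auto simp: tree_query_def)
  then show ?thesis unfolding cq_sat_def atoms using cong by (metis (no_types, lifting))
qed

lemma bij_betw_derivations_answers:
  "bij_betw (\<lambda>b. \<lambda>n\<in>to_nat ` addresses k. to_nat (b (from_nat n)))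
     (derivations Sym R k \<sigma>) (cq_answers Q)"
proof (rule bij_betw_byWitness[where f' = "\<lambda>a. \<lambda>p\<in>addresses k. from_nat (a (to_nat p))"])
  let ?f = "\<lambda>b :: nat list \<Rightarrow> 's list. \<lambda>n\<in>to_nat ` addresses k. to_nat (b (from_nat n))"
  let ?g = "\<lambda>a. \<lambda>p\<in>addresses k. from_nat (a (to_nat p)) :: 's list"
  let ?V = "R \<union> (\<lambda>\<sigma>. [\<sigma>]) ` Sym"
  have ans: "a \<in> cq_answers Q \<longleftrightarrow> a \<in> to_nat ` addresses k \<rightarrow>\<^sub>E to_nat ` ?V \<and>
      (\<forall>e\<in>set (tree_edges k). map a (edge_args e) \<in> edge_rel Sym R k \<sigma> e)" for a
    using cq_sat_tree_query unfolding cq_answers_def by (auto simp: tree_query_def)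
  have V: "b p \<in> ?V" if "b \<in> derivations Sym R k \<sigma>" "p \<in> addresses k" for b p
  proof -
    have "if length p < k then b p \<in> R else b p \<in> (\<lambda>\<sigma>. [\<sigma>]) ` Sym"
      using that unfolding derivations_def by blast
    then show ?thesis by (auto split: if_splits)
  qed
  show "\<forall>b\<in>derivations Sym R k \<sigma>. ?g (?f b) = b"
  proof
    fix b assume "b \<in> derivations Sym R k \<sigma>"
    then have "b \<in> extensional (addresses k)" by (simp add: derivations_def)
    then show "?g (?f b) = b" by (intro extensionalityI[of _ "addresses k"]) auto
  qed
  show "\<forall>a\<in>cq_answers Q. ?f (?g a) = a"
  proof
    fix a assume a: "a \<in> cq_answers Q"
    then have "a \<in> to_nat ` addresses k \<rightarrow>\<^sub>E to_nat ` ?V" by (simp add: ans)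
    then have ext: "a \<in> extensional (to_nat ` addresses k)"
      and im: "\<And>p. p \<in> addresses k \<Longrightarrow> a (to_nat p) \<in> to_nat ` ?V"
      by (auto simp: PiE_def)
    show "?f (?g a) = a"
    proof (rule extensionalityI[OF _ ext])
      fix n assume "n \<in> to_nat ` addresses k"
      then obtain p where p: "p \<in> addresses k" "n = to_nat p" by auto
      obtain v where "a (to_nat p) = to_nat v" "v \<in> ?V" using im[OF p(1)] by blast
      then show "?f (?g a) n = a n" using p by simp
    qed simp
  qed
  show "?f ` derivations Sym R k \<sigma> \<subseteq> cq_answers Q"
  proof
    fix a assume "a \<in> ?f ` derivations Sym R k \<sigma>"
    then obtain b where b: "b \<in> derivations Sym R k \<sigma>" and a: "a = ?f b" by auto
    have av: "a (to_nat p) = to_nat (b p)" if "p \<in> addresses k" for p using that by (simp add: a)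
    have "a \<in> to_nat ` addresses k \<rightarrow>\<^sub>E to_nat ` ?V" using V[OF b] by (auto simp: a)
    moreover have "map a (edge_args e) \<in> edge_rel Sym R k \<sigma> e" if e: "e \<in> set (tree_edges k)" for e
    proof -
      obtain p i where pi: "e = (p, i)" "p \<in> addresses k" "length p < k" "i < 3"
        using e by (auto simp: tree_edges)
      have p': "p @ [i] \<in> addresses k" using pi by (auto simp: addresses_def)
      have all: "if length q < k then b q \<in> R else b q \<in> (\<lambda>\<sigma>. [\<sigma>]) ` Sym" if "q \<in> addresses k" for q
        using b that unfolding derivations_def by blast
      have "b p \<in> R" using all[OF pi(2)] pi(3) by simp
      moreover have "b (p @ [i]) \<in> (if Suc (length p) < k then R else (\<lambda>\<sigma>. [\<sigma>]) ` Sym)"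
        using all[OF p'] by (auto split: if_splits)
      moreover have "hd (b (p @ [i])) = b p ! Suc i" "hd (b []) = \<sigma>"
        using b pi unfolding derivations_def by blast+
      ultimately have "(b p, b (p @ [i])) \<in> {(v, v'). v \<in> R \<and>
          v' \<in> (if Suc (length p) < k then R else (\<lambda>\<sigma>. [\<sigma>]) ` Sym) \<and>
          hd v' = v ! Suc i \<and> (p = [] \<longrightarrow> hd v = \<sigma>)}"
        by auto
      then show ?thesis
        unfolding edge_rel_def pi(1) prod.case
        by (rule rev_image_eqI) (simp add: edge_args_def av pi(2) p')
    qed
    ultimately show "a \<in> cq_answers Q" by (simp add: ans)
  qed
  show "?g ` cq_answers Q \<subseteq> derivations Sym R k \<sigma>"
  proof
    fix b assume "b \<in> ?g ` cq_answers Q"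
    then obtain a where a: "a \<in> cq_answers Q" and b: "b = ?g a" by auto
    have edge: "b p \<in> R \<and> b (p @ [i]) \<in> (if Suc (length p) < k then R else (\<lambda>\<sigma>. [\<sigma>]) ` Sym) \<and>
        hd (b (p @ [i])) = b p ! Suc i \<and> (p = [] \<longrightarrow> hd (b p) = \<sigma>)"
      if p: "p \<in> addresses k" "length p < k" "i < 3" for p i
    proof -
      have p': "p @ [i] \<in> addresses k" using p by (auto simp: addresses_def)
      have "(p, i) \<in> set (tree_edges k)" using p by (simp add: tree_edges)
      then have "map a (edge_args (p, i)) \<in> edge_rel Sym R k \<sigma> (p, i)" using a ans by blast
      then obtain v v' where vv': "a (to_nat p) = to_nat v" "a (to_nat (p @ [i])) = to_nat v'"
        and cond: "v \<in> R \<and> v' \<in> (if Suc (length p) < k then R else (\<lambda>\<sigma>. [\<sigma>]) ` Sym) \<and>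
          hd v' = v ! Suc i \<and> (p = [] \<longrightarrow> hd v = \<sigma>)"
        unfolding edge_rel_def edge_args_def by auto
      have "b p = v" "b (p @ [i]) = v'" using vv' p p' by (simp_all add: b)
      with cond show ?thesis by (simp only:) simp
    qed
    have root: "[] \<in> addresses k" "length ([] :: nat list) < k" using k by (auto simp: addresses_def)
    \<comment> \<open>The label of an inner node is checked by the edge to its child 0, that of a
      leaf by the edge to its parent.\<close>
    have "if length p < k then b p \<in> R else b p \<in> (\<lambda>\<sigma>. [\<sigma>]) ` Sym" if p: "p \<in> addresses k" for p
    proof (cases "length p < k")
      case True
      then show ?thesis using edge[OF p True, of 0] by simp
    next
      case False
      then have "p \<noteq> []" using k by auto
      then obtain q i where q: "p = q @ [i]" by (metis append_butlast_last_id)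
      have "q \<in> addresses k" "length q < k" "i < 3" using p q by (auto simp: addresses_def)
      from edge[OF this] show ?thesis using False q by auto
    qed
    moreover have "hd (b []) = \<sigma>" using edge[OF root, of 0] by simp
    moreover have "b \<in> extensional (addresses k)" by (simp add: b)
    ultimately show "b \<in> derivations Sym R k \<sigma>"
      using edge unfolding derivations_def by blast
  qed
qed

text \<open>Each variable stands for a label and is replaced by the weight of that label, a constant
  for a rule and a value of \<open>u\<close> for a leaf.\<close>

lemma is_projection_tree_query:
  fixes u :: "'s \<Rightarrow> 'a::comm_ring_1 mpoly"
  assumes u: "\<And>\<sigma>. u \<sigma> \<in> range mconst \<or> u \<sigma> \<in> range mvar"
  shows "is_projection (tree_value R w u k \<sigma>) (cq_poly Q)"
proof -
  define s where "s n = label_weight w u (from_nat n :: 's list)" for n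
  have "s n \<in> range mconst \<or> s n \<in> range mvar" for n
    using u by (auto simp: s_def label_weight_def)
  moreover have "msubst s (cq_poly Q) = tree_value R w u k \<sigma>"
  proof -
    let ?j = "\<lambda>b :: nat list \<Rightarrow> 's list. \<lambda>n\<in>to_nat ` addresses k. to_nat (b (from_nat n))"
    have "msubst s (cq_poly Q) = (\<Sum>a\<in>cq_answers Q. \<Prod>x\<in>cq_free Q. s (a x))"
      unfolding cq_poly_def by (rule msubst_sum_prod_mvar)
    also have "\<dots> = (\<Sum>b\<in>derivations Sym R k \<sigma>. \<Prod>x\<in>cq_free Q. s (?j b x))"
      by (rule sum.reindex_bij_betw[OF bij_betw_derivations_answers, symmetric])
    also have "\<dots> = (\<Sum>b\<in>derivations Sym R k \<sigma>. \<Prod>p\<in>addresses k. label_weight w u (b p))"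
      by (simp add: tree_query_def prod.reindex s_def)
    also have "\<dots> = tree_value R w u k \<sigma>"
      by (rule tree_value_eq_sum_derivations[symmetric]) (use fin R \<sigma> in auto)
    finally show ?thesis .
  qed
  ultimately show ?thesis unfolding is_projection_def by metis
qed

end

section \<open>The grammar of logarithmic depth and the size bounds\<close>

subsection \<open>The balanced grammar of a circuit\<close>

text \<open>\<open>Comp g d\<close> stands for the homogeneous component of degree \<open>d\<close> of the value of gate \<open>g\<close>,
  \<open>Ctx g h j\<close> for the entry \<open>(g, h)\<close> of the resolvent in degree \<open>j\<close>.\<close>

datatype symbol = One | Var nat | Comp nat nat | Ctx nat nat nat | Start

instance symbol :: countable
  by countable_datatype

text \<open>Rules with fewer than three factors are padded with \<open>One\<close>; a terminal symbol
  reproduces itself until the leaves are reached.\<close>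

fun split_rules :: "nat \<Rightarrow> nat set \<Rightarrow> nat \<Rightarrow> nat \<Rightarrow> symbol \<Rightarrow> symbol list set" where
  "split_rules s V D r One = {[One, One, One]}"
| "split_rules s V D r (Var v) = {[Var v, One, One]}"
| "split_rules s V D r (Comp g d) = (if d \<le> 1 then (\<lambda>v. [Var v, One, One]) ` V else
     (\<lambda>(e, x, a, b, j). [Ctx g x (d - e), Comp a j, Comp b (e - j)]) `
       (SIGMA e:{d div 2<..d}. {..<s} \<times> {..<s} \<times> {..<s} \<times>
          {j. 1 \<le> j \<and> j \<le> d div 2 \<and> j < e \<and> e \<le> j + d div 2}))"
| "split_rules s V D r (Ctx g h j) = (if j = 0 then {[One, One, One]} else
     (\<lambda>(e, x, k, y, z). [Ctx g x (j - e), Comp z (e - k), Ctx y h k]) `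
       ({j div 2<..j} \<times> {..<s} \<times> {..j div 2} \<times> {..<s} \<times> {..<s}))"
| "split_rules s V D r Start = insert [One, One, One] ((\<lambda>i. [Comp r i, One, One]) ` {1..D})"

text \<open>A projection substitutes one value per label, so the weight must be readable from the
  rule alone. In the branching rules the coefficient belongs to the gate \<open>x\<close> where the
  context ends, not to the head \<open>g\<close>; for \<open>Ctx\<close> it is the coefficient of
  the component of \<open>z\<close> in the entry \<open>(x, y)\<close> of \<open>L\<close>.\<close>

definition split_weight ::
    "(nat \<Rightarrow> nat \<Rightarrow> 'a) \<Rightarrow> (nat \<Rightarrow> nat \<Rightarrow> nat \<Rightarrow> 'a) \<Rightarrow> 'a \<Rightarrow> symbol list \<Rightarrow> 'a::comm_ring_1" where
  "split_weight l c c0 v = (case v ! 0 of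
     Comp g _ \<Rightarrow> (case v ! 1 of Var u \<Rightarrow> l g u | Ctx _ x _ \<Rightarrow>
       (case v ! 2 of Comp a _ \<Rightarrow> (case v ! 3 of Comp b _ \<Rightarrow> c x a b | _ \<Rightarrow> 1) | _ \<Rightarrow> 1) | _ \<Rightarrow> 1)
   | Ctx g h _ \<Rightarrow> (case v ! 1 of One \<Rightarrow> of_bool (g = h) | Ctx _ x _ \<Rightarrow>
       (case v ! 2 of Comp z _ \<Rightarrow> (case v ! 3 of Ctx y _ _ \<Rightarrow> c x z y + c x y z | _ \<Rightarrow> 1) | _ \<Rightarrow> 1) | _ \<Rightarrow> 1)
   | Start \<Rightarrow> (case v ! 1 of One \<Rightarrow> c0 | _ \<Rightarrow> 1)
   | _ \<Rightarrow> 1)"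

lemma split_weight_simps [simp]:
  "split_weight l c c0 [Comp g d, Var v, t, t'] = l g v"
  "split_weight l c c0 [Comp g d, Ctx g' x i, Comp a j, Comp b j'] = c x a b"
  "split_weight l c c0 [Ctx g h j, One, t, t'] = of_bool (g = h)"
  "split_weight l c c0 [Ctx g h j, Ctx g' x i, Comp z i', Ctx y h' k] = c x z y + c x y z"
  "split_weight l c c0 [Start, One, t, t'] = c0"
  "split_weight l c c0 [Start, Comp g d, t, t'] = 1"
  "split_weight l c c0 [One, t, t', t''] = 1"
  "split_weight l c c0 [Var v, t, t', t''] = 1"
  by (simp_all add: split_weight_def numeral_3_eq_3)

definition grammar_symbols :: "nat \<Rightarrow> nat set \<Rightarrow> nat \<Rightarrow> symbol set" where
  "grammar_symbols s V D = {One, Start} \<union> Var ` V \<union> (\<lambda>(g, d). Comp g d) ` ({..<s} \<times> {..D}) \<union>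
     (\<lambda>(g, h, j). Ctx g h j) ` ({..<s} \<times> {..<s} \<times> {..D})"

definition grammar_rules :: "nat \<Rightarrow> nat set \<Rightarrow> nat \<Rightarrow> nat \<Rightarrow> symbol list set" where
  "grammar_rules s V D r = {\<sigma> # ts | \<sigma> ts. \<sigma> \<in> grammar_symbols s V D \<and> ts \<in> split_rules s V D r \<sigma>}"

text \<open>Derivations in which \<open>Start\<close>, a \<open>Comp\<close> or a \<open>Ctx\<close>
  is left at a leaf contribute 0.\<close>

fun terminal :: "symbol \<Rightarrow> 'a::comm_ring_1 mpoly" where
  "terminal One = mconst 1"
| "terminal (Var v) = mvar v"
| "terminal _ = mconst 0"

lemma grammar_symbols_iff:
  "One \<in> grammar_symbols s V D" "Start \<in> grammar_symbols s V D"
  "Var v \<in> grammar_symbols s V D \<longleftrightarrow> v \<in> V"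
  "Comp g d \<in> grammar_symbols s V D \<longleftrightarrow> g < s \<and> d \<le> D"
  "Ctx g h j \<in> grammar_symbols s V D \<longleftrightarrow> g < s \<and> h < s \<and> j \<le> D"
  unfolding grammar_symbols_def by (auto simp: image_iff)

lemma card_grammar_symbols:
  assumes "finite V"
  shows "finite (grammar_symbols s V D)"
    and "card (grammar_symbols s V D) \<le> 2 + card V + s * (D + 1) + s * s * (D + 1)"
proof -
  show "finite (grammar_symbols s V D)" using assms by (simp add: grammar_symbols_def)
  have "card (Var ` V) \<le> card V" using assms by (rule card_image_le)
  moreover have "card ((\<lambda>(g, d). Comp g d) ` ({..<s} \<times> {..D})) \<le> s * (D + 1)"
    by (rule order.trans[OF card_image_le]) (simp_all add: card_cartesian_product)
  moreover have "card ((\<lambda>(g, h, j). Ctx g h j) ` ({..<s} \<times> {..<s} \<times> {..D})) \<le> s * s * (D + 1)"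
    by (rule order.trans[OF card_image_le]) (simp_all add: card_cartesian_product algebra_simps)
  moreover have "card {One, Start} = 2" by simp
  ultimately show "card (grammar_symbols s V D) \<le> 2 + card V + s * (D + 1) + s * s * (D + 1)"
    unfolding grammar_symbols_def
    by (intro order.trans[OF card_Un_le] add_mono) auto
qed

lemma grammar_rules_wf:
  assumes r: "r < s" and v: "v \<in> grammar_rules s V D r"
  shows "length v = 4 \<and> set v \<subseteq> grammar_symbols s V D"
proof -
  obtain \<sigma> ts where *: "v = \<sigma> # ts" "\<sigma> \<in> grammar_symbols s V D" "ts \<in> split_rules s V D r \<sigma>"
    using v by (auto simp: grammar_rules_def)
  have "length ts = 3 \<and> set ts \<subseteq> grammar_symbols s V D"
  proof (cases \<sigma>)
    case (Comp g d)
    then show ?thesis using * by (auto simp: grammar_symbols_iff split: if_splits)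
  next
    case (Ctx g h j)
    then show ?thesis using * by (auto simp: grammar_symbols_iff split: if_splits)
  qed (use * r in \<open>auto simp: grammar_symbols_iff\<close>)
  then show ?thesis using * by simp
qed

lemma card_grammar_rules:
  fixes s D r :: nat and V :: "nat set"
  assumes "r < s" "finite V"
  defines "q \<equiv> card (grammar_symbols s V D)"
  shows "finite (grammar_rules s V D r)" "card (grammar_rules s V D r) \<le> q ^ 4"
proof -
  have sub: "grammar_rules s V D r \<subseteq> {v. set v \<subseteq> grammar_symbols s V D \<and> length v = 4}"
    using grammar_rules_wf[OF assms(1)] by blast
  note fin = card_grammar_symbols(1)[OF assms(2)]
  show "finite (grammar_rules s V D r)"
    by (rule finite_subset[OF sub finite_lists_length_eq[OF fin]])
  show "card (grammar_rules s V D r) \<le> q ^ 4"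
    unfolding q_def card_lists_length_eq[OF fin, symmetric]
    by (rule card_mono[OF finite_lists_length_eq[OF fin] sub])
qed

context
  fixes s :: nat and V :: "nat set" and D r :: nat
    and l :: "nat \<Rightarrow> nat \<Rightarrow> 'a::comm_ring_1" and c :: "nat \<Rightarrow> nat \<Rightarrow> nat \<Rightarrow> 'a" and c0 :: 'a
    and F :: "nat \<Rightarrow> nat \<Rightarrow> 'a mpoly" and L :: "nat \<Rightarrow> nat \<Rightarrow> nat \<Rightarrow> 'a mpoly"
    and P :: "nat \<Rightarrow> symbol \<Rightarrow> 'a mpoly"
  assumes linear: "\<And>g. g < s \<Longrightarrow> F g 1 = (\<Sum>v\<in>V. mconst (l g v) * mvar v)"
    and quad: "\<And>g d. g < s \<Longrightarrow> d \<ge> 2 \<Longrightarrow>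
      F g d = (\<Sum>a<s. \<Sum>b<s. mconst (c g a b) * (\<Sum>j\<in>{1..<d}. F a j * F b (d - j)))"
    and V: "finite V" and r: "r < s"
  defines "L \<equiv> \<lambda>b g x. \<Sum>z<s. (mconst (c g z x) + mconst (c g x z)) * F z b"
  defines "P \<equiv> tree_value (grammar_rules s V D r) (split_weight l c c0) terminal"
begin

lemma P_Suc:
  assumes "\<sigma> \<in> grammar_symbols s V D"
  shows "P (Suc k) \<sigma> = (\<Sum>ts\<in>split_rules s V D r \<sigma>. mconst (split_weight l c c0 (\<sigma> # ts)) *
     (P k (ts ! 0) * P k (ts ! 1) * P k (ts ! 2)))"
proof -
  have "{ts. \<sigma> # ts \<in> grammar_rules s V D r} = split_rules s V D r \<sigma>"
    using assms by (auto simp: grammar_rules_def)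
  moreover have "{..<3} = {0, 1, 2 :: nat}" by auto
  ultimately show ?thesis by (simp add: P_def mult.assoc)
qed

lemma P_One: "P k One = 1"
proof (induction k)
  case 0
  show ?case by (simp add: P_def mconst_1)
next
  case (Suc k)
  then show ?case by (simp add: P_Suc grammar_symbols_iff mconst_1)
qed

lemma P_Var: "v \<in> V \<Longrightarrow> P k (Var v) = mvar v"
proof (induction k)
  case 0
  show ?case by (simp add: P_def)
next
  case (Suc k)
  then show ?case by (simp add: P_Suc grammar_symbols_iff mconst_1 P_One)
qed

lemma P_Comp_1:
  assumes "g < s" "1 \<le> D"
  shows "P (Suc k) (Comp g 1) = F g 1"
proof -
  have "inj_on (\<lambda>v. [Var v, One, One]) V" by (auto simp: inj_on_def)
  then show ?thesis
    using assms by (simp add: P_Suc grammar_symbols_iff sum.reindex linear[unfolded One_nat_def] P_One P_Var)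
qed

lemma P_Ctx_0:
  assumes "g < s" "h < s"
  shows "P (Suc k) (Ctx g h 0) = resolvent s L 0 g h"
  using assms by (simp add: P_Suc grammar_symbols_iff P_One mconst_0 mconst_1)

text \<open>\<open>quadratic_expansion\<close> with \<open>m = d div 2\<close>: the range of
  \<open>e\<close> bounds \<open>d - e\<close> by \<open>m\<close>, and \<open>J e\<close> bounds
  \<open>j\<close> and \<open>e - j\<close>, so all three factors have at most half the
  degree.\<close>

lemma P_Comp_step:
  assumes g: "g < s" and d: "2 \<le> d" "d \<le> D"
    and Ctx: "\<And>g h j. g < s \<Longrightarrow> h < s \<Longrightarrow> j \<le> d div 2 \<Longrightarrow> P k (Ctx g h j) = resolvent s L j g h"
    and Comp: "\<And>g j. g < s \<Longrightarrow> 1 \<le> j \<Longrightarrow> j \<le> d div 2 \<Longrightarrow> P k (Comp g j) = F g j"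
  shows "P (Suc k) (Comp g d) = F g d"
proof -
  define m where "m = d div 2"
  define J where "J e = {j. 1 \<le> j \<and> j \<le> m \<and> j < e \<and> e \<le> j + m}" for e
  have finJ: "finite (J e)" for e by (rule finite_subset[of _ "{..m}"]) (auto simp: J_def)
  let ?I = "SIGMA e:{m<..d}. {..<s} \<times> {..<s} \<times> {..<s} \<times> J e"
  let ?f = "\<lambda>(e, x, a, b, j). [Ctx g x (d - e), Comp a j, Comp b (e - j)]"
  have inj: "inj_on ?f ?I" by (auto simp: inj_on_def J_def)
  have "P (Suc k) (Comp g d) = (\<Sum>ts\<in>?f ` ?I. mconst (split_weight l c c0 (Comp g d # ts)) *
     (P k (ts ! 0) * P k (ts ! 1) * P k (ts ! 2)))"
    using g d by (simp add: P_Suc grammar_symbols_iff J_def m_def)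
  also have "\<dots> = (\<Sum>(e, x, a, b, j)\<in>?I. mconst (c x a b) *
      (P k (Ctx g x (d - e)) * P k (Comp a j) * P k (Comp b (e - j))))"
    unfolding sum.reindex[OF inj] by (rule sum.cong) auto
  also have "\<dots> = (\<Sum>(e, x, a, b, j)\<in>?I. resolvent s L (d - e) g x *
      (mconst (c x a b) * (F a j * F b (e - j))))"
  proof (rule sum.cong)
    fix i assume "i \<in> ?I"
    then obtain e x a b j where i: "i = (e, x, a, b, j)" "e \<in> {m<..d}" "x < s" "a < s" "b < s" "j \<in> J e"
      by auto
    have "d - e \<le> d div 2" "1 \<le> j" "j \<le> d div 2" "1 \<le> e - j" "e - j \<le> d div 2"
      using i d by (auto simp: J_def m_def)
    then show "(case i of (e, x, a, b, j) \<Rightarrow> mconst (c x a b) *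
        (P k (Ctx g x (d - e)) * P k (Comp a j) * P k (Comp b (e - j)))) =
      (case i of (e, x, a, b, j) \<Rightarrow> resolvent s L (d - e) g x * (mconst (c x a b) * (F a j * F b (e - j))))"
      using i g by (simp add: Ctx Comp mult_ac)
  qed simp
  also have "\<dots> = (\<Sum>e\<in>{m<..d}. \<Sum>x<s. \<Sum>a<s. \<Sum>b<s. \<Sum>j\<in>J e. resolvent s L (d - e) g x *
      (mconst (c x a b) * (F a j * F b (e - j))))"
    using finJ by (simp add: sum.Sigma split_def)
  also have "\<dots> = (\<Sum>e\<in>{m<..d}. \<Sum>x<s. resolvent s L (d - e) g x *
      (\<Sum>a<s. \<Sum>b<s. mconst (c x a b) * (\<Sum>j\<in>J e. F a j * F b (e - j))))"
    by (simp add: sum_distrib_left)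
  also have "\<dots> = F g d"
    unfolding L_def J_def
    by (rule quadratic_expansion[OF quad, symmetric]) (use g d in \<open>auto simp: m_def\<close>)
  finally show ?thesis .
qed

text \<open>Only the two outer resolvents are halved here; the component between them can have
  degree up to \<open>j\<close>, so \<open>Comp\<close> is assumed correct up to
  \<open>j\<close>.\<close>

lemma P_Ctx_step:
  assumes gh: "g < s" "h < s" and j: "1 \<le> j" "j \<le> D"
    and Ctx: "\<And>g h i. g < s \<Longrightarrow> h < s \<Longrightarrow> i \<le> j div 2 \<Longrightarrow> P k (Ctx g h i) = resolvent s L i g h"
    and Comp: "\<And>g i. g < s \<Longrightarrow> 1 \<le> i \<Longrightarrow> i \<le> j \<Longrightarrow> P k (Comp g i) = F g i"
  shows "P (Suc k) (Ctx g h j) = resolvent s L j g h"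
proof -
  define m where "m = j div 2"
  let ?I = "{m<..j} \<times> {..<s} \<times> {..m} \<times> {..<s} \<times> {..<s}"
  let ?f = "\<lambda>(e, x, k, y, z). [Ctx g x (j - e), Comp z (e - k), Ctx y h k]"
  have inj: "inj_on ?f ?I" by (auto simp: inj_on_def)
  have "P (Suc k) (Ctx g h j) = (\<Sum>ts\<in>?f ` ?I. mconst (split_weight l c c0 (Ctx g h j # ts)) *
     (P k (ts ! 0) * P k (ts ! 1) * P k (ts ! 2)))"
    using gh j by (simp add: P_Suc grammar_symbols_iff m_def)
  also have "\<dots> = (\<Sum>(e, x, i, y, z)\<in>?I. mconst (c x z y + c x y z) *
      (P k (Ctx g x (j - e)) * P k (Comp z (e - i)) * P k (Ctx y h i)))"
    unfolding sum.reindex[OF inj] by (rule sum.cong) auto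
  also have "\<dots> = (\<Sum>(e, x, i, y, z)\<in>?I. resolvent s L (j - e) g x *
      ((mconst (c x z y) + mconst (c x y z)) * F z (e - i) * resolvent s L i y h))"
  proof (rule sum.cong)
    fix t assume "t \<in> ?I"
    then obtain e x i y z where t: "t = (e, x, i, y, z)" "e \<in> {m<..j}" "x < s" "i \<le> m" "y < s" "z < s"
      by auto
    have "j - e \<le> j div 2" "i \<le> j div 2" "1 \<le> e - i" "e - i \<le> j"
      using t by (auto simp: m_def)
    then show "(case t of (e, x, i, y, z) \<Rightarrow> mconst (c x z y + c x y z) *
        (P k (Ctx g x (j - e)) * P k (Comp z (e - i)) * P k (Ctx y h i))) =
      (case t of (e, x, i, y, z) \<Rightarrow> resolvent s L (j - e) g x *
        ((mconst (c x z y) + mconst (c x y z)) * F z (e - i) * resolvent s L i y h))"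
      using t gh by (simp add: Ctx Comp mconst_add mult_ac)
  qed simp
  also have "\<dots> = (\<Sum>e\<in>{m<..j}. \<Sum>x<s. \<Sum>i\<le>m. \<Sum>y<s. \<Sum>z<s. resolvent s L (j - e) g x *
      ((mconst (c x z y) + mconst (c x y z)) * F z (e - i) * resolvent s L i y h))"
    by (simp add: sum.Sigma split_def)
  also have "\<dots> = (\<Sum>e\<in>{m<..j}. \<Sum>x<s. resolvent s L (j - e) g x *
      (\<Sum>i\<le>m. \<Sum>y<s. L (e - i) x y * resolvent s L i y h))"
    by (simp add: L_def sum_distrib_left sum_distrib_right)
  also have "\<dots> = resolvent s L j g h"
    unfolding L_def
    by (rule resolvent_balanced[OF quad, symmetric]) (use gh j in \<open>auto simp: m_def\<close>)
  finally show ?thesis .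
qed

text \<open>Doubling the degree takes two levels: first \<open>Comp\<close>, from halved
  \<open>Comp\<close> and \<open>Ctx\<close>, then \<open>Ctx\<close>, which needs
  \<open>Comp\<close> up to the new degree. Correctness for every larger \<open>k\<close> is needed
  because the three subtrees of a node share one depth while their degrees differ; surplus levels
  are filled by the self-reproducing terminals.\<close>

lemma P_correct:
  "(\<forall>k g i. 2 * n + 1 \<le> k \<and> g < s \<and> 1 \<le> i \<and> i \<le> 2 ^ n \<and> i \<le> D \<longrightarrow> P k (Comp g i) = F g i) \<and>
   (\<forall>k g h j. 2 * n + 2 \<le> k \<and> g < s \<and> h < s \<and> j \<le> 2 ^ n \<and> j \<le> D \<longrightarrow>
      P k (Ctx g h j) = resolvent s L j g h)"
proof (induction n)
  case 0
  have comp: "P k (Comp g i) = F g i" if "1 \<le> k" "g < s" "i = 1" "i \<le> D" for k g i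
    using that P_Comp_1[of g "k - 1"] by auto
  have "P k (Ctx g h j) = resolvent s L j g h" if *: "2 \<le> k" "g < s" "h < s" "j \<le> 1" "j \<le> D" for k g h j
  proof -
    obtain k' where k': "k = Suc (Suc k')" using *(1) by (metis Suc_le_D Suc_le_mono numeral_2_eq_2)
    show ?thesis
    proof (cases "j = 0")
      case True
      then show ?thesis using P_Ctx_0 * k' by simp
    next
      case False
      then have "j = 1" using * by simp
      show ?thesis
        unfolding k' by (rule P_Ctx_step)
          (use * \<open>j = 1\<close> in \<open>auto simp: P_Ctx_0 intro!: comp simp del: resolvent.simps\<close>)
    qed
  qed
  with comp show ?case by auto
next
  case (Suc n)
  have comp: "P k (Comp g i) = F g i" if *: "2 * n + 3 \<le> k" "g < s" "1 \<le> i" "i \<le> 2 ^ Suc n" "i \<le> D" for k g i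
  proof (cases "i = 1")
    case True
    then show ?thesis using P_Comp_1[of g "k - 1"] * by simp
  next
    case False
    obtain k' where k': "k = Suc k'" "2 * n + 2 \<le> k'" using *(1) by (cases k) auto
    have half: "i div 2 \<le> 2 ^ n" "i div 2 \<le> D" using * by auto
    show ?thesis
      unfolding k'(1) by (rule P_Comp_step) (use half Suc.IH * False k'(2) in auto)
  qed
  have "P k (Ctx g h j) = resolvent s L j g h"
    if *: "2 * n + 4 \<le> k" "g < s" "h < s" "j \<le> 2 ^ Suc n" "j \<le> D" for k g h j
  proof -
    obtain k' where k': "k = Suc k'" "2 * n + 3 \<le> k'" using *(1) by (cases k) auto
    show ?thesis
    proof (cases "j = 0")
      case True
      then show ?thesis using P_Ctx_0 * k' by simp
    next
      case False
      have half: "j div 2 \<le> 2 ^ n" "j div 2 \<le> D" using * by auto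
      show ?thesis
        unfolding k'(1) by (rule P_Ctx_step) (use half Suc.IH comp * False k'(2) in auto)
    qed
  qed
  with comp show ?case by simp
qed

text \<open>The quadratic system describes positive degrees only; the constant term enters as the
  weight of the rule from \<open>Start\<close> to \<open>[One, One, One]\<close>.\<close>

lemma P_Start:
  assumes "2 * n + 1 \<le> k" "D \<le> 2 ^ n"
  shows "P (Suc k) Start = mconst c0 + (\<Sum>i\<in>{1..D}. F r i)"
proof -
  have inj: "inj_on (\<lambda>i. [Comp r i, One, One]) {1..D}" by (auto simp: inj_on_def)
  have "P k (Comp r i) = F r i" if "i \<in> {1..D}" for i
    using P_correct[of n] that assms r by auto
  then have "(\<Sum>ts\<in>(\<lambda>i. [Comp r i, One, One]) ` {1..D}. mconst (split_weight l c c0 (Start # ts)) *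
     (P k (ts ! 0) * P k (ts ! 1) * P k (ts ! 2))) = (\<Sum>i\<in>{1..D}. F r i)"
    unfolding sum.reindex[OF inj] by (simp add: P_One mconst_1)
  moreover have "[One, One, One] \<notin> (\<lambda>i. [Comp r i, One, One]) ` {1..D}" by auto
  ultimately show ?thesis by (simp add: P_Suc grammar_symbols_iff P_One)
qed

end

subsection \<open>Circuits as projections of tree queries\<close>

lemma circuit_projection_tree_query:
  fixes f :: "'a::comm_ring_1 mpoly"
  assumes C: "circ_computes C f" "length C \<le> t" and deg: "total_degree f \<le> t"
  defines "q \<equiv> 2 + t + t * (t + 1) + t * t * (t + 1)"
  shows "\<exists>Q. cq_wf Q \<and> cq_quantifier_free Q \<and> cq_hypergraph_tree Q \<and>
     cq_size Q \<le> (q ^ 4 + q) + 81 * (2 * t + 2) ^ 4 * (13 + 9 * (q ^ 4 + q) ^ 2) \<and>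
     is_projection f (cq_poly Q)"
proof -
  define s where "s = length C"
  define V where "V = {v. GVar v \<in> set C}"
  have s: "1 \<le> s" "s \<le> t" using C by (auto simp: s_def circ_computes_def Suc_le_eq)
  define r where "r = s - 1"
  have r: "r < s" using s by (simp add: r_def)
  have f: "f = circ_vals C ! r"
  proof -
    have "1 \<le> length (circ_vals C)" using s by (simp add: s_def)
    then have "circ_vals C \<noteq> []" by (metis list.size(3) not_one_le_zero)
    then show ?thesis using C by (simp add: circ_computes_def r_def s_def last_conv_nth)
  qed
  note sys = circuit_quadratic_system[of C, folded s_def V_def]
  define F where "F g i = hom_comp i (circ_vals C ! g)" for g i
  from sys(3) obtain l c where
    linear: "\<And>g. g < s \<Longrightarrow> F g 1 = (\<Sum>v\<in>V. mconst (l g v) * mvar v)" and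
    quad: "\<And>g d. g < s \<Longrightarrow> d \<ge> 2 \<Longrightarrow>
      F g d = (\<Sum>a<s. \<Sum>b<s. mconst (c g a b) * (\<Sum>j\<in>{1..<d}. F a j * F b (d - j)))"
    unfolding F_def by blast
  define D where "D = t"
  define n where "n = (LEAST n. D \<le> 2 ^ n)"
  have n: "D \<le> 2 ^ n" unfolding n_def by (rule LeastI[of _ D]) (simp add: less_imp_le)
  \<comment> \<open>By minimality of \<open>n\<close> the power is at most twice \<open>D\<close>;
    the \<open>+ 1\<close> covers \<open>n = 0\<close>, where \<open>D\<close> may be 0.\<close>
  have n': "2 ^ n \<le> 2 * D + 1"
  proof (cases n)
    case (Suc n')
    then have "\<not> D \<le> 2 ^ n'" unfolding n_def by (metis lessI not_less_Least)
    then show ?thesis using Suc by simp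
  qed simp
  \<comment> \<open>\<open>2 * n + 1\<close> levels for components of degree up to
    \<open>2 ^ n\<close>, and one for the rule at \<open>Start\<close>.\<close>
  define k where "k = 2 * n + 2"
  define c0 where "c0 = Poly_Mapping.lookup f 0"
  let ?Sym = "grammar_symbols s V D" and ?R = "grammar_rules s V D r"
  let ?Q = "tree_query ?Sym ?R k Start"
  note fin = card_grammar_symbols(1)[OF sys(1)] card_grammar_rules(1)[OF r sys(1)]
  have wf: "\<And>v. v \<in> ?R \<Longrightarrow> length v = 4 \<and> set v \<subseteq> ?Sym" by (rule grammar_rules_wf[OF r])
  have k: "1 \<le> k" by (simp add: k_def)
  have Start: "Start \<in> ?Sym" by (simp add: grammar_symbols_def)
  note tq = fin wf k Start
  have "f = (\<Sum>i\<le>D. hom_comp i f)" by (rule sum_hom_comp) (use deg D_def in simp)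
  also have "{..D} = insert 0 {1..D}" by auto
  also have "(\<Sum>i\<in>insert 0 {1..D}. hom_comp i f) = mconst c0 + (\<Sum>i\<in>{1..D}. F r i)"
    by (simp add: hom_comp_0 c0_def F_def f)
  also have "\<dots> = tree_value ?R (split_weight l c c0) terminal (Suc (2 * n + 1)) Start"
    by (rule P_Start[OF linear quad sys(1) r order_refl n, symmetric])
  also have "Suc (2 * n + 1) = k" by (simp add: k_def)
  finally have val: "f = tree_value ?R (split_weight l c c0) terminal k Start" .
  have leaf: "(terminal \<sigma> :: 'a mpoly) \<in> range mconst \<or> (terminal \<sigma> :: 'a mpoly) \<in> range mvar" for \<sigma>
    by (cases \<sigma>) auto
  have proj: "is_projection f (cq_poly ?Q)"
    unfolding val by (rule is_projection_tree_query[OF tq leaf])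
  have "card ?Sym \<le> 2 + card V + s * (D + 1) + s * s * (D + 1)"
    by (rule card_grammar_symbols(2)[OF sys(1)])
  also have "\<dots> \<le> q"
    unfolding q_def D_def using s sys(2) by (intro add_mono mult_le_mono) auto
  finally have Sym: "card ?Sym \<le> q" .
  have "card ?R \<le> q ^ 4"
    using card_grammar_rules(2)[OF r sys(1)] power_mono[OF Sym, of 4] by (meson le0 le_trans)
  then have q: "card ?R + card ?Sym \<le> q ^ 4 + q" using Sym by simp
  have "(3::nat) ^ (k + 1) = 27 * 9 ^ n"
    by (simp add: k_def power_add power_mult)
  \<comment> \<open>Raising 9 to 16 turns the bound into a fourth power of \<open>2 ^ n\<close>,
    which is linear in \<open>t\<close>.\<close>
  also have "\<dots> \<le> 27 * 16 ^ n" by (intro mult_le_mono power_mono) auto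
  also have "(16::nat) ^ n = (2 ^ n) ^ 4" using power_mult[of "2::nat" 4 n] power_mult[of "2::nat" n 4] by (simp add: mult.commute)
  also have "27 * (2 ^ n) ^ 4 \<le> 81 * (2 * t + 2) ^ 4"
    by (intro mult_le_mono power_mono) (use n' D_def in auto)
  finally have addr: "3 ^ (k + 1) \<le> 81 * (2 * t + 2) ^ 4" .
  have "cq_size ?Q \<le> (card ?R + card ?Sym) + 3 ^ (k + 1) * (13 + 9 * (card ?R + card ?Sym) ^ 2)"
    by (rule cq_size_tree_query[OF tq])
  also have "\<dots> \<le> (q ^ 4 + q) + 81 * (2 * t + 2) ^ 4 * (13 + 9 * (q ^ 4 + q) ^ 2)"
    by (rule add_mono[OF q mult_le_mono[OF addr add_left_mono[OF mult_left_mono[OF power_mono[OF q]]]]]) simp_all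
  finally show ?thesis
    using proj cq_wf_tree_query[OF tq] cq_quantifier_free_tree_query[OF tq]
      cq_hypergraph_tree_tree_query[OF tq] by blast
qed

lemma VP_p_projection_tree_queries:
  fixes f :: "nat \<Rightarrow> 'a::field mpoly"
  assumes "in_VP f"
  shows "\<exists>\<Phi>. (\<forall>n. cq_wf (\<Phi> n) \<and> cq_quantifier_free (\<Phi> n) \<and> cq_hypergraph_tree (\<Phi> n)) \<and>
     poly_bounded (\<lambda>n. cq_size (\<Phi> n)) \<and> p_projection f (\<lambda>n. cq_poly (\<Phi> n))"
proof -
  obtain p where p: "\<And>n. total_degree (f n) \<le> poly p n"
    "\<And>n. \<exists>C. length C \<le> poly p n \<and> circ_computes C (f n)"
    using assms by (auto simp: in_VP_def)
  define q where "q n = 2 + poly p n + poly p n * (poly p n + 1) + poly p n * poly p n * (poly p n + 1)" for n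
  define B where "B n = (q n ^ 4 + q n) + 81 * (2 * poly p n + 2) ^ 4 * (13 + 9 * (q n ^ 4 + q n) ^ 2)" for n
  have "\<exists>Q. cq_wf Q \<and> cq_quantifier_free Q \<and> cq_hypergraph_tree Q \<and> cq_size Q \<le> B n \<and>
     is_projection (f n) (cq_poly Q)" for n
    using circuit_projection_tree_query p unfolding B_def q_def by blast
  then obtain \<Phi> where \<Phi>: "\<And>n. cq_wf (\<Phi> n) \<and> cq_quantifier_free (\<Phi> n) \<and> cq_hypergraph_tree (\<Phi> n)"
    "\<And>n. cq_size (\<Phi> n) \<le> B n" "\<And>n. is_projection (f n) (cq_poly (\<Phi> n))"
    by metis
  have "poly_bounded B" unfolding B_def q_def by (intro poly_bounded_intros)
  then have "poly_bounded (\<lambda>n. cq_size (\<Phi> n))" using \<Phi>(2) by (rule poly_bounded_mono)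
  moreover have "p_projection f (\<lambda>n. cq_poly (\<Phi> n))"
    \<comment> \<open>The index polynomial is the identity.\<close>
    unfolding p_projection_def by (rule exI[of _ "[:0, 1:]"]) (simp add: \<Phi>(3))
  ultimately show ?thesis using \<Phi>(1) by blast
qed

theorem mainTheorem17:
  shows "(\<forall>\<Phi> :: nat \<Rightarrow> cq.
            (\<forall>n. cq_wf (\<Phi> n) \<and> cq_acyclic (\<Phi> n)) \<and>
            (\<exists>p :: nat poly. \<forall>n. cq_size (\<Phi> n) \<le> poly p n) \<and>
            (\<exists>c. \<forall>n. quantified_star_size (\<Phi> n) \<le> c)
          \<longrightarrow> in_VP (\<lambda>n. cq_poly (\<Phi> n) :: 'a::field mpoly))
       \<and> (\<forall>f :: nat \<Rightarrow> 'a mpoly. in_VP f \<longrightarrow>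
            (\<exists>\<Phi> :: nat \<Rightarrow> cq.
               (\<forall>n. cq_wf (\<Phi> n) \<and> cq_quantifier_free (\<Phi> n) \<and> cq_hypergraph_tree (\<Phi> n)) \<and>
               (\<exists>p :: nat poly. \<forall>n. cq_size (\<Phi> n) \<le> poly p n) \<and>
               p_projection f (\<lambda>n. cq_poly (\<Phi> n))))"
proof (intro conjI allI impI)
  fix \<Phi> :: "nat \<Rightarrow> cq"
  assume "(\<forall>n. cq_wf (\<Phi> n) \<and> cq_acyclic (\<Phi> n)) \<and>
            (\<exists>p :: nat poly. \<forall>n. cq_size (\<Phi> n) \<le> poly p n) \<and>
            (\<exists>c. \<forall>n. quantified_star_size (\<Phi> n) \<le> c)"
  then obtain c where "\<And>n. cq_wf (\<Phi> n)" "\<And>n. cq_acyclic (\<Phi> n)"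
    "poly_bounded (\<lambda>n. cq_size (\<Phi> n))" "\<And>n. quantified_star_size (\<Phi> n) \<le> c"
    unfolding poly_bounded_def by blast
  then show "in_VP (\<lambda>n. cq_poly (\<Phi> n) :: 'a mpoly)" by (rule in_VP_cq_poly)
next
  fix f :: "nat \<Rightarrow> 'a mpoly"
  assume "in_VP f"
  from VP_p_projection_tree_queries[OF this]
  show "\<exists>\<Phi> :: nat \<Rightarrow> cq.
               (\<forall>n. cq_wf (\<Phi> n) \<and> cq_quantifier_free (\<Phi> n) \<and> cq_hypergraph_tree (\<Phi> n)) \<and>
               (\<exists>p :: nat poly. \<forall>n. cq_size (\<Phi> n) \<le> poly p n) \<and>
               p_projection f (\<lambda>n. cq_poly (\<Phi> n))"
    unfolding poly_bounded_def .
qed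

end
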